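(* Let $A$ be an irreducible affine Cartan matrix which is not of type $B_n^{(1)}, C_n^{(1)}, F_4^{(1)}, G_2^{(1)}$, let $\mathcal A_{\tilde W}$ be the associated double affine Artin group, let $w_\circ$ be the longest element of the finite Weyl group $\mathring W$, and let $B_3$ act on $\mathcal A_{\tilde W}$ via $\mathfrak a\mapsto\underline{\mathfrak a}$, $\mathfrak b\mapsto\underline{\mathfrak b}$. This action induces a group morphism from ${\rm PSL}(2,\mathbb Z)$ (if $w_\circ=-1$), respectively from ${\rm SL}(2,\mathbb Z)$ (if $w_\circ\ne-1$), to the outer automorphism group of $\mathcal A_{\tilde W}$; that is, the composite $B_3\to\mathrm{Aut}(\mathcal A_{\tilde W})\to\mathrm{Out}(\mathcal A_{\tilde W})$ factors through the surjection $B_3\to{\rm SL}(2,\mathbb Z)\to{\rm PSL}(2,\mathbb Z)$, respectively through $\pi:B_3\to{\rm SL}(2,\mathbb Z)$.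
   Context: $A=(a_{jk})_{0\le j,k\le n}$ is an irreducible affine Cartan matrix, labelled as in Kac's book, node $0$ being the affine node; types $B_n^{(1)}, C_n^{(1)}, F_4^{(1)}, G_2^{(1)}$ are excluded. In the Dynkin diagram distinct nodes $i,j$ are connected by $a_{ij}a_{ji}$ laces. The braid relation between elements $x,y$ attached to distinct nodes $i,j$ is $xyx\cdots=yxy\cdots$ with $m_{ij}$ factors on each side, $m_{ij}=2,3,4,6$ for $0,1,2,3$ laces (no relation for $4$ laces, which happens only when $n=1$). $B_3=\langle\mathfrak a,\mathfrak b\mid\mathfrak a\mathfrak b\mathfrak a=\mathfrak b\mathfrak a\mathfrak b\rangle$; the surjective morphism $\pi:B_3\to{\rm SL}(2,\mathbb Z)$ is given by $\pi(\mathfrak a)=\begin{pmatrix}1&1\\0&1\end{pmatrix}$, $\pi(\mathfrak b)=\begin{pmatrix}1&0\\-1&1\end{pmatrix}$. Root data. $(a_0,\dots,a_n)$, $(a_0^\vee,\dots,a_n^\vee)$ are Kac's numerical labels of $S(A)$ and $S(A^t)$ ($a_0=1$ except $a_0=2$ for $A_{2n}^{(2)}$). Let $\alpha_0,\dots,\alpha_n$ be the simple roots, $\delta=\sum_j a_j\alpha_j$, $\theta=\delta-a_0\alpha_0$, $d_j=a_j/a_j^\vee$; on the real span of the $\alpha_j$ take the form $(\alpha_j,\alpha_k)=d_j^{-1}a_{jk}$, and put $\alpha_j^\vee=d_j\alpha_j$, $s_j(x)=x-(x,\alpha_j^\vee)\alpha_j$. The finite Weyl group $\mathring W$ is generated by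 $s_1,\dots,s_n$; $w_\circ=-1$ means that $w_\circ$ acts as $-1$ on the span of $\alpha_1,\dots,\alpha_n$. $s_\theta\in\mathring W$ is the reflection in $\theta$, and $T_{s_\theta}=T_{j_1}\cdots T_{j_m}$ for a reduced decomposition $s_\theta=s_{j_1}\cdots s_{j_m}$. The lattice $\mathring Q$ is $\bigoplus_{j=1}^n\mathbb Z\alpha_j$, except for $A_{2n}^{(2)}$ where it is $\bigoplus_{j=1}^{n-1}\mathbb Z\alpha_j\oplus\mathbb Z\tfrac12\alpha_n$ (the weight lattice of the finite root system). Put $\hat\alpha_i^\vee=\alpha_i^\vee$ for all $i$, except $\hat\alpha_n^\vee=2\alpha_n^\vee$ (the coroot of $\frac12\alpha_n$) for $A_{2n}^{(2)}$. The affine Artin group $\mathcal A_W$ has generators $T_0,\dots,T_n$ and the braid relations for all pairs of distinct nodes. The double affine Artin group $\mathcal A_{\tilde W}$ is generated by $\mathcal A_W$, the lattice $\{X_\beta:\beta\in\mathring Q\}$ (with $X_\beta X_\gamma=X_{\beta+\gamma}$) and an element $X_{a_0^{-1}\delta}$, with $X_{\beta+k a_0^{-1}\delta}:=X_\beta X_{a_0^{-1}\delta}^k$, subject to, for all $0\le i\le n$ and $\beta\in\mathring Q$: (i) $X_{a_0^{-1}\delta}$ is central; (ii) $T_iX_\beta=X_\beta T_i$ if $(\beta,\hat\alpha_i^\vee)=0$; (iii) $T_iX_\beta T_i=X_{s_i(\beta)}$ if $(\beta,\hat\alpha_i^\vee)=-1$. Put $T_{01}=T_0$, $T_{02}=T_0^{-1}X_{\alpha_0}$,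 $T_{03}=X_{a_0^{-1}\theta}T_{s_\theta}^{-1}$; these together with the $T_i$ ($i\ne0$) generate $\mathcal A_{\tilde W}$. The automorphisms $\underline{\mathfrak a},\underline{\mathfrak b}$ of $\mathcal A_{\tilde W}$ fix all $T_i$, $i\neq0$, and are given by $\underline{\mathfrak a}:T_{03}\mapsto T_{03},\ T_{01}\mapsto T_{02},\ T_{02}\mapsto T_{02}^{-1}T_{01}T_{02}$ and $\underline{\mathfrak b}:T_{01}\mapsto T_{01},\ T_{02}\mapsto T_{03},\ T_{03}\mapsto T_{03}^{-1}T_{02}T_{03}$. *)

theory Defs
  imports "HOL-Analysis.Determinants" "HOL-Algebra.Bij" "HOL-Algebra.Coset"
begin

section \<open>Groups given by generators and relations\<close>

datatype 'g letter = Pos 'g | Neg 'g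

type_synonym 'g word = "'g letter list"

definition words :: "'g set \<Rightarrow> 'g word set" where
  "words S = lists (Pos ` S \<union> Neg ` S)"

text \<open>A relation \<open>u = v\<close> is a pair of words.  All relations used below are between words over
  the generating set, so the side conditions of \<open>rel\<close> discard nothing.\<close>

inductive pres_eq :: "'g set \<Rightarrow> ('g word \<times> 'g word) set \<Rightarrow> 'g word \<Rightarrow> 'g word \<Rightarrow> bool"
  for S R where
  refl: "w \<in> words S \<Longrightarrow> pres_eq S R w w"
| sym: "pres_eq S R u v \<Longrightarrow> pres_eq S R v u"
| trans: "pres_eq S R u v \<Longrightarrow> pres_eq S R v w \<Longrightarrow> pres_eq S R u w"
| cong: "pres_eq S R u u' \<Longrightarrow> pres_eq S R v v' \<Longrightarrow> pres_eq S R (u @ v) (u' @ v')"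
| right_inv: "g \<in> S \<Longrightarrow> pres_eq S R [Pos g, Neg g] []"
| left_inv: "g \<in> S \<Longrightarrow> pres_eq S R [Neg g, Pos g] []"
| rel: "(u, v) \<in> R \<Longrightarrow> u \<in> words S \<Longrightarrow> v \<in> words S \<Longrightarrow> pres_eq S R u v"

definition word_class :: "'g set \<Rightarrow> ('g word \<times> 'g word) set \<Rightarrow> 'g word \<Rightarrow> 'g word set" where
  "word_class S R w = {v. pres_eq S R w v}"

definition presented_group :: "'g set \<Rightarrow> ('g word \<times> 'g word) set \<Rightarrow> 'g word set monoid" where
  "presented_group S R =
     \<lparr>carrier = word_class S R ` words S,
      monoid.mult = (\<lambda>P Q. {w. \<exists>u\<in>P. \<exists>v\<in>Q. pres_eq S R (u @ v) w}),
      one = word_class S R []\<rparr>"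

fun word_eval :: "('h, 'm) monoid_scheme \<Rightarrow> ('g \<Rightarrow> 'h) \<Rightarrow> 'g word \<Rightarrow> 'h" where
  "word_eval H f [] = \<one>\<^bsub>H\<^esub>"
| "word_eval H f (Pos g # w) = f g \<otimes>\<^bsub>H\<^esub> word_eval H f w"
| "word_eval H f (Neg g # w) = inv\<^bsub>H\<^esub> (f g) \<otimes>\<^bsub>H\<^esub> word_eval H f w"

text \<open>The map from a presented group to \<open>H\<close> given on the generators by \<open>f\<close>.  It is meaningful
  only if \<open>f\<close> respects the relations, so that all words in a class \<open>P\<close> have the same value.\<close>

definition pres_lift :: "('h, 'm) monoid_scheme \<Rightarrow> ('g \<Rightarrow> 'h) \<Rightarrow> 'g word set \<Rightarrow> 'h" where
  "pres_lift H f P = the_elem (word_eval H f ` P)"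

lemma words_append: "u \<in> words S \<Longrightarrow> v \<in> words S \<Longrightarrow> u @ v \<in> words S"
  by (auto simp: words_def)

lemma pres_eq_words: "pres_eq S R u v \<Longrightarrow> u \<in> words S \<and> v \<in> words S"
  by (induction rule: pres_eq.induct) (auto simp: words_def)

lemma word_class_eq: "pres_eq S R u v \<Longrightarrow> word_class S R u = word_class S R v"
  unfolding word_class_def by (blast intro: pres_eq.sym pres_eq.trans)

lemma presented_group_mult:
  assumes "u \<in> words S" "v \<in> words S"
  shows "word_class S R u \<otimes>\<^bsub>presented_group S R\<^esub> word_class S R v = word_class S R (u @ v)"
  unfolding presented_group_def word_class_def monoid.simps
proof (intro Collect_cong iffI)
  fix w assume "\<exists>u'\<in>{v. pres_eq S R u v}. \<exists>v'\<in>{w. pres_eq S R v w}. pres_eq S R (u' @ v') w"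
  thus "pres_eq S R (u @ v) w" by (blast intro: pres_eq.cong pres_eq.trans)
next
  fix w assume "pres_eq S R (u @ v) w"
  thus "\<exists>u'\<in>{v. pres_eq S R u v}. \<exists>v'\<in>{w. pres_eq S R v w}. pres_eq S R (u' @ v') w"
    using assms by (blast intro: pres_eq.refl)
qed

lemma word_left_inverse:
  assumes "w \<in> words S" shows "\<exists>w'\<in>words S. pres_eq S R (w' @ w) []"
  using assms
proof (induction w)
  case Nil thus ?case by (auto intro!: bexI[of _ "[]"] pres_eq.refl)
next
  case (Cons x w)
  then have w: "w \<in> words S" by (auto simp: words_def)
  with Cons obtain w' where w': "w' \<in> words S" "pres_eq S R (w' @ w) []" by auto
  obtain y where y: "[y] \<in> words S" "pres_eq S R [y, x] []"
  proof (cases x)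
    case (Pos g) with Cons.prems show ?thesis
      by (intro that[of "Neg g"]) (auto simp: words_def intro: pres_eq.left_inv)
  next
    case (Neg g) with Cons.prems show ?thesis
      by (intro that[of "Pos g"]) (auto simp: words_def intro: pres_eq.right_inv)
  qed
  have "pres_eq S R (w' @ ([y, x] @ w)) (w' @ ([] @ w))"
    by (intro pres_eq.cong pres_eq.refl w w' y)
  hence "pres_eq S R ((w' @ [y]) @ x # w) []" using w'(2) pres_eq.trans by fastforce
  thus ?case using w' y by (intro bexI[of _ "w' @ [y]"] words_append) auto
qed

lemma group_presented_group: "group (presented_group S R)"
proof (rule groupI)
  let ?G = "presented_group S R"
  have car: "carrier ?G = word_class S R ` words S" and one: "\<one>\<^bsub>?G\<^esub> = word_class S R []"
    by (simp_all add: presented_group_def)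
  have nil: "[] \<in> words S" by (simp add: words_def)
  show "\<one>\<^bsub>?G\<^esub> \<in> carrier ?G" using nil by (auto simp: car one)
  show "x \<otimes>\<^bsub>?G\<^esub> y \<in> carrier ?G" if "x \<in> carrier ?G" "y \<in> carrier ?G" for x y
    using that by (auto simp: car presented_group_mult words_append)
  show "x \<otimes>\<^bsub>?G\<^esub> y \<otimes>\<^bsub>?G\<^esub> z = x \<otimes>\<^bsub>?G\<^esub> (y \<otimes>\<^bsub>?G\<^esub> z)"
    if "x \<in> carrier ?G" "y \<in> carrier ?G" "z \<in> carrier ?G" for x y z
    using that by (auto simp: car presented_group_mult words_append)
  show "\<one>\<^bsub>?G\<^esub> \<otimes>\<^bsub>?G\<^esub> x = x" if "x \<in> carrier ?G" for x
    using that nil by (auto simp: car one presented_group_mult)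
  show "\<exists>y\<in>carrier ?G. y \<otimes>\<^bsub>?G\<^esub> x = \<one>\<^bsub>?G\<^esub>" if x: "x \<in> carrier ?G" for x
  proof -
    obtain w where w: "w \<in> words S" "x = word_class S R w" using x by (auto simp: car)
    obtain w' where "w' \<in> words S" "pres_eq S R (w' @ w) []"
      using word_left_inverse[OF w(1)] by blast
    thus ?thesis using w
      by (intro bexI[of _ "word_class S R w'"]) (auto simp: car one presented_group_mult word_class_eq)
  qed
qed

section \<open>Outer automorphisms\<close>

definition Inn :: "('a, 'm) monoid_scheme \<Rightarrow> ('a \<Rightarrow> 'a) set" where
  "Inn G = (\<lambda>g. \<lambda>x\<in>carrier G. g \<otimes>\<^bsub>G\<^esub> x \<otimes>\<^bsub>G\<^esub> inv\<^bsub>G\<^esub> g) ` carrier G"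

definition OutGroup :: "('a, 'm) monoid_scheme \<Rightarrow> ('a \<Rightarrow> 'a) set monoid" where
  "OutGroup G = AutoGroup G Mod Inn G"

definition out_class :: "('a, 'm) monoid_scheme \<Rightarrow> ('a \<Rightarrow> 'a) \<Rightarrow> ('a \<Rightarrow> 'a) set" where
  "out_class G f = Inn G #>\<^bsub>AutoGroup G\<^esub> f"

section \<open>The braid group on three strands and the modular group\<close>

datatype b3_gen = BA | BB

definition b3_rels :: "(b3_gen word \<times> b3_gen word) set" where
  "b3_rels = {([Pos BA, Pos BB, Pos BA], [Pos BB, Pos BA, Pos BB])}"

definition B3 :: "b3_gen word set monoid" where
  "B3 = presented_group UNIV b3_rels"

definition b3 :: "b3_gen \<Rightarrow> b3_gen word set" where
  "b3 g = word_class UNIV b3_rels [Pos g]"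

definition SL2Z :: "(int^2^2) monoid" where
  "SL2Z = \<lparr>carrier = {M. det M = 1}, monoid.mult = (**), one = mat 1\<rparr>"

definition PSL2Z :: "(int^2^2) set monoid" where
  "PSL2Z = SL2Z Mod {mat 1, - mat 1}"

definition psl_class :: "int^2^2 \<Rightarrow> (int^2^2) set" where
  "psl_class M = {mat 1, - mat 1} #>\<^bsub>SL2Z\<^esub> M"

fun b3_matrix :: "b3_gen \<Rightarrow> int^2^2" where
  "b3_matrix BA = vector [vector [1, 1], vector [0, 1]]"
| "b3_matrix BB = vector [vector [1, 0], vector [- 1, 1]]"

definition b3_to_SL2Z :: "b3_gen word set \<Rightarrow> int^2^2" where
  "b3_to_SL2Z = pres_lift SL2Z b3_matrix"

section \<open>Affine Cartan matrices\<close>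

text \<open>A matrix \<open>(A i j)\<close> with \<open>0 \<le> i, j \<le> n\<close> is a function \<open>A\<close> whose values at other indices are
  irrelevant.\<close>

definition gen_cartan_matrix :: "nat \<Rightarrow> (nat \<Rightarrow> nat \<Rightarrow> int) \<Rightarrow> bool" where
  "gen_cartan_matrix n A \<longleftrightarrow>
     (\<forall>i\<le>n. A i i = 2) \<and>
     (\<forall>i\<le>n. \<forall>j\<le>n. i \<noteq> j \<longrightarrow> A i j \<le> 0) \<and>
     (\<forall>i\<le>n. \<forall>j\<le>n. A i j = 0 \<longrightarrow> A j i = 0)"

definition indecomposable :: "nat \<Rightarrow> (nat \<Rightarrow> nat \<Rightarrow> int) \<Rightarrow> bool" where
  "indecomposable n A \<longleftrightarrow>
     (\<forall>I. I \<subseteq> {..n} \<and> I \<noteq> {} \<and> I \<noteq> {..n} \<longrightarrow> (\<exists>i\<in>I. \<exists>j\<in>{..n} - I. A i j \<noteq> 0))"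

text \<open>Affine type as in Kac's trichotomy: \<open>A\<close> has corank 1, some \<open>u > 0\<close> satisfies \<open>A u = 0\<close>, and
  \<open>A v \<ge> 0\<close> implies \<open>A v = 0\<close>.\<close>

definition irreducible_affine_cartan :: "nat \<Rightarrow> (nat \<Rightarrow> nat \<Rightarrow> int) \<Rightarrow> bool" where
  "irreducible_affine_cartan n A \<longleftrightarrow> gen_cartan_matrix n A \<and> indecomposable n A \<and>
     (\<exists>u :: nat \<Rightarrow> real.
        (\<forall>j\<le>n. 0 < u j) \<and>
        (\<forall>i\<le>n. (\<Sum>j\<le>n. real_of_int (A i j) * u j) = 0) \<and>
        (\<forall>v. (\<forall>i\<le>n. (\<Sum>j\<le>n. real_of_int (A i j) * v j) = 0) \<longrightarrow> (\<exists>c. \<forall>j\<le>n. v j = c * u j))) \<and>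
     (\<forall>v :: nat \<Rightarrow> real.
        (\<forall>i\<le>n. 0 \<le> (\<Sum>j\<le>n. real_of_int (A i j) * v j)) \<longrightarrow>
        (\<forall>i\<le>n. (\<Sum>j\<le>n. real_of_int (A i j) * v j) = 0))"

text \<open>Types in Kac's notation; \<open>Aff_A2_even n\<close>, \<open>Aff_A2_odd n\<close>, \<open>Aff_D2 n\<close> stand for
  \<open>A\<^sub>2\<^sub>n\<close>, \<open>A\<^sub>2\<^sub>n\<^sub>-\<^sub>1\<close>, \<open>D\<^sub>n\<^sub>+\<^sub>1\<close> with superscript (2).\<close>

datatype affine_type =
    Aff_A nat | Aff_B nat | Aff_C nat | Aff_D nat | Aff_E6 | Aff_E7 | Aff_E8 | Aff_F4 | Aff_G2
  | Aff_A2_even nat | Aff_A2_odd nat | Aff_D2 nat | Aff_E6_2 | Aff_D4_3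

fun type_rank :: "affine_type \<Rightarrow> nat" where
  "type_rank (Aff_A n) = n"
| "type_rank (Aff_B n) = n"
| "type_rank (Aff_C n) = n"
| "type_rank (Aff_D n) = n"
| "type_rank Aff_E6 = 6"
| "type_rank Aff_E7 = 7"
| "type_rank Aff_E8 = 8"
| "type_rank Aff_F4 = 4"
| "type_rank Aff_G2 = 2"
| "type_rank (Aff_A2_even n) = n"
| "type_rank (Aff_A2_odd n) = n"
| "type_rank (Aff_D2 n) = n"
| "type_rank Aff_E6_2 = 4"
| "type_rank Aff_D4_3 = 2"

fun valid_type :: "affine_type \<Rightarrow> bool" where
  "valid_type (Aff_A n) \<longleftrightarrow> 1 \<le> n"
| "valid_type (Aff_B n) \<longleftrightarrow> 3 \<le> n"
| "valid_type (Aff_C n) \<longleftrightarrow> 2 \<le> n"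
| "valid_type (Aff_D n) \<longleftrightarrow> 4 \<le> n"
| "valid_type (Aff_A2_even n) \<longleftrightarrow> 1 \<le> n"
| "valid_type (Aff_A2_odd n) \<longleftrightarrow> 3 \<le> n"
| "valid_type (Aff_D2 n) \<longleftrightarrow> 2 \<le> n"
| "valid_type _ \<longleftrightarrow> True"

text \<open>Kac's Dynkin diagrams with his numbering of the nodes.  An entry \<open>(i, j, p, q)\<close> is an edge
  between \<open>i\<close> and \<open>j\<close> with \<open>A i j = - p\<close> and \<open>A j i = - q\<close>; in Kac's convention the arrow points
  towards \<open>i\<close> if \<open>p > q\<close> and towards \<open>j\<close> if \<open>p < q\<close>.\<close>

definition chain :: "nat \<Rightarrow> nat \<Rightarrow> (nat \<times> nat \<times> int \<times> int) list" where
  "chain i j = map (\<lambda>k. (k, Suc k, 1, 1)) [i..<j]"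

fun dynkin_edges :: "affine_type \<Rightarrow> (nat \<times> nat \<times> int \<times> int) list" where
  "dynkin_edges (Aff_A n) = (if n = 1 then [(0, 1, 2, 2)] else (n, 0, 1, 1) # chain 0 n)"
| "dynkin_edges (Aff_B n) = [(0, 2, 1, 1), (n - 1, n, 1, 2)] @ chain 1 (n - 1)"
| "dynkin_edges (Aff_C n) = [(0, 1, 1, 2), (n - 1, n, 2, 1)] @ chain 1 (n - 1)"
| "dynkin_edges (Aff_D n) = [(0, 2, 1, 1), (n - 2, n, 1, 1)] @ chain 1 (n - 1)"
| "dynkin_edges Aff_E6 = [(0, 6, 1, 1), (3, 6, 1, 1)] @ chain 1 5"
| "dynkin_edges Aff_E7 = (3, 7, 1, 1) # chain 0 6"
| "dynkin_edges Aff_E8 = (5, 8, 1, 1) # chain 0 7"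
| "dynkin_edges Aff_F4 = [(2, 3, 1, 2), (3, 4, 1, 1)] @ chain 0 2"
| "dynkin_edges Aff_G2 = [(0, 1, 1, 1), (1, 2, 1, 3)]"
| "dynkin_edges (Aff_A2_even n) =
     (if n = 1 then [(0, 1, 4, 1)] else [(0, 1, 2, 1), (n - 1, n, 2, 1)] @ chain 1 (n - 1))"
| "dynkin_edges (Aff_A2_odd n) = [(0, 2, 1, 1), (n - 1, n, 2, 1)] @ chain 1 (n - 1)"
| "dynkin_edges (Aff_D2 n) = [(0, 1, 2, 1), (n - 1, n, 1, 2)] @ chain 1 (n - 1)"
| "dynkin_edges Aff_E6_2 = [(2, 3, 2, 1), (3, 4, 1, 1)] @ chain 0 2"
| "dynkin_edges Aff_D4_3 = [(0, 1, 1, 1), (1, 2, 3, 1)]"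

definition kac_cartan :: "affine_type \<Rightarrow> nat \<Rightarrow> nat \<Rightarrow> int" where
  "kac_cartan t i j =
     (if i = j then 2
      else - (\<Sum>(k, l, p, q)\<leftarrow>dynkin_edges t.
                if (k, l) = (i, j) then p else if (k, l) = (j, i) then q else 0))"

definition of_type :: "affine_type \<Rightarrow> nat \<Rightarrow> (nat \<Rightarrow> nat \<Rightarrow> int) \<Rightarrow> bool" where
  "of_type t n A \<longleftrightarrow> valid_type t \<and> n = type_rank t \<and> (\<forall>i\<le>n. \<forall>j\<le>n. A i j = kac_cartan t i j)"

fun excluded_type :: "affine_type \<Rightarrow> bool" where
  "excluded_type (Aff_B n) = True"
| "excluded_type (Aff_C n) = True"
| "excluded_type Aff_F4 = True"
| "excluded_type Aff_G2 = True"
| "excluded_type _ = False"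

section \<open>Root data\<close>

text \<open>Numerical labels: the positive relatively prime integers with \<open>A a = 0\<close>.\<close>

definition labels :: "nat \<Rightarrow> (nat \<Rightarrow> nat \<Rightarrow> int) \<Rightarrow> nat \<Rightarrow> nat" where
  "labels n A = (THE a. (\<forall>j\<le>n. 0 < a j) \<and> (\<forall>j>n. a j = 0) \<and>
     (\<forall>i\<le>n. (\<Sum>j\<le>n. A i j * int (a j)) = 0) \<and> Gcd (a ` {..n}) = 1)"

definition colabels :: "nat \<Rightarrow> (nat \<Rightarrow> nat \<Rightarrow> int) \<Rightarrow> nat \<Rightarrow> nat" where
  "colabels n A = labels n (\<lambda>i j. A j i)"

definition dd :: "nat \<Rightarrow> (nat \<Rightarrow> nat \<Rightarrow> int) \<Rightarrow> nat \<Rightarrow> real" where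
  "dd n A j = real (labels n A j) / real (colabels n A j)"

text \<open>The real span of the simple roots: a vector is its coordinate function with respect to
  \<open>\<alpha>\<^sub>0, \<dots>, \<alpha>\<^sub>n\<close>, zero at all indices above \<open>n\<close>.\<close>

type_synonym rvec = "nat \<Rightarrow> real"

definition simple_root :: "nat \<Rightarrow> rvec" where
  "simple_root i = (\<lambda>j. if j = i then 1 else 0)"

definition delta :: "nat \<Rightarrow> (nat \<Rightarrow> nat \<Rightarrow> int) \<Rightarrow> rvec" where
  "delta n A = (\<lambda>j. real (labels n A j))"

definition theta :: "nat \<Rightarrow> (nat \<Rightarrow> nat \<Rightarrow> int) \<Rightarrow> rvec" where
  "theta n A = (\<lambda>j. delta n A j - real (labels n A 0) * simple_root 0 j)"

definition form :: "nat \<Rightarrow> (nat \<Rightarrow> nat \<Rightarrow> int) \<Rightarrow> rvec \<Rightarrow> rvec \<Rightarrow> real" where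
  "form n A x y = (\<Sum>j\<le>n. \<Sum>k\<le>n. x j * y k * (real_of_int (A j k) / dd n A j))"

definition simple_coroot :: "nat \<Rightarrow> (nat \<Rightarrow> nat \<Rightarrow> int) \<Rightarrow> nat \<Rightarrow> rvec" where
  "simple_coroot n A i = (\<lambda>j. dd n A i * simple_root i j)"

definition simple_refl :: "nat \<Rightarrow> (nat \<Rightarrow> nat \<Rightarrow> int) \<Rightarrow> nat \<Rightarrow> rvec \<Rightarrow> rvec" where
  "simple_refl n A i x = (\<lambda>j. x j - form n A x (simple_coroot n A i) * simple_root i j)"

definition theta_refl :: "nat \<Rightarrow> (nat \<Rightarrow> nat \<Rightarrow> int) \<Rightarrow> rvec \<Rightarrow> rvec" where
  "theta_refl n A x = (\<lambda>j. x j -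
     2 * form n A x (theta n A) / form n A (theta n A) (theta n A) * theta n A j)"

text \<open>The finite Weyl group; its elements are determined by their action on all coordinate
  functions, as the coordinates above \<open>n\<close> are fixed.\<close>

definition weyl_word :: "nat \<Rightarrow> (nat \<Rightarrow> nat \<Rightarrow> int) \<Rightarrow> nat list \<Rightarrow> rvec \<Rightarrow> rvec" where
  "weyl_word n A js = foldr (\<lambda>j f. simple_refl n A j \<circ> f) js id"

definition finite_weyl :: "nat \<Rightarrow> (nat \<Rightarrow> nat \<Rightarrow> int) \<Rightarrow> (rvec \<Rightarrow> rvec) set" where
  "finite_weyl n A = weyl_word n A ` lists {1..n}"

definition weyl_length :: "nat \<Rightarrow> (nat \<Rightarrow> nat \<Rightarrow> int) \<Rightarrow> (rvec \<Rightarrow> rvec) \<Rightarrow> nat" where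
  "weyl_length n A w = (LEAST m. \<exists>js\<in>lists {1..n}. length js = m \<and> weyl_word n A js = w)"

definition reduced_decomposition ::
    "nat \<Rightarrow> (nat \<Rightarrow> nat \<Rightarrow> int) \<Rightarrow> nat list \<Rightarrow> (rvec \<Rightarrow> rvec) \<Rightarrow> bool" where
  "reduced_decomposition n A js w \<longleftrightarrow>
     js \<in> lists {1..n} \<and> weyl_word n A js = w \<and> length js = weyl_length n A w"

definition longest_element :: "nat \<Rightarrow> (nat \<Rightarrow> nat \<Rightarrow> int) \<Rightarrow> (rvec \<Rightarrow> rvec) \<Rightarrow> bool" where
  "longest_element n A w \<longleftrightarrow>
     w \<in> finite_weyl n A \<and> (\<forall>v\<in>finite_weyl n A. weyl_length n A v \<le> weyl_length n A w)"

text \<open>\<open>w = -1\<close> on the span of \<open>\<alpha>\<^sub>1, \<dots>, \<alpha>\<^sub>n\<close>.\<close>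

definition acts_as_minus_one :: "nat \<Rightarrow> (rvec \<Rightarrow> rvec) \<Rightarrow> bool" where
  "acts_as_minus_one n w \<longleftrightarrow>
     (\<forall>x. x 0 = 0 \<and> (\<forall>j>n. x j = 0) \<longrightarrow> w x = (\<lambda>j. - x j))"

definition finite_lattice :: "nat \<Rightarrow> (nat \<Rightarrow> nat \<Rightarrow> int) \<Rightarrow> rvec set" where
  "finite_lattice n A = {\<beta>. \<beta> 0 = 0 \<and> (\<forall>j>n. \<beta> j = 0) \<and>
     (\<forall>j\<in>{1..n}. if of_type (Aff_A2_even n) n A \<and> j = n then 2 * \<beta> j \<in> \<int> else \<beta> j \<in> \<int>)}"

definition hat_coroot :: "nat \<Rightarrow> (nat \<Rightarrow> nat \<Rightarrow> int) \<Rightarrow> nat \<Rightarrow> rvec" where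
  "hat_coroot n A i =
     (if of_type (Aff_A2_even n) n A \<and> i = n then (\<lambda>j. 2 * simple_coroot n A i j)
      else simple_coroot n A i)"

section \<open>The double affine Artin group\<close>

text \<open>Generators: \<open>GT i\<close> is \<open>T\<^sub>i\<close>, \<open>GX \<beta>\<close> is \<open>X\<^sub>\<beta>\<close> for \<open>\<beta>\<close> in the finite lattice, and \<open>GD\<close> is
  \<open>X\<close> at \<open>\<delta> / a\<^sub>0\<close>.\<close>

datatype daa_gen = GT nat | GX rvec | GD

definition daa_gens :: "nat \<Rightarrow> (nat \<Rightarrow> nat \<Rightarrow> int) \<Rightarrow> daa_gen set" where
  "daa_gens n A = GT ` {..n} \<union> GX ` finite_lattice n A \<union> {GD}"

definition int_power_word :: "'g \<Rightarrow> int \<Rightarrow> 'g word" where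
  "int_power_word g k = (if 0 \<le> k then replicate (nat k) (Pos g) else replicate (nat (- k)) (Neg g))"

text \<open>\<open>X\<^sub>v\<close> for \<open>v = \<beta> + k \<delta> / a\<^sub>0\<close>.  The coordinate of \<open>v\<close> at \<open>\<alpha>\<^sub>0\<close> is \<open>k\<close>, because \<open>\<beta>\<close> has
  coordinate 0 there and \<open>\<delta> / a\<^sub>0\<close> has coordinate 1.\<close>

definition X_word :: "nat \<Rightarrow> (nat \<Rightarrow> nat \<Rightarrow> int) \<Rightarrow> rvec \<Rightarrow> daa_gen word" where
  "X_word n A v = Pos (GX (\<lambda>j. v j - v 0 * (delta n A j / real (labels n A 0))))
                  # int_power_word GD \<lfloor>v 0\<rfloor>"

fun alternating :: "nat \<Rightarrow> 'a \<Rightarrow> 'a \<Rightarrow> 'a list" where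
  "alternating 0 x y = []"
| "alternating (Suc m) x y = x # alternating m y x"

definition laces :: "(nat \<Rightarrow> nat \<Rightarrow> int) \<Rightarrow> nat \<Rightarrow> nat \<Rightarrow> int" where
  "laces A i j = A i j * A j i"

definition braid_length :: "(nat \<Rightarrow> nat \<Rightarrow> int) \<Rightarrow> nat \<Rightarrow> nat \<Rightarrow> nat" where
  "braid_length A i j =
     (if laces A i j = 0 then 2 else if laces A i j = 1 then 3
      else if laces A i j = 2 then 4 else 6)"

definition braid_rels :: "nat \<Rightarrow> (nat \<Rightarrow> nat \<Rightarrow> int) \<Rightarrow> (daa_gen word \<times> daa_gen word) set" where
  "braid_rels n A =
     {(alternating (braid_length A i j) (Pos (GT i)) (Pos (GT j)),
       alternating (braid_length A i j) (Pos (GT j)) (Pos (GT i))) | i j.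
      i \<le> n \<and> j \<le> n \<and> i \<noteq> j \<and> laces A i j \<in> {0, 1, 2, 3}}"

definition daa_rels :: "nat \<Rightarrow> (nat \<Rightarrow> nat \<Rightarrow> int) \<Rightarrow> (daa_gen word \<times> daa_gen word) set" where
  "daa_rels n A = braid_rels n A \<union>
     {([Pos (GX \<beta>), Pos (GX \<gamma>)], [Pos (GX (\<lambda>j. \<beta> j + \<gamma> j))]) | \<beta> \<gamma>.
        \<beta> \<in> finite_lattice n A \<and> \<gamma> \<in> finite_lattice n A} \<union>
     {([Pos GD, Pos g], [Pos g, Pos GD]) | g. g \<in> daa_gens n A} \<union>
     {([Pos (GT i), Pos (GX \<beta>)], [Pos (GX \<beta>), Pos (GT i)]) | i \<beta>.
        i \<le> n \<and> \<beta> \<in> finite_lattice n A \<and> form n A \<beta> (hat_coroot n A i) = 0} \<union>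
     {([Pos (GT i), Pos (GX \<beta>), Pos (GT i)], X_word n A (simple_refl n A i \<beta>)) | i \<beta>.
        i \<le> n \<and> \<beta> \<in> finite_lattice n A \<and> form n A \<beta> (hat_coroot n A i) = - 1}"

definition daa_group :: "nat \<Rightarrow> (nat \<Rightarrow> nat \<Rightarrow> int) \<Rightarrow> daa_gen word set monoid" where
  "daa_group n A = presented_group (daa_gens n A) (daa_rels n A)"

definition daa_class :: "nat \<Rightarrow> (nat \<Rightarrow> nat \<Rightarrow> int) \<Rightarrow> daa_gen word \<Rightarrow> daa_gen word set" where
  "daa_class n A = word_class (daa_gens n A) (daa_rels n A)"

definition T_elt :: "nat \<Rightarrow> (nat \<Rightarrow> nat \<Rightarrow> int) \<Rightarrow> nat \<Rightarrow> daa_gen word set" where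
  "T_elt n A i = daa_class n A [Pos (GT i)]"

definition X_elt :: "nat \<Rightarrow> (nat \<Rightarrow> nat \<Rightarrow> int) \<Rightarrow> rvec \<Rightarrow> daa_gen word set" where
  "X_elt n A v = daa_class n A (X_word n A v)"

definition T_word_elt :: "nat \<Rightarrow> (nat \<Rightarrow> nat \<Rightarrow> int) \<Rightarrow> nat list \<Rightarrow> daa_gen word set" where
  "T_word_elt n A js = daa_class n A (map (\<lambda>j. Pos (GT j)) js)"

definition T01 :: "nat \<Rightarrow> (nat \<Rightarrow> nat \<Rightarrow> int) \<Rightarrow> daa_gen word set" where
  "T01 n A = T_elt n A 0"

definition T02 :: "nat \<Rightarrow> (nat \<Rightarrow> nat \<Rightarrow> int) \<Rightarrow> daa_gen word set" where
  "T02 n A = inv\<^bsub>daa_group n A\<^esub> (T_elt n A 0) \<otimes>\<^bsub>daa_group n A\<^esub> X_elt n A (simple_root 0)"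

text \<open>Here \<open>js\<close> is a reduced decomposition of the reflection in \<open>\<theta>\<close>.\<close>

definition T03 :: "nat \<Rightarrow> (nat \<Rightarrow> nat \<Rightarrow> int) \<Rightarrow> nat list \<Rightarrow> daa_gen word set" where
  "T03 n A js = X_elt n A (\<lambda>j. theta n A j / real (labels n A 0))
                \<otimes>\<^bsub>daa_group n A\<^esub> inv\<^bsub>daa_group n A\<^esub> (T_word_elt n A js)"

text \<open>The defining properties of the two automorphisms.  Each determines its automorphism uniquely,
  since \<open>T01\<close>, \<open>T02\<close>, \<open>T03\<close> and the \<open>T\<^sub>i\<close> with \<open>i \<noteq> 0\<close> generate the group.\<close>

definition is_aut_a ::
    "nat \<Rightarrow> (nat \<Rightarrow> nat \<Rightarrow> int) \<Rightarrow> nat list \<Rightarrow> (daa_gen word set \<Rightarrow> daa_gen word set) \<Rightarrow> bool" where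
  "is_aut_a n A js f \<longleftrightarrow> f \<in> auto (daa_group n A) \<and>
     (\<forall>i\<in>{1..n}. f (T_elt n A i) = T_elt n A i) \<and>
     f (T03 n A js) = T03 n A js \<and>
     f (T01 n A) = T02 n A \<and>
     f (T02 n A) = inv\<^bsub>daa_group n A\<^esub> (T02 n A) \<otimes>\<^bsub>daa_group n A\<^esub> T01 n A \<otimes>\<^bsub>daa_group n A\<^esub> T02 n A"

definition is_aut_b ::
    "nat \<Rightarrow> (nat \<Rightarrow> nat \<Rightarrow> int) \<Rightarrow> nat list \<Rightarrow> (daa_gen word set \<Rightarrow> daa_gen word set) \<Rightarrow> bool" where
  "is_aut_b n A js f \<longleftrightarrow> f \<in> auto (daa_group n A) \<and>
     (\<forall>i\<in>{1..n}. f (T_elt n A i) = T_elt n A i) \<and>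
     f (T01 n A) = T01 n A \<and>
     f (T02 n A) = T03 n A js \<and>
     f (T03 n A js) =
       inv\<^bsub>daa_group n A\<^esub> (T03 n A js) \<otimes>\<^bsub>daa_group n A\<^esub> T02 n A \<otimes>\<^bsub>daa_group n A\<^esub> T03 n A js"

text \<open>The action of the braid group on \<open>G\<close> sending its two generators to \<open>fa\<close> and \<open>fb\<close>.\<close>

definition b3_action ::
    "('a, 'm) monoid_scheme \<Rightarrow> ('a \<Rightarrow> 'a) \<Rightarrow> ('a \<Rightarrow> 'a) \<Rightarrow> b3_gen word set \<Rightarrow> 'a \<Rightarrow> 'a" where
  "b3_action G fa fb = pres_lift (AutoGroup G) (case_b3_gen fa fb)"

end

(* The braid group on three strands acts on the double affine Artin group G through automorphisms with
   c = aba satisfying c^2(y) = P^-1 y P for y = T01, T02, T03, where P = T01 T02 T03 = X_(delta/a_0) T_s^-1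
   and s is the reflection in theta.  Since X_(delta/a_0) is central, c^2 conjugates the T0k by T_s and fixes
   the other generators.  The longest element factors with additive lengths as w_0 = s u, where u is a
   product of simple reflections orthogonal to theta, so T_u commutes with T_s and with the T0k.  Hence
   c^4 is conjugation by T_(w_0)^2, and c^2 is conjugation by T_(w_0) if w_0 = -1.  On the other side, an
   element of B_3 is in normal form z^k U^e P S^f with S = aba, U = ab, z = S^2 = U^3 and P a word in a^-1
   and b, whose matrices are a free monoid; so the kernels of the maps from B_3 to SL(2, Z) and PSL(2, Z)
   are generated by (aba)^4 and (aba)^2. *)

theory Submission
  imports Defs "HOL-Algebra.Generated_Groups"
begin

section \<open>Evaluation of words, maps out of presented groups, factoring through a
  surjection\<close>

section \<open>Presented groups\<close>

lemma words_Nil [simp]: "[] \<in> words S"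
  and words_Pos [simp]: "Pos g # w \<in> words S \<longleftrightarrow> g \<in> S \<and> w \<in> words S"
  and words_Neg [simp]: "Neg g # w \<in> words S \<longleftrightarrow> g \<in> S \<and> w \<in> words S"
  by (auto simp: words_def)

lemma words_append_iff [simp]: "u @ v \<in> words S \<longleftrightarrow> u \<in> words S \<and> v \<in> words S"
  by (auto simp: words_def)

lemma words_induct [consumes 1, case_names Nil Pos Neg]:
  assumes "w \<in> words S" "P []"
    and "\<And>g w. g \<in> S \<Longrightarrow> w \<in> words S \<Longrightarrow> P w \<Longrightarrow> P (Pos g # w)"
    and "\<And>g w. g \<in> S \<Longrightarrow> w \<in> words S \<Longrightarrow> P w \<Longrightarrow> P (Neg g # w)"
  shows "P w"
  using assms(1)
proof (induction w)
  case (Cons x w)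
  then show ?case using assms(3,4) by (cases x) auto
qed (simp add: assms(2))

lemma word_class_in_carrier [simp, intro]:
  "w \<in> words S \<Longrightarrow> word_class S R w \<in> carrier (presented_group S R)"
  by (simp add: presented_group_def)

lemma presented_group_one: "\<one>\<^bsub>presented_group S R\<^esub> = word_class S R []"
  by (simp add: presented_group_def)

lemma presented_group_carrierE:
  assumes "x \<in> carrier (presented_group S R)"
  obtains w where "w \<in> words S" "x = word_class S R w"
  using assms by (auto simp: presented_group_def)

lemma word_class_Neg:
  assumes "g \<in> S"
  shows "word_class S R [Neg g] = inv\<^bsub>presented_group S R\<^esub> (word_class S R [Pos g])"
proof -
  interpret group "presented_group S R" by (rule group_presented_group)
  show ?thesis
    by (rule inv_equality[symmetric])
       (use assms in \<open>auto simp: presented_group_mult presented_group_one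
          intro!: word_class_eq pres_eq.left_inv\<close>)
qed

text \<open>This turns induction on words into induction on group elements: every element is the
  value of a word at the tautological generator map, so stability under left multiplication by
  signed generators can be checked letter by letter.\<close>

lemma word_eval_presented_group:
  assumes "w \<in> words S"
  shows "word_eval (presented_group S R) (\<lambda>g. word_class S R [Pos g]) w = word_class S R w"
  using assms
  by (induction rule: words_induct)
     (simp_all add: presented_group_one word_class_Neg[symmetric] presented_group_mult)

lemma word_class_rel:
  "(u, v) \<in> R \<Longrightarrow> u \<in> words S \<Longrightarrow> v \<in> words S \<Longrightarrow> word_class S R u = word_class S R v"
  by (intro word_class_eq pres_eq.rel)

lemma presented_group_subgroup_eq:
  assumes "subgroup K (presented_group S R)" "\<And>g. g \<in> S \<Longrightarrow> word_class S R [Pos g] \<in> K"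
  shows "carrier (presented_group S R) \<subseteq> K"
proof
  fix x assume "x \<in> carrier (presented_group S R)"
  then obtain w where w: "w \<in> words S" "x = word_class S R w" by (rule presented_group_carrierE)
  interpret K: subgroup K "presented_group S R" by (fact assms(1))
  have "word_eval (presented_group S R) (\<lambda>g. word_class S R [Pos g]) w \<in> K"
    using w(1) by (induction rule: words_induct) (auto simp: assms(2))
  thus "x \<in> K" using w by (simp add: word_eval_presented_group)
qed

context group
begin

lemma word_eval_closed:
  assumes "w \<in> words S" "\<And>g. g \<in> S \<Longrightarrow> f g \<in> carrier G"
  shows "word_eval G f w \<in> carrier G"
  using assms(1) by (induction rule: words_induct) (auto simp: assms(2))

lemma word_eval_append:
  assumes "u \<in> words S" "v \<in> words S" "\<And>g. g \<in> S \<Longrightarrow> f g \<in> carrier G"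
  shows "word_eval G f (u @ v) = word_eval G f u \<otimes> word_eval G f v"
  using assms(1)
  by (induction rule: words_induct)
     (auto simp: assms word_eval_closed[OF assms(2,3)] word_eval_closed[OF _ assms(3)] m_assoc)

lemma word_eval_pres_eq:
  assumes "pres_eq S R u v" and f: "\<And>g. g \<in> S \<Longrightarrow> f g \<in> carrier G"
    and R: "\<And>u v. (u, v) \<in> R \<Longrightarrow> u \<in> words S \<Longrightarrow> v \<in> words S \<Longrightarrow>
      word_eval G f u = word_eval G f v"
  shows "word_eval G f u = word_eval G f v"
  using assms(1)
proof (induction rule: pres_eq.induct)
  case (cong u u' v v')
  then show ?case
    using pres_eq_words[OF cong.hyps(1)] pres_eq_words[OF cong.hyps(2)]
    by (simp add: word_eval_append[where S = S, OF _ _ f])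
qed (auto simp: f R)

text \<open>Since \<open>pres_lift\<close> picks the only member of the image of a class, its value
  is available only once that image is known to be a singleton, and this is what respecting the
  relations gives.\<close>

lemma pres_lift_class:
  assumes w: "w \<in> words S" and f: "\<And>g. g \<in> S \<Longrightarrow> f g \<in> carrier G"
    and R: "\<And>u v. (u, v) \<in> R \<Longrightarrow> u \<in> words S \<Longrightarrow> v \<in> words S \<Longrightarrow>
      word_eval G f u = word_eval G f v"
  shows "pres_lift G f (word_class S R w) = word_eval G f w"
proof -
  have eq: "word_eval G f v = word_eval G f w" if "v \<in> word_class S R w" for v
    using word_eval_pres_eq[of S R w v f, OF _ f R] that by (simp add: word_class_def)
  have "w \<in> word_class S R w" using w by (simp add: word_class_def pres_eq.refl)
  hence "word_eval G f ` word_class S R w = {word_eval G f w}" using eq by blast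
  thus ?thesis by (simp add: pres_lift_def)
qed

lemma pres_lift_hom:
  assumes f: "\<And>g. g \<in> S \<Longrightarrow> f g \<in> carrier G"
    and R: "\<And>u v. (u, v) \<in> R \<Longrightarrow> u \<in> words S \<Longrightarrow> v \<in> words S \<Longrightarrow>
      word_eval G f u = word_eval G f v"
  shows "pres_lift G f \<in> hom (presented_group S R) G"
  by (rule homI)
     (auto elim!: presented_group_carrierE
        simp: presented_group_mult pres_lift_class[OF _ f R] word_eval_closed[OF _ f]
          word_eval_append[where S = S, OF _ _ f])

end

text \<open>The homomorphism theorem in a form that mentions no quotient by the kernel: compose
  \<open>f\<close> with a set-theoretic section of \<open>p\<close>. The kernel condition makes
  \<open>f\<close> constant on the fibres of \<open>p\<close>, so the choice of section does not
  matter.\<close>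

lemma hom_factor_surj:
  assumes "group G" "group Q" "group H" and p: "p \<in> hom G Q" and f: "f \<in> hom G H"
    and surj: "carrier Q \<subseteq> p ` carrier G"
    and ker: "\<And>x. x \<in> carrier G \<Longrightarrow> p x = \<one>\<^bsub>Q\<^esub> \<Longrightarrow> f x = \<one>\<^bsub>H\<^esub>"
  shows "\<exists>\<phi>\<in>hom Q H. \<forall>x\<in>carrier G. \<phi> (p x) = f x"
proof -
  interpret p: group_hom G Q p using assms by (simp add: group_hom_def group_hom_axioms_def)
  interpret f: group_hom G H f using assms by (simp add: group_hom_def group_hom_axioms_def)
  define r where "r q = (SOME x. x \<in> carrier G \<and> p x = q)" for q
  have r: "r q \<in> carrier G \<and> p (r q) = q" if "q \<in> carrier Q" for q
    unfolding r_def by (rule someI_ex) (use surj that in blast)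
  have key: "f x = f y" if xy: "x \<in> carrier G" "y \<in> carrier G" and eq: "p x = p y" for x y
  proof -
    have "p (x \<otimes>\<^bsub>G\<^esub> inv\<^bsub>G\<^esub> y) = \<one>\<^bsub>Q\<^esub>" using xy eq by simp
    hence "f (x \<otimes>\<^bsub>G\<^esub> inv\<^bsub>G\<^esub> y) = \<one>\<^bsub>H\<^esub>" using xy ker by simp
    thus ?thesis using xy by (simp add: f.H.inv_solve_right')
  qed
  show ?thesis
  proof (intro bexI[of _ "\<lambda>q. f (r q)"] ballI)
    show "f (r (p x)) = f x" if "x \<in> carrier G" for x
      using that r[of "p x"] by (intro key) auto
    show "(\<lambda>q. f (r q)) \<in> hom Q H"
    proof (rule homI)
      fix x y assume xy: "x \<in> carrier Q" "y \<in> carrier Q"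
      have "f (r (x \<otimes>\<^bsub>Q\<^esub> y)) = f (r x \<otimes>\<^bsub>G\<^esub> r y)"
        using xy r[of x] r[of y] r[of "x \<otimes>\<^bsub>Q\<^esub> y"] by (intro key) auto
      thus "f (r (x \<otimes>\<^bsub>Q\<^esub> y)) = f (r x) \<otimes>\<^bsub>H\<^esub> f (r y)" using xy r by simp
    qed (use r in auto)
  qed
qed

section \<open>Inner automorphisms and the projection to the outer automorphism group\<close>

section \<open>Outer automorphisms\<close>

lemma carrier_AutoGroup [simp]: "carrier (AutoGroup G) = auto G"
  by (simp add: AutoGroup_def)

lemma mult_AutoGroup:
  "f \<in> auto G \<Longrightarrow> g \<in> auto G \<Longrightarrow> f \<otimes>\<^bsub>AutoGroup G\<^esub> g = compose (carrier G) f g"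
  by (simp add: AutoGroup_def BijGroup_def auto_def)

lemma one_AutoGroup: "\<one>\<^bsub>AutoGroup G\<^esub> = (\<lambda>x\<in>carrier G. x)"
  by (simp add: AutoGroup_def BijGroup_def)

lemma auto_closed: "f \<in> auto G \<Longrightarrow> x \<in> carrier G \<Longrightarrow> f x \<in> carrier G"
  by (auto simp: auto_def hom_def)

lemma auto_mult: "f \<in> auto G \<Longrightarrow> x \<in> carrier G \<Longrightarrow> y \<in> carrier G \<Longrightarrow>
    f (x \<otimes>\<^bsub>G\<^esub> y) = f x \<otimes>\<^bsub>G\<^esub> f y"
  by (auto simp: auto_def hom_def)

lemma auto_extensional: "f \<in> auto G \<Longrightarrow> f \<in> extensional (carrier G)"
  by (auto simp: auto_def Bij_def)

context group
begin

lemma auto_inv: "f \<in> auto G \<Longrightarrow> x \<in> carrier G \<Longrightarrow> f (inv x) = inv (f x)"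
  by (rule group_hom.hom_inv) (auto simp: group_hom_def group_hom_axioms_def auto_def is_group)

abbreviation conj_aut :: "'a \<Rightarrow> 'a \<Rightarrow> 'a" where
  "conj_aut g \<equiv> (\<lambda>x\<in>carrier G. g \<otimes> x \<otimes> inv g)"

lemma inv_cancel_left [simp]:
  "g \<in> carrier G \<Longrightarrow> x \<in> carrier G \<Longrightarrow> inv g \<otimes> (g \<otimes> x) = x"
  "g \<in> carrier G \<Longrightarrow> x \<in> carrier G \<Longrightarrow> g \<otimes> (inv g \<otimes> x) = x"
  by (simp_all add: m_assoc[symmetric])

lemma conj_aut_mult:
  assumes "g \<in> carrier G" "x \<in> carrier G" "y \<in> carrier G"
  shows "g \<otimes> (x \<otimes> y) \<otimes> inv g = (g \<otimes> x \<otimes> inv g) \<otimes> (g \<otimes> y \<otimes> inv g)"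
  using assms by (simp add: m_assoc)

lemma conj_aut_in_auto:
  assumes g: "g \<in> carrier G" shows "conj_aut g \<in> auto G"
proof -
  have "conj_aut g \<in> hom G G"
    using g by (intro homI) (auto simp: conj_aut_mult)
  moreover have "bij_betw (conj_aut g) (carrier G) (carrier G)"
    by (rule bij_betwI[where g = "conj_aut (inv g)"])
       (use g in \<open>auto simp: m_assoc\<close>)
  ultimately show ?thesis by (auto simp: auto_def Bij_def)
qed

lemma compose_conj_aut:
  assumes "g \<in> carrier G" "h \<in> carrier G"
  shows "conj_aut g \<otimes>\<^bsub>AutoGroup G\<^esub> conj_aut h = conj_aut (g \<otimes> h)"
  using assms
  by (auto simp: mult_AutoGroup conj_aut_in_auto compose_def fun_eq_iff m_assoc inv_mult_group)

lemma conj_aut_one: "conj_aut \<one> = \<one>\<^bsub>AutoGroup G\<^esub>"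
  by (auto simp: one_AutoGroup fun_eq_iff)

lemma Inn_normal: "Inn G \<lhd> AutoGroup G"
proof -
  interpret Au: group "AutoGroup G" by (rule AutoGroup)
  have inv: "inv\<^bsub>AutoGroup G\<^esub> conj_aut g = conj_aut (inv g)" if "g \<in> carrier G" for g
    by (rule Au.inv_equality)
       (use that in \<open>simp_all only: compose_conj_aut conj_aut_in_auto carrier_AutoGroup inv_closed
          l_inv conj_aut_one\<close>)
  show ?thesis unfolding Au.normal_inv_iff
  proof (intro conjI ballI)
    show "subgroup (Inn G) (AutoGroup G)"
    proof (rule Au.subgroupI)
      show "Inn G \<noteq> {}" by (auto simp: Inn_def)
      show "Inn G \<subseteq> carrier (AutoGroup G)" using conj_aut_in_auto by (auto simp: Inn_def)
      show "inv\<^bsub>AutoGroup G\<^esub> f \<in> Inn G" if f: "f \<in> Inn G" for f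
      proof -
        obtain g where "g \<in> carrier G" "f = conj_aut g" using f by (auto simp: Inn_def)
        thus ?thesis using inv[of g] inv_closed[of g] unfolding Inn_def by blast
      qed
      show "f \<otimes>\<^bsub>AutoGroup G\<^esub> h \<in> Inn G" if f: "f \<in> Inn G" and h: "h \<in> Inn G" for f h
      proof -
        obtain g where "g \<in> carrier G" "f = conj_aut g" using f by (auto simp: Inn_def)
        moreover obtain g' where "g' \<in> carrier G" "h = conj_aut g'"
          using h by (auto simp: Inn_def)
        ultimately show ?thesis using compose_conj_aut[of g g'] m_closed[of g g'] unfolding Inn_def by blast
      qed    qed
  next
    fix f h assume f: "f \<in> carrier (AutoGroup G)" and "h \<in> Inn G"
    then obtain g where g: "g \<in> carrier G" and h: "h = conj_aut g" by (auto simp: Inn_def)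
    have fa: "f \<in> auto G" using f by simp
    have fg: "f g \<in> carrier G" using fa g by (rule auto_closed)
    \<comment> \<open>Normality comes from this intertwining rule: an automorphism carries
      conjugation by \<open>g\<close> to conjugation by \<open>f g\<close>.\<close>
    have "f \<otimes>\<^bsub>AutoGroup G\<^esub> h = conj_aut (f g) \<otimes>\<^bsub>AutoGroup G\<^esub> f"
      using g fa fg conj_aut_in_auto[of g] conj_aut_in_auto[of "f g"]
      by (auto simp: h mult_AutoGroup compose_def fun_eq_iff auto_mult auto_inv auto_closed)
    hence "f \<otimes>\<^bsub>AutoGroup G\<^esub> h \<otimes>\<^bsub>AutoGroup G\<^esub> inv\<^bsub>AutoGroup G\<^esub> f = conj_aut (f g)"
      using f conj_aut_in_auto[OF fg, folded carrier_AutoGroup]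
      by (simp add: Au.m_assoc del: carrier_AutoGroup)
    thus "f \<otimes>\<^bsub>AutoGroup G\<^esub> h \<otimes>\<^bsub>AutoGroup G\<^esub> inv\<^bsub>AutoGroup G\<^esub> f \<in> Inn G"
      using fg by (auto simp: Inn_def)
  qed
qed

lemma group_OutGroup: "group (OutGroup G)"
  unfolding OutGroup_def by (rule normal.factorgroup_is_group[OF Inn_normal])

lemma out_class_hom: "out_class G \<in> hom (AutoGroup G) (OutGroup G)"
  unfolding OutGroup_def out_class_def using normal.r_coset_hom_Mod[OF Inn_normal] .

lemma out_class_conj_aut:
  assumes "g \<in> carrier G" shows "out_class G (conj_aut g) = \<one>\<^bsub>OutGroup G\<^esub>"
  unfolding OutGroup_def out_class_def one_FactGroup
  by (rule group.coset_join2[OF AutoGroup])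
     (use assms conj_aut_in_auto normal_imp_subgroup[OF Inn_normal] in \<open>auto simp: Inn_def\<close>)

end

section \<open>Normal forms in the braid group on three strands\<close>

section \<open>The braid group on three strands and the modular group\<close>

locale braid3 = group +
  fixes a b
  assumes a [simp]: "a \<in> carrier G" and b [simp]: "b \<in> carrier G"
    and braid: "a \<otimes> b \<otimes> a = b \<otimes> a \<otimes> b"
begin

definition S where "S = a \<otimes> b \<otimes> a"
definition U where "U = a \<otimes> b"
definition Z where "Z = S \<otimes> S"

lemma SUZ_closed [simp]: "S \<in> carrier G" "U \<in> carrier G" "Z \<in> carrier G"
  by (simp_all add: S_def U_def Z_def)

lemma U_a: "U \<otimes> a = S" and b_U: "b \<otimes> U = S"
  by (simp_all add: S_def U_def braid m_assoc)

text \<open>The half twist S exchanges the two generators under conjugation.\<close>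

lemma S_b: "S \<otimes> b = a \<otimes> S"
  by (metis S_def U_def a b b_U m_assoc SUZ_closed)

lemma U_U: "U \<otimes> U = S \<otimes> b"
  by (metis S_b U_def b_U a b m_assoc SUZ_closed)

lemma U_U_U: "U \<otimes> (U \<otimes> U) = Z"
  by (metis U_U Z_def U_a S_b m_assoc SUZ_closed a b)

lemma Z_S: "Z \<otimes> S = S \<otimes> Z"
  by (simp add: Z_def m_assoc)

lemma Z_U: "Z \<otimes> U = U \<otimes> Z"
  by (simp add: U_U_U[symmetric] m_assoc)

lemma S_inv_a: "S \<otimes> inv a = U"
  by (simp add: U_a[symmetric] m_assoc)

text \<open>Modulo the central Z, this and the next rule identify \<open>inv a\<close> with S U and
  \<open>b\<close> with S U^2, the two syllables of a reduced word in a free product of cyclic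
  groups of orders 2 and 3.\<close>

lemma S_U: "S \<otimes> U = Z \<otimes> inv a"
  by (simp add: Z_def m_assoc S_inv_a)

lemma S_U_U: "S \<otimes> (U \<otimes> U) = Z \<otimes> b"
  by (simp add: Z_def m_assoc U_U)

text \<open>With these, all four signed generators are Z^(-1) times a word in S and U, so closure of
  the normal forms has to be checked for S, U and powers of Z only.\<close>

lemma Z_a: "Z \<otimes> a = U \<otimes> (U \<otimes> S)"
  by (simp add: U_U_U[symmetric] m_assoc U_a)

lemma Z_inv_b: "Z \<otimes> inv b = U \<otimes> S"
  by (simp add: U_U_U[symmetric] m_assoc U_U)

lemma commute_int_pow:
  assumes "x \<in> carrier G" "y \<in> carrier G" "x \<otimes> y = y \<otimes> x"
  shows "x [^] (k::int) \<otimes> y = y \<otimes> x [^] k"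
proof -
  have nat: "u [^] (m::nat) \<otimes> y = y \<otimes> u [^] m"
    if "u \<in> carrier G" "u \<otimes> y = y \<otimes> u" for u m
  proof (induction m)
    case (Suc m)
    have "u [^] Suc m \<otimes> y = u [^] m \<otimes> y \<otimes> u"
      using that(1) assms(2) by (simp add: m_assoc that(2))
    also have "\<dots> = y \<otimes> u [^] m \<otimes> u" by (simp only: Suc)
    finally show ?case using that(1) assms(2) by (simp add: m_assoc)
  qed (use assms in simp)
  have "inv x \<otimes> y = y \<otimes> inv x"
  proof -
    have "inv x \<otimes> (x \<otimes> y) \<otimes> inv x = inv x \<otimes> (y \<otimes> x) \<otimes> inv x" using assms by simp
    thus ?thesis using assms(1,2) by (simp add: m_assoc)
  qed
  hence "inv x [^] nat (- k) \<otimes> y = y \<otimes> inv x [^] nat (- k)" using assms(1) by (intro nat) auto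
  moreover have "x [^] nat k \<otimes> y = y \<otimes> x [^] nat k" using assms(1,3) by (rule nat)
  ultimately show ?thesis
    unfolding int_pow_def2 nat_pow_inv[OF assms(1)] by (auto split: if_splits)
qed

lemma Z_pow_S: "x \<in> carrier G \<Longrightarrow> S \<otimes> (Z [^] (k::int) \<otimes> x) = Z [^] k \<otimes> (S \<otimes> x)"
  and Z_pow_U: "x \<in> carrier G \<Longrightarrow> U \<otimes> (Z [^] (k::int) \<otimes> x) = Z [^] k \<otimes> (U \<otimes> x)"
  by (simp_all add: m_assoc[symmetric] commute_int_pow Z_S Z_U)

lemma Z_pow_Z: "x \<in> carrier G \<Longrightarrow> Z [^] (k::int) \<otimes> (Z [^] (l::int) \<otimes> x) = Z [^] (k + l) \<otimes> x"
  by (simp add: m_assoc[symmetric] int_pow_mult)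

fun pos_word :: "bool list \<Rightarrow> 'a" where
  "pos_word [] = \<one>"
| "pos_word (x # l) = (if x then inv a else b) \<otimes> pos_word l"

lemma pos_word_closed [simp]: "pos_word l \<in> carrier G"
  by (induction l) auto

text \<open>Modelled on reduced words in S and U modulo Z, with S of order 2 and U of order 3: a
  leading power of U, then syllables S U or S U^2 stored as letters \<open>inv a\<close> or
  \<open>b\<close>, then possibly a last S. All powers of Z are collected in
  \<open>k\<close>.\<close>

definition nf :: "int \<Rightarrow> nat \<Rightarrow> bool list \<Rightarrow> nat \<Rightarrow> 'a" where
  "nf k e l f = Z [^] k \<otimes> (U [^] e \<otimes> (pos_word l \<otimes> S [^] f))"

definition NF :: "'a set" where
  "NF = {nf k e l f | k e l f. e < 3 \<and> f < 2}"

lemma NF_I: "x = nf k e l f \<Longrightarrow> e < 3 \<Longrightarrow> f < 2 \<Longrightarrow> x \<in> NF"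
  by (auto simp: NF_def)

lemma nf_closed [simp]: "nf k e l f \<in> carrier G"
  by (simp add: nf_def)

lemma NF_closed: "x \<in> NF \<Longrightarrow> x \<in> carrier G"
  by (auto simp: NF_def)

lemma NF_Z: "x \<in> NF \<Longrightarrow> Z [^] (j::int) \<otimes> x \<in> NF"
  unfolding NF_def
proof (clarify, intro exI conjI)
  fix k e l f
  show "Z [^] j \<otimes> nf k e l f = nf (j + k) e l f" by (simp add: nf_def Z_pow_Z)
qed auto

lemma NF_U: assumes "x \<in> NF" shows "U \<otimes> x \<in> NF"
proof -
  obtain k e l f where x: "x = nf k e l f" and e: "e < 3" and f: "f < 2"
    using assms by (auto simp: NF_def)
  consider "e < 2" | "e = 2" using e by linarith
  thus ?thesis
  proof cases
    case 1
    have "U \<otimes> x = nf k (Suc e) l f"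
      unfolding x nf_def by (subst nat_pow_Suc2) (simp_all add: Z_pow_U m_assoc)
    thus ?thesis by (rule NF_I) (use 1 f in auto)
  next
    case 2
    let ?y = "pos_word l \<otimes> S [^] f"
    have "U \<otimes> x = Z [^] k \<otimes> (U \<otimes> (U [^] e \<otimes> ?y))"
      by (simp add: x nf_def Z_pow_U)
    also have "U \<otimes> (U [^] e \<otimes> ?y) = Z [^] (1::int) \<otimes> ?y"
      by (simp add: 2 numeral_2_eq_2 U_U_U[symmetric] m_assoc int_pow_1)
    finally have "U \<otimes> x = nf (k + 1) 0 l f"
      by (simp add: nf_def int_pow_mult m_assoc)
    thus ?thesis by (rule NF_I) (use f in auto)
  qed
qed

lemma NF_S: assumes "x \<in> NF" shows "S \<otimes> x \<in> NF"
proof -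
  obtain k e l f where x: "x = nf k e l f" and e: "e < 3" and f: "f < 2"
    using assms by (auto simp: NF_def)
  let ?y = "pos_word l \<otimes> S [^] f"
  have Sx: "S \<otimes> x = Z [^] k \<otimes> (S \<otimes> (U [^] e \<otimes> ?y))"
    by (simp add: x nf_def Z_pow_S)
  \<comment> \<open>If no power of U leads, S meets the first letter and turns it into U or U^2; if
    one does, S absorbs it and a new letter appears. The trailing power of S is touched only when
    the word is empty.\<close>
  consider "e = 0" "l = []" "f = 0" | "e = 0" "l = []" "f = 1" | l' where "e = 0" "l = True # l'"
    | l' where "e = 0" "l = False # l'" | "e = 1" | "e = 2"
    using e f by (cases l) (auto, linarith+)
  thus ?thesis
  proof cases
    case 1
    have "S \<otimes> x = nf k 0 [] 1" unfolding Sx by (simp add: 1 nf_def)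
    thus ?thesis by (intro NF_I) auto
  next
    case 2
    have "S \<otimes> x = Z [^] k \<otimes> (Z [^] (1::int) \<otimes> \<one>)"
      unfolding Sx by (simp add: 2 Z_def int_pow_1)
    also have "\<dots> = nf (k + 1) 0 [] 0" by (simp add: nf_def int_pow_mult)
    finally show ?thesis by (intro NF_I) auto
  next
    case 3
    have "S \<otimes> x = nf k 1 l' f"
      unfolding Sx by (simp add: 3 nf_def m_assoc[symmetric] S_inv_a)
    thus ?thesis by (rule NF_I) (use f in auto)
  next
    case 4
    have "S \<otimes> x = nf k 2 l' f"
      unfolding Sx by (simp add: 4 nf_def m_assoc[symmetric] numeral_2_eq_2 U_U)
    thus ?thesis by (rule NF_I) (use f in auto)
  next
    case 5
    have "S \<otimes> x = Z [^] k \<otimes> (Z [^] (1::int) \<otimes> (inv a \<otimes> ?y))"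
      unfolding Sx by (simp add: 5 m_assoc[symmetric] S_U int_pow_1)
    also have "\<dots> = nf (k + 1) 0 (True # l) f" by (simp add: nf_def int_pow_mult m_assoc)
    finally show ?thesis by (rule NF_I) (use f in auto)
  next
    case 6
    have "S \<otimes> (U [^] e \<otimes> ?y) = (S \<otimes> (U \<otimes> U)) \<otimes> ?y"
      by (simp add: 6 numeral_2_eq_2 m_assoc)
    hence "S \<otimes> x = Z [^] k \<otimes> (Z [^] (1::int) \<otimes> (b \<otimes> ?y))"
      unfolding Sx by (simp add: S_U_U int_pow_1 m_assoc)
    also have "\<dots> = nf (k + 1) 0 (False # l) f" by (simp add: nf_def int_pow_mult m_assoc)
    finally show ?thesis by (rule NF_I) (use f in auto)
  qed
qed

lemma NF_gens:
  assumes x: "x \<in> NF"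
  shows "a \<otimes> x \<in> NF" "inv a \<otimes> x \<in> NF" "b \<otimes> x \<in> NF" "inv b \<otimes> x \<in> NF"
proof -
  have inv: "u = Z [^] (- 1 :: int) \<otimes> v" if "Z \<otimes> u = v" "u \<in> carrier G" for u v
    using that by (auto simp: int_pow_neg int_pow_1)
  have xc: "x \<in> carrier G" using x by (rule NF_closed)
  have "a \<otimes> x = Z [^] (- 1 :: int) \<otimes> (U \<otimes> (U \<otimes> (S \<otimes> x)))"
    by (subst inv[OF Z_a]) (simp_all add: xc m_assoc)
  thus "a \<otimes> x \<in> NF" using x by (simp add: NF_S NF_U NF_Z)
  have "inv a \<otimes> x = Z [^] (- 1 :: int) \<otimes> (S \<otimes> (U \<otimes> x))"
    by (subst inv[OF S_U[symmetric]]) (simp_all add: xc m_assoc)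
  thus "inv a \<otimes> x \<in> NF" using x by (simp add: NF_S NF_U NF_Z)
  have "b \<otimes> x = Z [^] (- 1 :: int) \<otimes> (S \<otimes> (U \<otimes> (U \<otimes> x)))"
    by (subst inv[OF S_U_U[symmetric]]) (simp_all add: xc m_assoc)
  thus "b \<otimes> x \<in> NF" using x by (simp add: NF_S NF_U NF_Z)
  have "inv b \<otimes> x = Z [^] (- 1 :: int) \<otimes> (U \<otimes> (S \<otimes> x))"
    by (subst inv[OF Z_inv_b]) (simp_all add: xc m_assoc)
  thus "inv b \<otimes> x \<in> NF" using x by (simp add: NF_S NF_U NF_Z)
qed

lemma one_NF: "\<one> \<in> NF"
  by (rule NF_I[of _ 0 0 "[]" 0]) (auto simp: nf_def)

end

interpretation B3: group B3
  unfolding B3_def by (rule group_presented_group)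

interpretation B3: braid3 B3 "b3 BA" "b3 BB"
proof
  show "b3 BA \<in> carrier B3" "b3 BB \<in> carrier B3"
    unfolding b3_def B3_def by auto
  show "b3 BA \<otimes>\<^bsub>B3\<^esub> b3 BB \<otimes>\<^bsub>B3\<^esub> b3 BA = b3 BB \<otimes>\<^bsub>B3\<^esub> b3 BA \<otimes>\<^bsub>B3\<^esub> b3 BB"
    unfolding b3_def B3_def
    by (simp add: presented_group_mult word_class_rel b3_rels_def)
qed

lemma B3_carrier_NF: "carrier B3 \<subseteq> B3.NF"
proof
  fix x assume "x \<in> carrier B3"
  then obtain w where w: "w \<in> words UNIV" "x = word_class UNIV b3_rels w"
    unfolding B3_def by (rule presented_group_carrierE)
  have eq: "word_class UNIV b3_rels [Pos g] = b3 g" for g by (simp add: b3_def)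
  have "word_eval B3 b3 w \<in> B3.NF"
    using w(1)
  proof (induction rule: words_induct)
    case (Pos g w) thus ?case by (cases g rule: b3_gen.exhaust) (simp_all add: B3.NF_gens)
  next
    case (Neg g w) thus ?case by (cases g rule: b3_gen.exhaust) (simp_all add: B3.NF_gens)
  qed (simp add: B3.one_NF)
  thus "x \<in> B3.NF" using w word_eval_presented_group[of w UNIV b3_rels] by (simp add: eq B3_def)
qed

section \<open>Matrices of the normal forms; kernel and image of the map to SL(2, Z)\<close>

definition mat2 :: "int \<Rightarrow> int \<Rightarrow> int \<Rightarrow> int \<Rightarrow> int^2^2" where
  "mat2 p q r s = vector [vector [p, q], vector [r, s]]"

lemma mat2_mult: "mat2 p q r s ** mat2 p' q' r' s' =
    mat2 (p * p' + q * r') (p * q' + q * s') (r * p' + s * r') (r * q' + s * s')"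
  by (simp add: mat2_def vec_eq_iff forall_2 matrix_matrix_mult_def sum_2)

lemma det_mat2: "det (mat2 p q r s) = p * s - q * r"
  by (simp add: mat2_def det_2)

lemma mat2_eq_iff: "mat2 p q r s = mat2 p' q' r' s' \<longleftrightarrow> p = p' \<and> q = q' \<and> r = r' \<and> s = s'"
  by (auto simp: mat2_def vec_eq_iff forall_2)

lemma mat_1_mat2: "mat 1 = mat2 1 0 0 1"
  by (simp add: mat2_def vec_eq_iff forall_2 mat_def)

lemma uminus_mat2: "- mat2 p q r s = mat2 (- p) (- q) (- r) (- s)"
  by (simp add: mat2_def vec_eq_iff forall_2)

lemma mat2_cases: obtains p q r s where "M = mat2 p q r s"
  by (rule that[of "M $ 1 $ 1" "M $ 1 $ 2" "M $ 2 $ 1" "M $ 2 $ 2"])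
     (simp add: mat2_def vec_eq_iff forall_2)

lemma minus_mat_1_mult: "- mat 1 ** M = - (M :: int^2^2)"
  by (cases M rule: mat2_cases) (simp add: mat2_mult mat_1_mat2 uminus_mat2)

lemmas mat2_simps = mat2_mult det_mat2 mat2_eq_iff mat_1_mat2 uminus_mat2

lemma SL2Z_simps: "carrier SL2Z = {M. det M = 1}" "\<one>\<^bsub>SL2Z\<^esub> = mat 1" "x \<otimes>\<^bsub>SL2Z\<^esub> y = x ** y"
  by (simp_all add: SL2Z_def)

interpretation SL2Z: group SL2Z
proof (rule groupI)
  show "\<exists>y\<in>carrier SL2Z. y \<otimes>\<^bsub>SL2Z\<^esub> x = \<one>\<^bsub>SL2Z\<^esub>" if x: "x \<in> carrier SL2Z" for x
  proof -
    obtain p q r s where "x = mat2 p q r s" by (rule mat2_cases)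
    thus ?thesis using x
      by (intro bexI[of _ "mat2 s (- q) (- r) p"]) (auto simp: SL2Z_simps mat2_simps algebra_simps)
  qed
qed (auto simp: SL2Z_simps det_mul matrix_mul_assoc)

lemma b3_matrix_mat2: "b3_matrix BA = mat2 1 1 0 1" "b3_matrix BB = mat2 1 0 (- 1) 1"
  by (simp_all add: mat2_def)

lemma b3_to_SL2Z_hom: "b3_to_SL2Z \<in> hom B3 SL2Z"
  and b3_to_SL2Z_b3: "b3_to_SL2Z (b3 g) = b3_matrix g"
proof -
  have c: "b3_matrix g \<in> carrier SL2Z" for g
    by (cases g) (simp_all add: b3_matrix_mat2 SL2Z_simps mat2_simps del: b3_matrix.simps)
  have r: "word_eval SL2Z b3_matrix u = word_eval SL2Z b3_matrix v" if "(u, v) \<in> b3_rels" for u v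
    using that
    by (auto simp: b3_rels_def SL2Z_simps b3_matrix_mat2 mat2_simps simp del: b3_matrix.simps)
  show "b3_to_SL2Z \<in> hom B3 SL2Z"
    unfolding b3_to_SL2Z_def B3_def by (rule SL2Z.pres_lift_hom) (use c r in auto)
  show "b3_to_SL2Z (b3 g) = b3_matrix g"
    unfolding b3_to_SL2Z_def b3_def
    by (subst SL2Z.pres_lift_class) (use c[of g] c r in \<open>auto simp del: b3_matrix.simps\<close>)
qed

interpretation pi: group_hom B3 SL2Z b3_to_SL2Z
  by (simp add: group_hom_def group_hom_axioms_def B3.is_group SL2Z.is_group b3_to_SL2Z_hom)

lemma b3_to_SL2Z_SUZ:
  "b3_to_SL2Z B3.S = mat2 0 1 (- 1) 0"
  "b3_to_SL2Z B3.U = mat2 0 1 (- 1) 1"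
  "b3_to_SL2Z B3.Z = - mat 1"
  by (simp_all add: B3.S_def B3.U_def B3.Z_def b3_to_SL2Z_b3 b3_matrix_mat2 SL2Z_simps mat2_simps
      del: b3_matrix.simps)

text \<open>Up to the signs of the off-diagonal entries, the matrices below are the free monoid generated
  by the two elementary nonnegative matrices.\<close>

lemma b3_to_SL2Z_pos_word:
  "\<exists>p q r s. b3_to_SL2Z (B3.pos_word l) = mat2 p q r s \<and> 1 \<le> p \<and> q \<le> 0 \<and> r \<le> 0 \<and> 1 \<le> s \<and>
     (l \<noteq> [] \<longrightarrow> q < 0 \<or> r < 0)"
proof (induction l)
  case Nil
  show ?case by (simp add: SL2Z_simps mat2_simps)
next
  case (Cons x l)
  then obtain p q r s where IH: "b3_to_SL2Z (B3.pos_word l) = mat2 p q r s" "1 \<le> p" "q \<le> 0"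
    "r \<le> 0" "1 \<le> s" by blast
  have inv: "inv\<^bsub>SL2Z\<^esub> (mat2 1 1 0 1) = mat2 1 (- 1) 0 1"
    by (rule SL2Z.inv_equality) (auto simp: SL2Z_simps mat2_simps)
  \<comment> \<open>The letter \<open>inv a\<close> subtracts the second row from the first, and
    \<open>b\<close> subtracts the first from the second. With diagonal entries at least 1 and the
    others at most 0, the diagonal cannot shrink and one off-diagonal entry becomes strictly
    negative.\<close>
  show ?case
    using IH by (cases x) (auto simp: b3_to_SL2Z_b3 b3_matrix_mat2 inv SL2Z_simps mat2_simps
        simp del: b3_matrix.simps)
qed

lemma SL2Z_minus_one_pow:
  "- mat 1 [^]\<^bsub>SL2Z\<^esub> (k::int) = (if even k then mat 1 else - mat 1)"
proof -
  have c: "- mat 1 \<in> carrier SL2Z" and sq: "- mat 1 \<otimes>\<^bsub>SL2Z\<^esub> - mat 1 = \<one>\<^bsub>SL2Z\<^esub>"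
    by (simp_all add: SL2Z_simps mat2_simps)
  have ev: "- mat 1 [^]\<^bsub>SL2Z\<^esub> (2 * j) = \<one>\<^bsub>SL2Z\<^esub>" for j :: int
  proof -
    have "- mat 1 [^]\<^bsub>SL2Z\<^esub> (2 * j) = (- mat 1 [^]\<^bsub>SL2Z\<^esub> (2::int)) [^]\<^bsub>SL2Z\<^esub> j"
      using c by (simp add: SL2Z.int_pow_pow)
    also have "- mat 1 [^]\<^bsub>SL2Z\<^esub> (2::int) = - mat 1 [^]\<^bsub>SL2Z\<^esub> (1 + 1 :: int)" by simp
    also have "\<dots> = \<one>\<^bsub>SL2Z\<^esub>" using c sq by (simp only: SL2Z.int_pow_mult SL2Z.int_pow_1)
    finally show ?thesis by (simp add: SL2Z.int_pow_one)
  qed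
  show ?thesis
  proof (cases "even k")
    case True then show ?thesis using ev by (auto simp: SL2Z_simps elim!: evenE)
  next
    case False
    then obtain j where j: "k = 2 * j + 1" by (rule oddE)
    show ?thesis using c False unfolding j
      by (simp add: SL2Z.int_pow_mult ev SL2Z.int_pow_1) 
  qed
qed

lemma b3_to_SL2Z_kernel:
  assumes x: "x \<in> carrier B3" and pm: "b3_to_SL2Z x \<in> {mat 1, - mat 1}"
  shows "\<exists>k::int. x = B3.Z [^]\<^bsub>B3\<^esub> k \<and> (b3_to_SL2Z x = mat 1 \<longrightarrow> even k)"
proof -
  obtain k e l f where x: "x = B3.nf k e l f" and ef: "e < 3" "f < 2"
    using x B3_carrier_NF by (auto simp: B3.NF_def)
  \<comment> \<open>The matrix of the normal form without its central power, which contributes only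
    the sign (-1)^k.\<close>
  define P where "P = b3_to_SL2Z (B3.U [^]\<^bsub>B3\<^esub> e \<otimes>\<^bsub>B3\<^esub> (B3.pos_word l \<otimes>\<^bsub>B3\<^esub> B3.S [^]\<^bsub>B3\<^esub> f))"
  have px: "b3_to_SL2Z x = (if even k then P else - P)"
    by (simp add: x B3.nf_def P_def[symmetric] pi.hom_int_pow b3_to_SL2Z_SUZ SL2Z_minus_one_pow)
       (auto simp: P_def SL2Z_simps minus_mat_1_mult)
  obtain p q r s where l: "b3_to_SL2Z (B3.pos_word l) = mat2 p q r s" "1 \<le> p" "q \<le> 0" "r \<le> 0"
    "1 \<le> s" "l \<noteq> [] \<longrightarrow> q < 0 \<or> r < 0" using b3_to_SL2Z_pos_word[of l] by blast
  have e: "e = 0 \<or> e = 1 \<or> e = 2" and f: "f = 0 \<or> f = 1" using ef by auto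
  have P: "P \<in> {mat 1, - mat 1}" using pm px by (metis minus_minus insert_iff empty_iff)
  \<comment> \<open>Six products U^e M S^f are multiplied out, M being the matrix of the word.
    Unless e = f = 0, the sign pattern of M leaves a nonzero off-diagonal entry; in the remaining
    case an off-diagonal entry of M is nonzero unless the word is empty.\<close>
  have "e = 0 \<and> f = 0 \<and> l = []"
    using e f P l unfolding P_def
    by (auto simp: pi.hom_nat_pow b3_to_SL2Z_SUZ l(1) SL2Z_simps mat2_simps numeral_2_eq_2)
  thus ?thesis using px
    by (intro exI[of _ k]) (auto simp: x B3.nf_def P_def SL2Z_simps mat2_simps)
qed

text \<open>Euclid's algorithm on the first column, using the rotation S and the shears
  \<open>mat2 1 m 0 1\<close>.\<close>

lemma b3_to_SL2Z_surj: "carrier SL2Z \<subseteq> b3_to_SL2Z ` carrier B3"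
proof -
  define K where "K = b3_to_SL2Z ` carrier B3"
  have K: "subgroup K SL2Z" unfolding K_def by (rule pi.img_is_subgroup)
  have mult: "M ** N \<in> K" if "M \<in> K" "N \<in> K" for M N
    using subgroup.m_closed[OF K that] by (simp add: SL2Z_simps)
  have S: "mat2 0 1 (- 1) 0 \<in> K" unfolding K_def b3_to_SL2Z_SUZ[symmetric] by (intro imageI) simp
  have Am: "mat2 1 m 0 1 \<in> K" for m
  proof -
    have pow: "mat2 1 1 0 1 [^]\<^bsub>SL2Z\<^esub> (j::nat) = mat2 1 (int j) 0 1" for j
      by (induction j) (simp_all add: SL2Z_simps mat2_simps)
    have A: "mat2 1 1 0 1 \<in> K"
      unfolding K_def b3_matrix_mat2[symmetric] b3_to_SL2Z_b3[symmetric] by (intro imageI) simp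
    have p: "mat2 1 (int j) 0 1 \<in> K" for j
      unfolding pow[symmetric] 
      by (induction j) (auto simp: A mult SL2Z_simps subgroup.one_closed[OF K, unfolded SL2Z_simps])
    show ?thesis
    proof (cases "0 \<le> m")
      case True thus ?thesis using p[of "nat m"] by simp
    next
      case False
      have "inv\<^bsub>SL2Z\<^esub> (mat2 1 (int (nat (- m))) 0 1) = mat2 1 m 0 1"
        by (rule SL2Z.inv_equality) (use False in \<open>auto simp: SL2Z_simps mat2_simps\<close>)
      thus ?thesis using subgroup.m_inv_closed[OF K p[of "nat (- m)"]] by simp
    qed
  qed
  have "mat2 p q r s \<in> K" if "p * s - q * r = 1" for p q r s
    using that
  proof (induction "nat \<bar>r\<bar>" arbitrary: p q r s rule: less_induct)
    case less
    show ?case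
    proof (cases "r = 0")
      case True
      hence "p = 1 \<and> s = 1 \<or> p = - 1 \<and> s = - 1"
        using less.prems by (simp add: zmult_eq_1_iff)
      \<comment> \<open>S^2 is -1, which supplies the triangular matrices with diagonal -1.\<close>
      moreover have "mat2 0 1 (- 1) 0 ** (mat2 0 1 (- 1) 0 ** mat2 1 (- q) 0 1) \<in> K"
        by (intro mult S Am)
      ultimately show ?thesis using Am[of q] True by (auto simp: mat2_simps)
    next
      case False
      define m where "m = p div r"
      let ?p' = "- r" let ?r' = "p - m * r"
      have "mat2 r s (- ?r') (- (q - m * s)) \<in> K"
      proof (rule less.hyps)
        have "?r' = p mod r" by (simp add: m_def minus_div_mult_eq_mod)
        thus "nat \<bar>- ?r'\<bar> < nat \<bar>r\<bar>" using False by (simp add: abs_mod_less)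
        show "r * - (q - m * s) - s * - ?r' = 1" using less.prems by (simp add: algebra_simps)
      qed
      \<comment> \<open>S^3 is the inverse of S; it swaps the rows back with the right sign, and the
        shear then restores p from the remainder p mod r.\<close>
      hence "mat2 1 m 0 1 ** (mat2 0 1 (- 1) 0 ** (mat2 0 1 (- 1) 0 ** (mat2 0 1 (- 1) 0 **
          mat2 r s (- ?r') (- (q - m * s))))) \<in> K"
        by (intro mult Am S)
      thus ?thesis by (simp add: mat2_simps algebra_simps)
    qed
  qed
  thus ?thesis unfolding K_def[symmetric]
    by (auto simp: SL2Z_simps det_mat2) (metis det_mat2 mat2_cases)
qed

lemma PSL2Z_normal: "{mat 1, - mat 1} \<lhd> SL2Z"
proof (rule SL2Z.normal_inv_iff[THEN iffD2], intro conjI ballI)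
  have m: "- mat 1 \<in> carrier SL2Z" "- mat 1 \<otimes>\<^bsub>SL2Z\<^esub> - mat 1 = \<one>\<^bsub>SL2Z\<^esub>"
    by (simp_all add: SL2Z_simps mat2_simps)
  show "subgroup {mat 1, - mat 1} SL2Z"
  proof (rule SL2Z.subgroupI)
    show "inv\<^bsub>SL2Z\<^esub> x \<in> {mat 1, - mat 1}" if "x \<in> {mat 1, - mat 1}" for x
      using that SL2Z.inv_one SL2Z.inv_equality[OF m(2) m(1) m(1)] by (auto simp: SL2Z_simps)
  qed (use m in \<open>auto simp: SL2Z_simps mat2_simps\<close>)
  fix x h :: "int^2^2" assume x: "x \<in> carrier SL2Z" and h: "h \<in> {mat 1, - mat 1}"
  have "x \<otimes>\<^bsub>SL2Z\<^esub> h = h \<otimes>\<^bsub>SL2Z\<^esub> x"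
    using h by (cases x rule: mat2_cases) (auto simp: SL2Z_simps mat2_simps)
  moreover have "h \<in> carrier SL2Z" using h m by (auto simp: SL2Z_simps)
  ultimately show "x \<otimes>\<^bsub>SL2Z\<^esub> h \<otimes>\<^bsub>SL2Z\<^esub> inv\<^bsub>SL2Z\<^esub> x \<in> {mat 1, - mat 1}"
    using x h by (simp add: SL2Z.m_assoc)
qed

text \<open>The kernel consists of even powers of Z, that is of powers of Z Z, so triviality has to
  be tested on a single element.\<close>

lemma factor_through_SL2Z:
  assumes H: "group H" and F: "F \<in> hom B3 H" and 1: "F (B3.Z \<otimes>\<^bsub>B3\<^esub> B3.Z) = \<one>\<^bsub>H\<^esub>"
  shows "\<exists>\<phi>\<in>hom SL2Z H. \<forall>x\<in>carrier B3. \<phi> (b3_to_SL2Z x) = F x"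
proof (rule hom_factor_surj[OF B3.is_group SL2Z.is_group H b3_to_SL2Z_hom F b3_to_SL2Z_surj])
  interpret F: group_hom B3 H F
    by (simp add: group_hom_def group_hom_axioms_def B3.is_group H F)
  fix x assume "x \<in> carrier B3" "b3_to_SL2Z x = \<one>\<^bsub>SL2Z\<^esub>"
  then obtain k where "x = B3.Z [^]\<^bsub>B3\<^esub> (k::int)" "even k"
    using b3_to_SL2Z_kernel[of x] by (auto simp: SL2Z_simps)
  then obtain j where "x = B3.Z [^]\<^bsub>B3\<^esub> (2 * j :: int)" by (auto elim!: evenE)
  also have "\<dots> = (B3.Z [^]\<^bsub>B3\<^esub> (1 + 1 :: int)) [^]\<^bsub>B3\<^esub> j" by (simp add: B3.int_pow_pow)
  also have "B3.Z [^]\<^bsub>B3\<^esub> (1 + 1 :: int) = B3.Z \<otimes>\<^bsub>B3\<^esub> B3.Z"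
    by (simp only: B3.int_pow_mult B3.int_pow_1 B3.SUZ_closed)
  finally show "F x = \<one>\<^bsub>H\<^esub>"
    by (simp only: F.hom_int_pow B3.m_closed B3.SUZ_closed 1 F.H.int_pow_one)
qed

lemma factor_through_PSL2Z:
  assumes H: "group H" and F: "F \<in> hom B3 H" and 1: "F B3.Z = \<one>\<^bsub>H\<^esub>"
  shows "\<exists>\<phi>\<in>hom PSL2Z H. \<forall>x\<in>carrier B3. \<phi> (psl_class (b3_to_SL2Z x)) = F x"
proof -
  interpret F: group_hom B3 H F
    by (simp add: group_hom_def group_hom_axioms_def B3.is_group H F)
  interpret N: normal "{mat 1, - mat 1}" SL2Z by (rule PSL2Z_normal)
  have hom: "(psl_class \<circ> b3_to_SL2Z) \<in> hom B3 PSL2Z"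
    by (rule hom_compose[OF b3_to_SL2Z_hom])
       (use N.r_coset_hom_Mod in \<open>simp add: psl_class_def[abs_def] PSL2Z_def\<close>)
  have surj: "carrier PSL2Z \<subseteq> (psl_class \<circ> b3_to_SL2Z) ` carrier B3"
    using b3_to_SL2Z_surj unfolding PSL2Z_def carrier_FactGroup psl_class_def by fastforce
  have "\<exists>\<phi>\<in>hom PSL2Z H. \<forall>x\<in>carrier B3. \<phi> ((psl_class \<circ> b3_to_SL2Z) x) = F x"
  proof (rule hom_factor_surj[OF B3.is_group _ H hom F surj])
    show "group PSL2Z" unfolding PSL2Z_def by (rule N.factorgroup_is_group)
    fix x assume x: "x \<in> carrier B3" "(psl_class \<circ> b3_to_SL2Z) x = \<one>\<^bsub>PSL2Z\<^esub>"
    have "b3_to_SL2Z x \<in> {mat 1, - mat 1}"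
      using x SL2Z.coset_join1[OF _ _ N.subgroup_axioms, of "b3_to_SL2Z x"]
      by (simp add: PSL2Z_def psl_class_def)
    then obtain k where "x = B3.Z [^]\<^bsub>B3\<^esub> (k::int)" using b3_to_SL2Z_kernel[OF x(1)] by blast
    thus "F x = \<one>\<^bsub>H\<^esub>" by (simp add: F.hom_int_pow 1 F.H.int_pow_one)
  qed
  thus ?thesis by simp
qed

section \<open>The invariant form and the reflections of an affine root datum\<close>

section \<open>Affine root data\<close>

text \<open>The value of the i-th simple coroot on a vector, read off from the Cartan matrix alone;
  by \<open>form_coroot\<close> it agrees with the form, so the reflections can be handled without
  the factors d_i.\<close>

definition pairing :: "nat \<Rightarrow> (nat \<Rightarrow> nat \<Rightarrow> int) \<Rightarrow> nat \<Rightarrow> rvec \<Rightarrow> real" where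
  "pairing n A i x = (\<Sum>k\<le>n. real_of_int (A i k) * x k)"

text \<open>Collects what the geometry needs to know about the labels, so that the classification
  enters only when the locale is instantiated. The last assumption is the symmetry of A i j / d_i,
  cleared of denominators.\<close>

locale affine_root_data =
  fixes n :: nat and A :: "nat \<Rightarrow> nat \<Rightarrow> int"
  assumes cartan: "gen_cartan_matrix n A"
    and indec: "indecomposable n A"
    and label_pos: "i \<le> n \<Longrightarrow> 0 < labels n A i"
    and colabel_pos: "i \<le> n \<Longrightarrow> 0 < colabels n A i"
    and label_outside: "n < j \<Longrightarrow> labels n A j = 0"
    and label_kernel: "i \<le> n \<Longrightarrow> (\<Sum>j\<le>n. A i j * int (labels n A j)) = 0"
    and label_sym: "i \<le> n \<Longrightarrow> j \<le> n \<Longrightarrow>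
      A i j * int (colabels n A i) * int (labels n A j) =
      A j i * int (colabels n A j) * int (labels n A i)"
begin

declare One_nat_def [simp del]

abbreviation "al \<equiv> simple_root"
abbreviation "F \<equiv> form n A"
abbreviation "cp \<equiv> pairing n A"
abbreviation "sr \<equiv> simple_refl n A"
abbreviation "wp \<equiv> weyl_word n A"
abbreviation "d \<equiv> dd n A"
abbreviation "I \<equiv> {1..n}"

lemma A_diag [simp]: "i \<le> n \<Longrightarrow> A i i = 2"
  and A_off: "i \<le> n \<Longrightarrow> j \<le> n \<Longrightarrow> i \<noteq> j \<Longrightarrow> A i j \<le> 0"
  and A_zero: "i \<le> n \<Longrightarrow> j \<le> n \<Longrightarrow> A i j = 0 \<longleftrightarrow> A j i = 0"
  using cartan by (auto simp: gen_cartan_matrix_def)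

lemma d_pos: "i \<le> n \<Longrightarrow> 0 < d i"
  by (simp add: dd_def label_pos colabel_pos)

lemma d_sym:
  assumes "i \<le> n" "j \<le> n"
  shows "real_of_int (A i j) / d i = real_of_int (A j i) / d j"
proof -
  have "real_of_int (A i j * int (colabels n A i) * int (labels n A j)) =
      real_of_int (A j i * int (colabels n A j) * int (labels n A i))"
    using label_sym[OF assms] by simp
  thus ?thesis using label_pos[OF assms(1)] label_pos[OF assms(2)]
    by (simp add: dd_def field_simps)
qed

lemma cp_add: "cp i (\<lambda>k. a * x k + b * y k) = a * cp i x + b * cp i y"
  by (simp add: pairing_def sum.distrib sum_distrib_left algebra_simps)

lemma cp_diff: "cp i (\<lambda>k. x k - c * y k) = cp i x - c * cp i y"
  using cp_add[of i 1 x "- c" y] by simp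

lemma cp_scale: "cp i (\<lambda>k. c * x k) = c * cp i x"
  using cp_add[of i c x 0 x] by simp

lemma cp_al: "j \<le> n \<Longrightarrow> cp i (al j) = A i j"
  by (simp add: pairing_def simple_root_def if_distrib cong: if_cong)

lemma cp_delta: "i \<le> n \<Longrightarrow> cp i (delta n A) = 0"
proof -
  assume "i \<le> n"
  have "cp i (delta n A) = real_of_int (\<Sum>j\<le>n. A i j * int (labels n A j))"
    by (simp add: pairing_def delta_def)
  thus ?thesis using label_kernel[OF \<open>i \<le> n\<close>] by simp
qed

lemma form_cp: "F x y = (\<Sum>j\<le>n. x j * (cp j y / d j))"
  by (simp add: form_def pairing_def sum_distrib_left sum_divide_distrib algebra_simps)

lemma form_sym: "F x y = F y x"
proof -
  have eq: "x j * y k * (real_of_int (A j k) / d j) = y k * x j * (real_of_int (A k j) / d k)"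
    if "j \<le> n" "k \<le> n" for j k
    using d_sym[OF that] by simp
  show ?thesis unfolding form_def by (subst sum.swap, (rule sum.cong[OF HOL.refl])+) (rule eq, auto)
qed

lemma form_al: "i \<le> n \<Longrightarrow> F (al i) x = cp i x / d i"
  by (simp add: form_cp simple_root_def if_distrib[of "\<lambda>x. x * _"] if_distrib[of "\<lambda>x. x / _"]
      cong: if_cong)

lemma form_al': "i \<le> n \<Longrightarrow> F x (al i) = cp i x / d i"
  by (simp add: form_sym[of x] form_al)

lemma form_linear_right: "F x (\<lambda>k. a * y k + b * z k) = a * F x y + b * F x z"
  by (simp add: form_cp cp_add sum.distrib sum_distrib_left algebra_simps add_divide_distrib)

lemma form_linear_left: "F (\<lambda>k. a * y k + b * z k) x = a * F y x + b * F z x"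
  by (simp add: form_sym[of _ x] form_linear_right)

lemma form_scale_right: "F x (\<lambda>k. c * y k) = c * F x y"
  using form_linear_right[of x c y 0 y] by simp

lemma form_scale_left: "F (\<lambda>k. c * y k) x = c * F y x"
  using form_linear_left[of c y 0 y x] by simp

lemma form_coroot: "i \<le> n \<Longrightarrow> F x (simple_coroot n A i) = cp i x"
proof -
  assume i: "i \<le> n"
  have "F x (simple_coroot n A i) = d i * F x (al i)"
    using form_linear_right[of x "d i" "al i" 0 "al i"] by (simp add: simple_coroot_def)
  thus ?thesis using i d_pos[OF i] by (simp add: form_al')
qed

lemma sr_eq: "i \<le> n \<Longrightarrow> sr i x = (\<lambda>k. x k - cp i x * al i k)"
  by (simp add: simple_refl_def form_coroot)

lemma sr_linear: "i \<le> n \<Longrightarrow> sr i (\<lambda>k. a * x k + b * y k) = (\<lambda>k. a * sr i x k + b * sr i y k)"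
  by (simp add: sr_eq cp_add algebra_simps)

lemma sr_sr: "i \<le> n \<Longrightarrow> sr i (sr i x) = x"
  by (simp add: sr_eq cp_diff cp_al)

lemma form_sr: "i \<le> n \<Longrightarrow> F (sr i x) (sr i y) = F x y"
proof -
  assume i: "i \<le> n"
  have "F (sr i x) (sr i y) = F (\<lambda>k. 1 * x k + (- cp i x) * al i k) (\<lambda>k. 1 * y k + (- cp i y) * al i k)"
    using i by (simp add: sr_eq)
  also have "\<dots> = F x y"
    using i d_pos[OF i]
    by (simp only: form_linear_left form_linear_right form_al form_al' cp_al A_diag)
       (simp add: field_simps)
  finally show ?thesis .
qed

lemma wp_Nil [simp]: "wp [] = id"
  and wp_Cons: "wp (j # js) = sr j \<circ> wp js"
  by (simp_all add: weyl_word_def)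

lemma wp_append: "wp (xs @ ys) = wp xs \<circ> wp ys"
  by (induction xs) (simp_all add: wp_Cons o_assoc)

lemma wp_single: "wp [i] = sr i"
  by (simp add: wp_Cons)

lemma wp_rev: "js \<in> lists I \<Longrightarrow> wp (rev js) (wp js x) = x"
  by (induction js arbitrary: x) (simp_all add: wp_Cons wp_append sr_sr)

lemma wp_rev': "js \<in> lists I \<Longrightarrow> wp js (wp (rev js) x) = x"
  using wp_rev[of "rev js" x] by (simp add: in_lists_conv_set)

lemma wp_linear: "js \<in> lists I \<Longrightarrow>
    wp js (\<lambda>k. a * x k + b * y k) = (\<lambda>k. a * wp js x k + b * wp js y k)"
  by (induction js) (simp_all add: wp_Cons sr_linear)

lemma wp_diff: "js \<in> lists I \<Longrightarrow> wp js (\<lambda>k. x k - c * y k) = (\<lambda>k. wp js x k - c * wp js y k)"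
  using wp_linear[of js 1 x "- c" y] by simp

lemma wp_scale: "js \<in> lists I \<Longrightarrow> wp js (\<lambda>k. c * x k) = (\<lambda>k. c * wp js x k)"
  using wp_linear[of js c x 0 x] by simp

lemma wp_uminus: "js \<in> lists I \<Longrightarrow> wp js (\<lambda>k. - x k) = (\<lambda>k. - wp js x k)"
  using wp_scale[of js "- 1" x] by simp

lemma wp_sum:
  assumes "js \<in> lists I" "finite J"
  shows "wp js (\<lambda>k. \<Sum>i\<in>J. c i * f i k) = (\<lambda>k. \<Sum>i\<in>J. c i * wp js (f i) k)"
  using assms(2)
proof (induction J)
  case empty
  show ?case using wp_scale[OF assms(1), of 0] by simp
next
  case (insert j J)
  thus ?case using wp_linear[OF assms(1), of "c j" "f j" 1 "\<lambda>k. \<Sum>i\<in>J. c i * f i k"] by simp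
qed

lemma form_wp: "js \<in> lists I \<Longrightarrow> F (wp js x) (wp js y) = F x y"
  by (induction js) (simp_all add: wp_Cons form_sr)

lemma wp_outside: "js \<in> lists I \<Longrightarrow> k \<notin> I \<Longrightarrow> wp js x k = x k"
  by (induction js) (auto simp: wp_Cons sr_eq simple_root_def)

lemma wp_Ints:
  assumes "js \<in> lists I" "\<And>k. x k \<in> \<int>"
  shows "wp js x k \<in> \<int>"
proof -
  have "\<forall>k. wp js x k \<in> \<int>"
    using assms(1)
    by (induction js)
       (auto simp: wp_Cons sr_eq simple_root_def pairing_def assms(2) intro!: Ints_diff Ints_mult Ints_sum)
  thus ?thesis ..
qed

lemma al_Ints: "al i k \<in> \<int>" by (simp add: simple_root_def)

lemma decompose:
  assumes "\<And>k. k \<notin> I \<Longrightarrow> x k = 0"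
  shows "x = (\<lambda>k. \<Sum>i\<in>I. x i * al i k)"
proof
  fix k show "x k = (\<Sum>i\<in>I. x i * al i k)"
    using assms[of k] by (auto simp: simple_root_def if_distrib cong: if_cong)
qed

lemma wp_decompose:
  assumes "js \<in> lists I" "\<And>k. k \<notin> I \<Longrightarrow> x k = 0"
  shows "wp js x k = (\<Sum>i\<in>I. x i * wp js (al i) k)"
  using wp_sum[OF assms(1), of I x al] decompose[of x, OF assms(2)] by simp

text \<open>The rule w s_i w^(-1) = s_(w alpha_i). The sign \<open>e\<close> lets one statement
  serve both the longest element, which sends simple roots to negatives of simple roots, and
  elements fixing a simple root.\<close>

lemma wp_conj:
  assumes js: "js \<in> lists I" and i: "i \<in> I" and j: "j \<in> I" and e: "e * e = 1"
    and eq: "wp js (al i) = (\<lambda>k. e * al j k)"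
  shows "wp js (sr i x) = sr j (wp js x)"
proof -
  have n: "i \<le> n" "j \<le> n" using i j by auto
  have "2 / d i = F (al i) (al i)" using n by (simp add: form_al cp_al)
  also have "\<dots> = F (\<lambda>k. e * al j k) (\<lambda>k. e * al j k)" by (simp only: eq[symmetric] form_wp[OF js])
  also have "\<dots> = 2 / d j * (e * e)"
    using n by (simp add: form_scale_left form_scale_right form_al cp_al)
  \<comment> \<open>The roots alpha_i and alpha_j have equal length because w preserves the form,
    and 2 / d_i is the squared length of alpha_i.\<close>
  finally have dij: "d i = d j" using e d_pos n by (simp add: field_simps)
  have "cp i x / d i = F x (al i)" using n by (simp add: form_al')
  also have "\<dots> = F (wp js x) (\<lambda>k. e * al j k)" by (simp only: eq[symmetric] form_wp[OF js])
  also have "\<dots> = e * (cp j (wp js x) / d j)"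
    using n by (simp add: form_scale_right form_al')
  finally have "cp i x = e * cp j (wp js x)"
    using dij d_pos[OF n(2)] by (simp add: field_simps)
  hence "cp j (wp js x) = e * cp i x" using e by (metis mult.assoc mult_1)
  thus ?thesis
    using n js by (simp add: sr_eq wp_diff eq mult.assoc mult.left_commute)
qed

text \<open>Dividing coordinates by the labels u_j turns 2 (x, x) into a sum of terms -b_ij u_i u_j
  (y_i - y_j)^2, all nonnegative since the off-diagonal b_ij are at most 0. If the sum is not
  positive, y is constant along edges, hence on the connected diagram, and it vanishes at node
  0.\<close>

lemma form_definite:
  assumes "x 0 = 0" "\<And>k. k > n \<Longrightarrow> x k = 0" "F x x \<le> 0"
  shows "x k = 0"
proof -
  define u where "u j = real (labels n A j)" for j
  define y where "y j = x j / u j" for j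
  define b where "b i j = real_of_int (A i j) / d i" for i j
  have u: "0 < u j" if "j \<le> n" for j using label_pos[OF that] by (simp add: u_def)
  have xy: "x j = u j * y j" if "j \<le> n" for j using u[OF that] by (simp add: y_def)
  have bsym: "b i j = b j i" if "i \<le> n" "j \<le> n" for i j using d_sym[OF that] by (simp add: b_def)
  have ker: "(\<Sum>j\<le>n. b i j * u j) = 0" if "i \<le> n" for i
    using cp_delta[OF that]
    by (simp add: pairing_def delta_def b_def u_def sum_divide_distrib[symmetric])
  have F: "F x x = (\<Sum>i\<le>n. \<Sum>j\<le>n. b i j * u i * u j * (y i * y j))"
    unfolding form_def by (rule sum.cong[OF HOL.refl])+ (simp add: xy b_def)
  have 1: "(\<Sum>i\<le>n. \<Sum>j\<le>n. b i j * u i * u j * (y i)\<^sup>2) = 0"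
  proof (rule sum.neutral, rule ballI)
    fix i assume "i \<in> {..n}"
    have "(\<Sum>j\<le>n. b i j * u i * u j * (y i)\<^sup>2) = u i * (y i)\<^sup>2 * (\<Sum>j\<le>n. b i j * u j)"
      by (simp add: sum_distrib_left algebra_simps)
    thus "(\<Sum>j\<le>n. b i j * u i * u j * (y i)\<^sup>2) = 0" using ker \<open>i \<in> {..n}\<close> by simp
  qed
  have 2: "(\<Sum>i\<le>n. \<Sum>j\<le>n. b i j * u i * u j * (y j)\<^sup>2) = 0"
    unfolding 1[symmetric]
    by (subst sum.swap, (rule sum.cong[OF HOL.refl])+) (simp add: bsym)
  define t where "t i j = - b i j * u i * u j * (y i - y j)\<^sup>2" for i j
  have "(\<Sum>i\<le>n. \<Sum>j\<le>n. t i j) = 2 * F x x -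
      (\<Sum>i\<le>n. \<Sum>j\<le>n. b i j * u i * u j * (y i)\<^sup>2) - (\<Sum>i\<le>n. \<Sum>j\<le>n. b i j * u i * u j * (y j)\<^sup>2)"
    unfolding F t_def
    by (simp add: sum_distrib_left sum_subtractf[symmetric] power2_eq_square algebra_simps)
  hence le: "(\<Sum>i\<le>n. \<Sum>j\<le>n. t i j) \<le> 0" using 1 2 assms(3) by simp
  have t0: "0 \<le> t i j" if "i \<le> n" "j \<le> n" for i j
  proof (cases "i = j")
    case False
    hence "b i j \<le> 0" using A_off[OF that] d_pos[OF that(1)] by (simp add: b_def divide_le_0_iff)
    thus ?thesis using u that by (simp add: t_def mult_nonpos_nonneg less_imp_le)
  qed (simp add: t_def)
  have tz: "t i j = 0" if "i \<le> n" "j \<le> n" for i j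
  proof -
    have "(\<Sum>j\<le>n. t i j) \<le> (\<Sum>i\<le>n. \<Sum>j\<le>n. t i j)"
      using that t0 by (intro member_le_sum) (auto intro: sum_nonneg)
    moreover have "t i j \<le> (\<Sum>j\<le>n. t i j)"
      using that t0 by (intro member_le_sum) auto
    ultimately show ?thesis using le t0[OF that] by linarith
  qed
  define J where "J = {j. j \<le> n \<and> y j = 0}"
  have "J = {..n}"
  proof (rule ccontr)
    assume "J \<noteq> {..n}"
    moreover have "0 \<in> J" using assms(1) by (simp add: J_def y_def)
    ultimately obtain i j where ij: "i \<in> J" "j \<in> {..n} - J" "A i j \<noteq> 0"
      using indec[unfolded indecomposable_def, rule_format, of J] by (auto simp: J_def)
    hence "y i = 0" "y j \<noteq> 0" "i \<le> n" "j \<le> n" by (auto simp: J_def)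
    moreover have "b i j \<noteq> 0" using ij d_pos[of i] by (simp add: b_def J_def)
    ultimately show False using tz[of i j] u[of i] u[of j] by (simp add: t_def)
  qed
  hence "k \<le> n \<Longrightarrow> x k = 0" using xy[of k] by (auto simp: J_def)
  thus ?thesis using assms(2)[of k] by linarith
qed

lemma laces_bound:
  assumes "i \<in> I" "j \<in> I" "i \<noteq> j"
  shows "laces A i j \<in> {0, 1, 2, 3}"
proof -
  have n: "i \<le> n" "j \<le> n" using assms by auto
  \<comment> \<open>Twice the component of alpha_j orthogonal to alpha_i; its squared length is (8 -
    2 \<open>laces A i j\<close>) / d_j, so positivity bounds the laces.\<close>
  let ?v = "\<lambda>k. 2 * al j k + (- real_of_int (A i j)) * al i k"
  have "\<not> F ?v ?v \<le> 0"
  proof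
    assume "F ?v ?v \<le> 0"
    hence "?v j = 0" by (rule form_definite[rotated 2]) (use assms in \<open>auto simp: simple_root_def\<close>)
    thus False using assms by (simp add: simple_root_def)
  qed
  moreover have "F ?v ?v = 4 * (2 / d j) - 2 * A i j * (A j i / d j) - 2 * A i j * (A i j / d i)
      + A i j * A i j * (2 / d i)"
    using n by (simp only: form_linear_left form_linear_right form_al cp_al A_diag) (simp add: algebra_simps)
  moreover have "\<dots> = (8 - 2 * real_of_int (laces A i j)) / d j"
  proof -
    have "A i j * A i j * (2 / d i) = 2 * A i j * (A i j / d i)" by simp
    also have "\<dots> = 2 * A i j * (A j i / d j)" using d_sym[OF n] by simp
    finally show ?thesis using d_sym[OF n] by (simp add: laces_def diff_divide_distrib)
  qed
  ultimately have "0 < (8 - 2 * real_of_int (laces A i j)) / d j" by linarith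
  hence "laces A i j < 4" using d_pos[OF n(2)] by (simp add: zero_less_divide_iff)
  moreover have "0 \<le> laces A i j"
    unfolding laces_def using A_off n assms(3) by (intro mult_nonpos_nonpos) auto
  ultimately show ?thesis by auto
qed

end

section \<open>Combinatorics of alternating words in two letters\<close>

section \<open>Alternating words\<close>

lemma length_alternating [simp]: "length (alternating k x y) = k"
  by (induction k arbitrary: x y) auto

lemma set_alternating: "set (alternating k x y) \<subseteq> {x, y}"
  by (induction k arbitrary: x y) auto

lemma alternating_numeral:
  "alternating 1 x y = [x]"
  "alternating 2 x y = [x, y]"
  "alternating 3 x y = [x, y, x]"
  "alternating 4 x y = [x, y, x, y]"
  "alternating 5 x y = [x, y, x, y, x]"
  "alternating 6 x y = [x, y, x, y, x, y]"
  by (simp_all add: numeral_eq_Suc)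

lemma alternating_snoc: "alternating (Suc k) x y = alternating k x y @ [if even k then x else y]"
  by (induction k arbitrary: x y) auto

lemma rev_alternating: "rev (alternating k x y) = (if odd k then alternating k x y else alternating k y x)"
proof (induction k arbitrary: x y)
  case (Suc k)
  have "rev (alternating (Suc k) x y) = rev (alternating k y x) @ [x]" by simp
  also have "\<dots> = (if odd (Suc k) then alternating (Suc k) x y else alternating (Suc k) y x)"
    unfolding Suc.IH alternating_snoc by auto
  finally show ?case .
qed simp

lemma alternating_prefix:
  "m \<le> k \<Longrightarrow> \<exists>r. alternating k x y = alternating m x y @ r \<and> set r \<subseteq> {x, y}"
proof (induction m arbitrary: k x y)
  case 0
  thus ?case using set_alternating[of k x y] by auto
next
  case (Suc m)
  then obtain k' where k: "k = Suc k'" "m \<le> k'" by (cases k) auto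
  show ?case using Suc.IH[OF k(2), of y x] k(1) by auto
qed

lemma alternatingI:
  assumes "set r \<subseteq> {i, t}" "i \<noteq> t" "\<And>p s q. r \<noteq> p @ s # s # q" "\<And>q. r \<noteq> i # q"
  shows "r = alternating (length r) t i"
  using assms
proof (induction r arbitrary: i t)
  case (Cons x r)
  have x: "x = t" using Cons.prems(1,4) by auto
  have "r = alternating (length r) i t"
  proof (rule Cons.IH)
    show "set r \<subseteq> {t, i}" using Cons.prems(1) by auto
    show "t \<noteq> i" using Cons.prems(2) by simp
    show "r \<noteq> p @ s # s # q" for p s q using Cons.prems(3)[of "x # p" s q] by auto
    show "r \<noteq> t # q" for q using Cons.prems(3)[of "[]" x q] x by auto
  qed
  thus ?case using x by simp
qed simp

section \<open>Lengths and signs of roots in the finite Weyl group\<close>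

section \<open>The finite Weyl group as a Coxeter group\<close>

context affine_root_data
begin

abbreviation "m \<equiv> braid_length A"

abbreviation ll :: "nat list \<Rightarrow> nat" where
  "ll js \<equiv> weyl_length n A (wp js)"

definition red :: "nat list \<Rightarrow> bool" where
  "red js \<longleftrightarrow> js \<in> lists I \<and> length js = ll js"

definition pos :: "nat list \<Rightarrow> nat \<Rightarrow> bool" where
  "pos js i \<longleftrightarrow> (\<forall>k. 0 \<le> wp js (al i) k)"

definition neg :: "nat list \<Rightarrow> nat \<Rightarrow> bool" where
  "neg js i \<longleftrightarrow> (\<forall>k. wp js (al i) k \<le> 0)"

lemma ll_le: "js \<in> lists I \<Longrightarrow> ll js \<le> length js"
  unfolding weyl_length_def by (rule Least_le) auto

lemma ex_red:
  assumes "js \<in> lists I"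
  obtains us where "red us" "wp us = wp js" "length us = ll js"
proof -
  have "\<exists>us\<in>lists I. length us = ll js \<and> wp us = wp js"
    unfolding weyl_length_def by (rule LeastI_ex) (use assms in auto)
  thus ?thesis using that by (auto simp: red_def)
qed

lemma red_lists: "red js \<Longrightarrow> js \<in> lists I" by (simp add: red_def)

lemma redI: "red us \<Longrightarrow> wp us = wp vs \<Longrightarrow> length us = length vs \<Longrightarrow> vs \<in> lists I \<Longrightarrow> red vs"
  by (simp add: red_def)

lemma ll_append: "us \<in> lists I \<Longrightarrow> vs \<in> lists I \<Longrightarrow> ll (us @ vs) \<le> ll us + length vs"
proof -
  assume us: "us \<in> lists I" and vs: "vs \<in> lists I"
  obtain us' where us': "red us'" "wp us' = wp us" "length us' = ll us" using ex_red[OF us] .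
  have "ll (us @ vs) = ll (us' @ vs)" by (simp add: wp_append us')
  also have "\<dots> \<le> length (us' @ vs)" using us' vs red_lists by (intro ll_le) auto
  finally show ?thesis by (simp add: us')
qed

lemma ll_append': "us \<in> lists I \<Longrightarrow> vs \<in> lists I \<Longrightarrow> ll (us @ vs) \<le> length us + ll vs"
proof -
  assume us: "us \<in> lists I" and vs: "vs \<in> lists I"
  obtain vs' where vs': "red vs'" "wp vs' = wp vs" "length vs' = ll vs" using ex_red[OF vs] .
  have "ll (us @ vs) = ll (us @ vs')" by (simp add: wp_append vs')
  also have "\<dots> \<le> length (us @ vs')" using vs' us red_lists by (intro ll_le) auto
  finally show ?thesis by (simp add: vs')
qed

lemma wp_double: "i \<in> I \<Longrightarrow> wp (us @ i # i # vs) = wp (us @ vs)"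
  by (simp add: wp_append wp_Cons fun_eq_iff sr_sr)

lemma ll_snoc_le: "us \<in> lists I \<Longrightarrow> i \<in> I \<Longrightarrow> ll (us @ [i]) \<le> Suc (ll us)"
  using ll_append[of us "[i]"] by simp

lemma ll_snoc_ge: "us \<in> lists I \<Longrightarrow> i \<in> I \<Longrightarrow> ll us \<le> Suc (ll (us @ [i]))"
  using ll_append[of "us @ [i]" "[i]"] wp_double[of i us "[]"] by simp

lemma red_prefix: "red (us @ vs) \<Longrightarrow> red us"
  using ll_append[of us vs] ll_le[of us] by (auto simp: red_def)

lemma red_suffix: "red (us @ vs) \<Longrightarrow> red vs"
  using ll_append'[of us vs] ll_le[of vs] by (auto simp: red_def)

lemma wp_inj: "js \<in> lists I \<Longrightarrow> wp js x = wp js y \<Longrightarrow> x = y"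
  by (metis wp_rev)

lemma not_pos_neg: "js \<in> lists I \<Longrightarrow> pos js i \<Longrightarrow> neg js i \<Longrightarrow> False"
proof -
  assume js: "js \<in> lists I" and "pos js i" "neg js i"
  hence "wp js (al i) k = 0" for k by (simp add: pos_def neg_def antisym)
  hence "wp js (al i) = wp js (\<lambda>k. 0)" using wp_scale[OF js, of 0] by auto
  from wp_inj[OF js this] have "al i i = 0" by simp
  thus False by (simp add: simple_root_def)
qed

text \<open>These are the finite Cartan matrices of rank two: A_1 x A_1, A_2, and both orientations
  of B_2 and G_2.\<close>

lemma braid_cases:
  assumes "i \<in> I" "j \<in> I" "i \<noteq> j"
  obtains "m i j = 2" "A i j = 0" "A j i = 0"
  | "m i j = 3" "A i j = - 1" "A j i = - 1"
  | "m i j = 4" "A i j = - 1" "A j i = - 2" | "m i j = 4" "A i j = - 2" "A j i = - 1"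
  | "m i j = 6" "A i j = - 1" "A j i = - 3" | "m i j = 6" "A i j = - 3" "A j i = - 1"
proof -
  have n: "i \<le> n" "j \<le> n" using assms by auto
  define p q where "p = - A i j" and "q = - A j i"
  have pq: "p * q \<in> {0, 1, 2, 3}" "0 \<le> p" "0 \<le> q" "p = 0 \<longleftrightarrow> q = 0"
    using laces_bound[OF assms] A_off[OF n assms(3)] A_off[OF n(2,1)] A_zero[OF n] assms(3)
    by (auto simp: p_def q_def laces_def)
  have "p = 0 \<and> q = 0 \<or> p = 1 \<and> q = 1 \<or> p = 1 \<and> q = 2 \<or> p = 2 \<and> q = 1 \<or>
      p = 1 \<and> q = 3 \<or> p = 3 \<and> q = 1"
  proof (cases "p = 0")
    case False
    hence "1 \<le> p" "1 \<le> q" using pq by auto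
    hence "p \<le> p * q" "q \<le> p * q" by auto
    hence "p \<le> 3" "q \<le> 3" using pq(1) by auto
    hence "p = 1 \<or> p = 2 \<or> p = 3" "q = 1 \<or> q = 2 \<or> q = 3"
      using \<open>1 \<le> p\<close> \<open>1 \<le> q\<close> by linarith+
    thus ?thesis using pq(1) by auto
  qed (use pq in auto)
  thus ?thesis using that by (auto simp: p_def q_def braid_length_def laces_def)
qed

lemma m_sym: "m i j = m j i"
  by (simp add: braid_length_def laces_def mult.commute)

definition comb :: "nat \<Rightarrow> nat \<Rightarrow> real \<Rightarrow> real \<Rightarrow> rvec" where
  "comb i j p q = (\<lambda>k. p * al i k + q * al j k)"

lemma sr_comb:
  fixes p q :: real
  assumes "i \<in> I" "j \<in> I"
  shows "sr i (comb i j p q) = comb i j (- p - A i j * q) q"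
    and "sr j (comb i j p q) = comb i j p (- q - A j i * p)"
  using assms by (auto simp: comb_def sr_eq cp_add cp_al fun_eq_iff) (simp_all add: algebra_simps)

lemma sr_sub_comb:
  fixes p q :: real
  assumes "i \<in> I" "j \<in> I"
  shows "sr i (\<lambda>k. x k - p * al i k - q * al j k) =
      (\<lambda>k. x k - (cp i x - p - A i j * q) * al i k - q * al j k)"
    and "sr j (\<lambda>k. x k - p * al i k - q * al j k) =
      (\<lambda>k. x k - p * al i k - (cp j x - q - A j i * p) * al j k)"
  using assms by (auto simp: sr_eq cp_diff cp_al fun_eq_iff) (simp_all add: algebra_simps)

lemma wp_braid:
  assumes ij: "i \<in> I" "j \<in> I" "i \<noteq> j"
  shows "wp (alternating (m i j) i j) = wp (alternating (m i j) j i)"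
proof
  fix x
  \<comment> \<open>Writing x with two zero multiples makes the rules for x - p alpha_i - q alpha_j
    applicable; both words then give the same coefficients, linear in the two coroot values of
    x.\<close>
  have "wp (alternating (m i j) i j) (\<lambda>k. x k - 0 * al i k - 0 * al j k) =
      wp (alternating (m i j) j i) (\<lambda>k. x k - 0 * al i k - 0 * al j k)"
    using ij
    by (cases rule: braid_cases)
       (simp_all only: alternating_numeral wp_Cons wp_Nil o_apply id_apply
         sr_sub_comb[OF ij(1,2)], auto simp: algebra_simps)
  thus "wp (alternating (m i j) i j) x = wp (alternating (m i j) j i) x" by simp
qed

text \<open>The tested root belongs to the letter that would continue the alternating word, so this
  is the rank two instance of the principle that a reduced word followed by an ascent gives a
  positive root. Each rank two case is a direct computation.\<close>

lemma alternating_cone: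
  assumes ij: "i \<in> I" "j \<in> I" "i \<noteq> j" and k: "k < m i j"
  shows "\<exists>p q. wp (alternating k i j) (al (if even k then i else j)) = comb i j p q \<and> 0 \<le> p \<and> 0 \<le> q"
proof -
  have al: "al i = comb i j 1 0" "al j = comb i j 0 1" by (simp_all add: comb_def)
  note eval = alternating_numeral wp_Cons sr_comb[OF ij(1,2)] al
  have I: ?thesis if "wp (alternating k i j) (al (if even k then i else j)) = comb i j p q"
    "0 \<le> p" "0 \<le> q" for p q using that by blast
  from ij show ?thesis
  proof (cases rule: braid_cases)
    case 1
    hence "k = 0 \<or> k = 1" using k by auto
    thus ?thesis by (elim disjE) (rule I, simp add: eval 1, simp, simp)+
  next
    case 2
    hence "k = 0 \<or> k = 1 \<or> k = 2" using k by auto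
    thus ?thesis by (elim disjE) (rule I, simp add: eval 2, simp, simp)+
  next
    case 3
    hence "k = 0 \<or> k = 1 \<or> k = 2 \<or> k = 3" using k by auto
    thus ?thesis by (elim disjE) (rule I, simp add: eval 3, simp, simp)+
  next
    case 4
    hence "k = 0 \<or> k = 1 \<or> k = 2 \<or> k = 3" using k by auto
    thus ?thesis by (elim disjE) (rule I, simp add: eval 4, simp, simp)+
  next
    case 5
    hence "k = 0 \<or> k = 1 \<or> k = 2 \<or> k = 3 \<or> k = 4 \<or> k = 5" using k by auto
    thus ?thesis by (elim disjE) (rule I, simp add: eval 5, simp, simp)+
  next
    case 6
    hence "k = 0 \<or> k = 1 \<or> k = 2 \<or> k = 3 \<or> k = 4 \<or> k = 5" using k by auto
    thus ?thesis by (elim disjE) (rule I, simp add: eval 6, simp, simp)+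
  qed
qed

end

context affine_root_data
begin

lemma wp_comb: "js \<in> lists I \<Longrightarrow> wp js (comb i j p q) = (\<lambda>k. p * wp js (al i) k + q * wp js (al j) k)"
  by (simp add: comb_def wp_linear)

lemma m_pos: "0 < m i j"
  by (simp add: braid_length_def)

text \<open>Deodhar's argument: split off from the right the longest possible word in the letter \<open>i\<close> and the
  last letter of a reduced decomposition, and use that short alternating words map simple roots into
  the cone spanned by two simple roots.\<close>

lemma pos_if_ll_snoc_ge:
  assumes "js \<in> lists I" "i \<in> I" "ll js \<le> ll (js @ [i])"
  shows "pos js i"
  using assms
proof (induction "ll js" arbitrary: js i rule: less_induct)
  case less
  note js = less.prems(1) and i = less.prems(2)
  obtain us0 where us0: "red us0" "wp us0 = wp js" "length us0 = ll js" using ex_red[OF js] .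
  show ?case
  proof (cases us0 rule: rev_cases)
    case Nil
    thus ?thesis using us0 by (auto simp: pos_def simple_root_def)
  next
    case (snoc us t)
    have us: "us \<in> lists I" and t: "t \<in> I" using red_lists[OF us0(1)] snoc by auto
    have wpt: "wp (us @ [t]) = wp js" using us0 snoc by simp
    have len: "Suc (length us) = ll js" using us0 snoc by simp
    have it: "i \<noteq> t"
    proof
      assume "i = t"
      have "wp (js @ [i]) = wp ((us @ [t]) @ [i])" unfolding wp_append[of js] wp_append[of "us @ [t]"] wpt ..
      also have "\<dots> = wp us" using wp_double[OF t, of us "[]"] \<open>i = t\<close> by simp
      finally have "ll (js @ [i]) \<le> length us" using ll_le[OF us] by simp
      thus False using less.prems(3) len by simp
    qed
    \<comment> \<open>Factorizations of the element into \<open>v\<close> and a word in i and t,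
      with lengths adding up. A shortest such \<open>v\<close> is a minimal coset representative for
      the dihedral subgroup of i and t.\<close>
    define P where "P v \<longleftrightarrow> (\<exists>y. v \<in> lists I \<and> y \<in> lists {i, t} \<and> wp (v @ y) = wp js \<and>
      ll v + length y = ll js)" for v
    have P_us: "P us"
    proof -
      have "ll js \<le> Suc (ll us)" using ll_snoc_le[OF us t] by (simp add: wpt)
      hence "ll us + length [t] = ll js" using ll_le[OF us] len by simp
      thus ?thesis unfolding P_def using us wpt by (intro exI[of _ "[t]"]) auto
    qed
    obtain v where v: "P v" and min: "\<And>v'. P v' \<Longrightarrow> ll v \<le> ll v'"
      using ex_has_least_nat[of P us ll] P_us by blast
    obtain y where vI: "v \<in> lists I" and y: "y \<in> lists {i, t}" and wvy: "wp (v @ y) = wp js"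
      and lvy: "ll v + length y = ll js" using v by (auto simp: P_def)
    have lv: "ll v < ll js" using min[OF P_us] ll_le[OF us] len by simp
    have yI: "y' \<in> lists I" if "y' \<in> lists {i, t}" for y' using that i t by auto
    have short: "length y \<le> length y'" if "y' \<in> lists I" "wp (v @ y') = wp js" for y'
      using ll_append[OF vI that(1)] that(2) lvy by simp
    \<comment> \<open>A dihedral part ending in i would make i shorten the element, against the
      hypothesis on lengths.\<close>
    have no_i: False if "y' @ [i] \<in> lists I" "wp (v @ y' @ [i]) = wp js" "length (y' @ [i]) = length y" for y'
    proof -
      have y': "y' \<in> lists I" using that by simp
      have "wp (js @ [i]) = wp ((v @ y' @ [i]) @ [i])" by (simp only: wp_append that(2)[unfolded wp_append])
      also have "\<dots> = wp (v @ y')" using wp_double[OF i, of "v @ y'" "[]"] by simp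
      finally have "ll (js @ [i]) \<le> ll v + length y'" using ll_append[OF vI y'] by simp
      thus False using less.prems(3) lvy that(3) by simp
    qed
    \<comment> \<open>Neither letter shortens \<open>v\<close>, since otherwise it could be moved
      over to the dihedral part; as \<open>v\<close> is shorter than the element, the induction
      hypothesis applies to both letters.\<close>
    have pos_v: "pos v s" if s: "s \<in> {i, t}" for s
    proof (rule less.hyps[OF lv vI])
      show sI: "s \<in> I" using s i t by auto
      show "ll v \<le> ll (v @ [s])"
      proof (rule ccontr)
        assume lt: "\<not> ll v \<le> ll (v @ [s])"
        have w: "wp ((v @ [s]) @ (s # y)) = wp js" using wp_double[OF sI, of v y] wvy by simp
        have "ll js \<le> ll (v @ [s]) + length (s # y)"
          using ll_append[of "v @ [s]" "s # y"] vI sI yI[OF y] by (simp only: w) simp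
        hence "ll (v @ [s]) + length (s # y) = ll js" using lt lvy by simp
        hence "P (v @ [s])" unfolding P_def using vI sI s y w by (intro exI[of _ "s # y"]) auto
        from min[OF this] lt show False by simp
      qed
    qed
    have "rev y = alternating (length (rev y)) t i"
    proof (rule alternatingI[OF _ it])
      show "set (rev y) \<subseteq> {i, t}" using y by auto
      show "rev y \<noteq> p @ s # s # q" for p s q
      proof
        assume "rev y = p @ s # s # q"
        hence y2: "y = rev q @ s # s # rev p" by (simp add: rev_swap)
        hence s: "s \<in> I" "rev q @ rev p \<in> lists I" using yI[OF y] by auto
        have "wp (v @ rev q @ rev p) = wp js"
          using wp_double[OF s(1), of "v @ rev q" "rev p"] wvy y2 by simp
        from short[OF s(2) this] show False using y2 by simp
      qed
      show "rev y \<noteq> i # q" for q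
      proof
        assume "rev y = i # q"
        hence "y = rev q @ [i]" by (simp add: rev_swap)
        thus False using no_i[of "rev q"] yI[OF y] wvy by simp
      qed
    qed
    define k where "k = length y"
    have y_alt: "y = rev (alternating k t i)"
      using \<open>rev y = _\<close> by (metis k_def length_rev rev_rev_ident)
    \<comment> \<open>At full length the braid relation would rewrite the end of \<open>y\<close> so
      that it ends in i, which \<open>no_i\<close> forbids.\<close>
    have km: "k < m t i"
    proof (rule ccontr)
      assume "\<not> k < m t i"
      then obtain r where r: "alternating k t i = alternating (m t i) t i @ r" "set r \<subseteq> {t, i}"
        using alternating_prefix[of "m t i" k t i] by auto
      obtain m' where m': "m t i = Suc m'" using m_pos[of t i] by (cases "m t i") auto
      have eq: "wp (rev (alternating (m t i) t i)) = wp (rev (alternating (m t i) i t))"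
        unfolding rev_alternating using wp_braid[OF t i it[symmetric]] by auto
      define y' where "y' = rev r @ rev (alternating m' t i)"
      have "rev (alternating (m t i) i t) = rev (alternating m' t i) @ [i]" by (simp add: m')
      hence y'i: "y' @ [i] = rev r @ rev (alternating (m t i) i t)" by (simp add: y'_def)
      show False
      proof (rule no_i[of y'])
        show "y' @ [i] \<in> lists I"
          unfolding y'i using r(2) set_alternating[of "m t i" i t] i t by auto
        show "wp (v @ y' @ [i]) = wp js"
          unfolding y'i wvy[symmetric] y_alt r(1) by (simp add: wp_append eq)
        show "length (y' @ [i]) = length y" unfolding y'i y_alt r(1) by simp
      qed
    qed
    have "\<exists>a b p q. a \<in> {i, t} \<and> b \<in> {i, t} \<and> wp y (al i) = comb a b p q \<and> 0 \<le> p \<and> 0 \<le> q"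
    proof (cases "even k")
      case True
      thus ?thesis using alternating_cone[OF i t it, of k] km y_alt m_sym[of i t]
        by (auto simp: rev_alternating)
    next
      case False
      thus ?thesis using alternating_cone[OF t i it[symmetric], of k] km y_alt
        by (auto simp: rev_alternating)
    qed
    then obtain a b p q where ab: "a \<in> {i, t}" "b \<in> {i, t}" "wp y (al i) = comb a b p q" "0 \<le> p" "0 \<le> q"
      by blast
    have "wp js (al i) = wp v (comb a b p q)" by (simp add: wvy[symmetric] wp_append ab(3))
    thus ?thesis using pos_v[OF ab(1)] pos_v[OF ab(2)] ab(4,5)
      by (simp add: pos_def wp_comb[OF vI])
  qed
qed

text \<open>The sign of w alpha_i decides whether s_i lengthens or shortens w. The negative half is
  the positive half applied to w s_i, which maps alpha_i to the opposite vector.\<close>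

lemma pos_or_neg_snoc:
  assumes js: "js \<in> lists I" and i: "i \<in> I"
  shows "pos js i \<and> ll (js @ [i]) = Suc (ll js) \<or> neg js i \<and> ll js = Suc (ll (js @ [i]))"
proof -
  have N: "neg js i" if "ll (js @ [i]) \<le> ll js"
  proof -
    have dbl: "wp ((js @ [i]) @ [i]) = wp js" using wp_double[OF i, of js "[]"] by simp
    have "pos (js @ [i]) i"
      by (rule pos_if_ll_snoc_ge) (use js i that in \<open>simp_all only: dbl\<close>, auto)
    moreover have "wp (js @ [i]) (al i) = (\<lambda>k. - wp js (al i) k)"
      using i wp_uminus[OF js, of "al i"] by (simp add: wp_append wp_single sr_eq cp_al)
    ultimately show ?thesis by (simp add: pos_def neg_def)
  qed
  show ?thesis
  proof (cases "ll js \<le> ll (js @ [i])")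
    case True
    hence "pos js i" using pos_if_ll_snoc_ge js i by blast
    thus ?thesis using N not_pos_neg[OF js, of i] ll_snoc_le[OF js i] True
      by (metis le_SucE le_antisym nle_le)
  next
    case False
    thus ?thesis using N ll_snoc_ge[OF js i] by auto
  qed
qed

lemma pos_iff: "js \<in> lists I \<Longrightarrow> i \<in> I \<Longrightarrow> pos js i \<longleftrightarrow> ll (js @ [i]) = Suc (ll js)"
  using pos_or_neg_snoc[of js i] not_pos_neg[of js i] by auto

lemma neg_iff: "js \<in> lists I \<Longrightarrow> i \<in> I \<Longrightarrow> neg js i \<longleftrightarrow> ll js = Suc (ll (js @ [i]))"
  using pos_or_neg_snoc[of js i] not_pos_neg[of js i] by auto

lemma red_snoc_pos: "red js \<Longrightarrow> i \<in> I \<Longrightarrow> pos js i \<Longrightarrow> red (js @ [i])"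
  using pos_iff[of js i] by (simp add: red_def)

lemma red_snocD: "red (js @ [i]) \<Longrightarrow> red js \<and> i \<in> I \<and> pos js i \<and> neg (js @ [i]) i"
proof -
  assume r: "red (js @ [i])"
  have rj: "red js" and i: "i \<in> I" using red_prefix[OF r] red_lists[OF r] by auto
  have js: "js \<in> lists I" using rj by (rule red_lists)
  have "pos js i" using r rj pos_iff[OF js i] by (simp add: red_def)
  moreover have "neg (js @ [i]) i"
    using neg_iff[of "js @ [i]" i] js i r rj wp_double[OF i, of js "[]"] by (simp add: red_def)
  ultimately show ?thesis using rj i by simp
qed

text \<open>If w maps alpha_i and alpha_j to negative vectors, it does so with every nonnegative
  combination of them. By \<open>alternating_cone\<close> the next letter of the alternating word is
  always tested on such a combination, so each letter shortens.\<close>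

lemma strip:
  assumes us: "us \<in> lists I" and ij: "i \<in> I" "j \<in> I" "i \<noteq> j" and neg: "neg us i" "neg us j" and k: "k \<le> m i j"
  shows "ll us = ll (us @ alternating k i j) + k"
  using k
proof (induction k)
  case (Suc k)
  let ?y = "alternating k i j" and ?z = "if even k then i else j"
  have yI: "us @ ?y \<in> lists I" and z: "?z \<in> I" using us ij set_alternating[of k i j] by auto
  obtain p q where pq: "wp ?y (al ?z) = comb i j p q" "0 \<le> p" "0 \<le> q"
    using alternating_cone[OF ij, of k] Suc.prems by auto
  have "neg (us @ ?y) ?z"
    unfolding neg_def
    using neg pq(2,3) by (auto simp: wp_append pq(1) wp_comb[OF us] neg_def mult_nonneg_nonpos add_nonpos_nonpos)
  hence "ll (us @ ?y) = Suc (ll ((us @ ?y) @ [?z]))" using neg_iff[OF yI z] by blast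
  also have "(us @ ?y) @ [?z] = us @ alternating (Suc k) i j" by (simp only: alternating_snoc append_assoc)
  finally show ?case using Suc by simp
qed simp

end

section \<open>Lifting reduced words to a group with braid relations\<close>

section \<open>Matsumoto's theorem\<close>

text \<open>Braid relations are required between finite nodes only, where \<open>laces_bound\<close>
  guarantees at most three laces; node 0 may be joined by four.\<close>

locale braided = affine_root_data n A + G: group G for n A and G (structure) +
  fixes T
  assumes T_closed: "i \<le> n \<Longrightarrow> T i \<in> carrier G"
    and T_braid: "i \<in> {1..n} \<Longrightarrow> j \<in> {1..n} \<Longrightarrow> i \<noteq> j \<Longrightarrow>
      foldr (\<lambda>i g. T i \<otimes> g) (alternating (braid_length A i j) i j) \<one> =
      foldr (\<lambda>i g. T i \<otimes> g) (alternating (braid_length A i j) j i) \<one>"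
begin

definition tw :: "nat list \<Rightarrow> 'a" where
  "tw js = foldr (\<lambda>i g. T i \<otimes> g) js \<one>"

lemma tw_Nil [simp]: "tw [] = \<one>"
  and tw_Cons: "tw (i # js) = T i \<otimes> tw js"
  by (simp_all add: tw_def)

lemma T_closed_I: "i \<in> I \<Longrightarrow> T i \<in> carrier G"
  by (simp add: T_closed)

lemma tw_closed: "js \<in> lists I \<Longrightarrow> tw js \<in> carrier G"
  by (induction js) (auto simp: tw_Cons T_closed)

lemma tw_append: "us \<in> lists I \<Longrightarrow> vs \<in> lists I \<Longrightarrow> tw (us @ vs) = tw us \<otimes> tw vs"
  by (induction us) (auto simp: tw_Cons T_closed tw_closed G.m_assoc)

lemma tw_single: "i \<in> I \<Longrightarrow> tw [i] = T i"
  by (simp add: tw_Cons T_closed)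

text \<open>If both \<open>i\<close> and \<open>j\<close> shorten \<open>w\<close> from the right, then so do the two alternating words of maximal
  length; this gives reduced decompositions of \<open>w\<close> related by a braid move.\<close>

lemma matsumoto: "red us \<Longrightarrow> red vs \<Longrightarrow> wp us = wp vs \<Longrightarrow> tw us = tw vs"
proof (induction "length us" arbitrary: us vs)
  case 0
  hence "length vs = 0" by (metis red_def)
  thus ?case using 0 by simp
next
  case (Suc l)
  have "length us = length vs" using Suc.prems by (simp add: red_def)
  obtain u i where us: "us = u @ [i]" using Suc.hyps(2) by (cases us rule: rev_cases) auto
  obtain v j where vs: "vs = v @ [j]" using Suc.hyps(2) \<open>length us = length vs\<close>
    by (cases vs rule: rev_cases) auto
  have u: "red u" "i \<in> I" "neg us i" using red_snocD[of u i] Suc.prems(1) us by auto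
  have v: "red v" "j \<in> I" "neg vs j" using red_snocD[of v j] Suc.prems(2) vs by auto
  have uI: "u \<in> lists I" "us \<in> lists I" and vI: "v \<in> lists I" "vs \<in> lists I"
    using red_lists Suc.prems u v by auto
  have lu: "l = length u" and lv: "l = length v" using us vs Suc.hyps(2) \<open>length us = length vs\<close> by auto
  show ?case
  proof (cases "i = j")
    case True
    have "wp u = wp (us @ [i])" using wp_double[OF u(2), of u "[]"] by (simp add: us)
    also have "\<dots> = wp (vs @ [i])" by (simp add: wp_append Suc.prems(3))
    also have "\<dots> = wp v" using wp_double[OF u(2), of v "[]"] by (simp add: vs True)
    finally have "tw u = tw v" using Suc.hyps(1)[OF lu u(1) v(1)] by simp
    thus ?thesis using uI vI u(2) v(2) True by (simp add: us vs tw_append)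
  next
    case False
    have ns: "neg us i" "neg us j" using u(3) v(3) Suc.prems(3) by (simp_all add: neg_def)
    obtain m' where m': "m i j = Suc m'" using m_pos[of i j] by (cases "m i j") auto
    define x where "x = us @ alternating (m i j) i j"
    have altI: "alternating k i j \<in> lists I" "alternating k j i \<in> lists I" for k
      using set_alternating[of k i j] set_alternating[of k j i] u(2) v(2) by auto
    have xI: "x \<in> lists I" using uI altI by (simp add: x_def)
    have lx: "ll us = ll x + m i j"
      unfolding x_def by (rule strip[OF uI(2) u(2) v(2) False ns]) simp
    obtain xr where xr: "red xr" "wp xr = wp x" "length xr = ll x" using ex_red[OF xI] .
    have xrI: "xr \<in> lists I" using xr(1) by (rule red_lists)
    have w1: "wp (xr @ rev (alternating (m i j) i j)) = wp us"
      using altI(1)[of "m i j"] by (simp add: wp_append xr(2) x_def fun_eq_iff wp_rev')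
    have w2: "wp (xr @ rev (alternating (m i j) j i)) = wp us"
    proof -
      have "wp x = wp (us @ alternating (m i j) j i)"
        by (simp only: x_def wp_append wp_braid[OF u(2) v(2) False])
      thus ?thesis using altI(2)[of "m i j"] by (simp add: wp_append xr(2) fun_eq_iff wp_rev')
    qed
    have len: "length us = ll us" using Suc.prems(1) by (simp add: red_def)
    have r: "red (xr @ rev (alternating (m i j) i j))" "red (xr @ rev (alternating (m i j) j i))"
      using altI[of "m i j"] xrI len lx xr(3) Suc.prems(1) 
      by (auto intro!: redI[OF Suc.prems(1)] simp: w1 w2 in_lists_conv_set)
    have e1: "xr @ rev (alternating (m i j) i j) = (xr @ rev (alternating m' j i)) @ [i]"
      and e2: "xr @ rev (alternating (m i j) j i) = (xr @ rev (alternating m' i j)) @ [j]"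
      by (simp_all add: m')
    have rI: "rev (alternating k i j) \<in> lists I" "rev (alternating k j i) \<in> lists I" for k
      using altI[of k] by (auto simp: in_lists_conv_set)
    have cancel: "wp a = wp b" if "wp (a @ [k]) = wp (b @ [k])" "k \<in> I" for a b k
    proof -
      have "wp ((a @ [k]) @ [k]) = wp ((b @ [k]) @ [k])" using that(1) by (simp only: wp_append)
      thus ?thesis using wp_double[OF that(2), of a "[]"] wp_double[OF that(2), of b "[]"] by simp
    qed
    \<comment> \<open>Both words have one letter less than \<open>us\<close> and represent the same
      element, so the induction hypothesis applies; appending i then gives the lift of
      \<open>us\<close>. The same argument with j handles \<open>vs\<close>, and the two results
      differ by one braid relation.\<close>
    have "tw u = tw (xr @ rev (alternating m' j i))"
      by (rule Suc.hyps(1)[OF lu u(1) red_prefix[OF r(1)[unfolded e1]] cancel[OF _ u(2)]])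
         (simp only: e1[symmetric] w1 us[symmetric])
    hence "tw us = tw (xr @ rev (alternating (m i j) i j))"
      unfolding e1 us using uI xrI rI u(2) by (simp add: tw_append tw_closed G.m_assoc)
    moreover have "tw v = tw (xr @ rev (alternating m' i j))"
      by (rule Suc.hyps(1)[OF lv v(1) red_prefix[OF r(2)[unfolded e2]] cancel[OF _ v(2)]])
         (simp only: e2[symmetric] w2 vs[symmetric] Suc.prems(3))
    hence "tw vs = tw (xr @ rev (alternating (m i j) j i))"
      unfolding e2 vs using vI xrI rI v(2) by (simp add: tw_append tw_closed G.m_assoc)
    moreover have "tw (rev (alternating (m i j) i j)) = tw (rev (alternating (m i j) j i))"
      using T_braid[OF u(2) v(2) False] by (simp add: rev_alternating tw_def)
    ultimately show ?thesis using xrI rI by (simp add: tw_append)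
  qed
qed

end

section \<open>Dominant vectors, their stabilizers, and the longest element\<close>

section \<open>The longest element\<close>

context affine_root_data
begin

lemma all_pos_imp_id:
  assumes "v \<in> lists I" "\<And>i. i \<in> I \<Longrightarrow> pos v i"
  shows "wp v = id"
proof -
  obtain us where us: "red us" "wp us = wp v" using ex_red[OF assms(1)] .
  show ?thesis
  proof (cases us rule: rev_cases)
    case (snoc u i)
    hence "i \<in> I" "neg us i" using red_snocD us(1) by auto
    moreover from this have "pos us i" using assms(2)[of i] us(2) by (simp add: pos_def)
    ultimately show ?thesis using not_pos_neg red_lists us(1) by blast
  qed (use us in auto)
qed

lemma form_nonpos:
  assumes th: "\<And>i. i \<in> I \<Longrightarrow> 0 \<le> F th (al i)" and x: "\<And>k. x k \<le> 0" "\<And>k. k \<notin> I \<Longrightarrow> x k = 0"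
  shows "F th x \<le> 0"
proof -
  have "F th x = (\<Sum>i\<in>{..n}. x i * F th (al i))"
    unfolding form_sym[of th x] form_cp[of x th] by (intro sum.cong HOL.refl) (simp add: form_al')
  also have "\<dots> = (\<Sum>i\<in>I. x i * F th (al i))"
    using x(2) by (intro sum.mono_neutral_right) auto
  also have "\<dots> \<le> 0" using th x(1) by (intro sum_nonpos mult_nonpos_nonneg) auto
  finally show ?thesis .
qed

lemma stabilizer_word:
  assumes th: "\<And>i. i \<in> I \<Longrightarrow> 0 \<le> F th (al i)"
  shows "red y \<Longrightarrow> wp y th = th \<Longrightarrow> \<forall>i\<in>set y. F th (al i) = 0"
proof (induction y rule: rev_induct)
  case (snoc i y)
  have r: "red y" "i \<in> I" "neg (y @ [i]) i" using red_snocD[OF snoc.prems(1)] by auto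
  have yI: "y @ [i] \<in> lists I" using snoc.prems(1) by (rule red_lists)
  have n: "i \<le> n" using r by simp
  have "F th (al i) = F (wp (y @ [i]) th) (wp (y @ [i]) (al i))" using form_wp[OF yI] by simp
  also have "\<dots> \<le> 0" unfolding snoc.prems(2)
    using th r(2,3) wp_outside[OF yI] by (intro form_nonpos) (auto simp: neg_def simple_root_def)
  finally have 0: "F th (al i) = 0" using th[OF r(2)] by simp
  hence "cp i th = 0" using n d_pos[OF n] by (simp add: form_al')
  hence "sr i th = th" using n by (simp add: sr_eq)
  hence "wp y th = th" using snoc.prems(2) by (simp add: wp_append wp_single)
  thus ?case using snoc.IH r(1) 0 by simp
qed simp

text \<open>Each further letter i of a reduced word subtracts a nonnegative multiple of u alpha_i,
  where u is the preceding word, and this root is positive.\<close>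

lemma dominant_ge:
  assumes th: "\<And>i. i \<in> I \<Longrightarrow> 0 \<le> F th (al i)" and v: "v \<in> lists I"
  shows "wp v th k \<le> th k"
proof -
  have red: "red us \<Longrightarrow> wp us th k \<le> th k" for us
  proof (induction us rule: rev_induct)
    case (snoc i u)
    have r: "red u" "i \<in> I" "pos u i" using red_snocD[OF snoc.prems] by auto
    have n: "i \<le> n" using r by simp
    have "0 \<le> cp i th" using th[OF r(2)] n d_pos[OF n] by (simp add: form_al' zero_le_divide_iff)
    moreover have "wp (u @ [i]) th k = wp u th k - cp i th * wp u (al i) k"
      using n wp_diff[OF red_lists[OF r(1)], of th "cp i th" "al i"]
      by (simp add: wp_append wp_single sr_eq)
    moreover have "0 \<le> wp u (al i) k" using r(3) by (simp add: pos_def)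
    ultimately show ?case
      using snoc.IH[OF r(1)] mult_nonneg_nonneg[of "cp i th" "wp u (al i) k"] by linarith
  qed simp
  obtain us where "red us" "wp us = wp v" using ex_red[OF v] .
  thus ?thesis using red[of us] by simp
qed

end

locale longest = affine_root_data +
  fixes ws
  assumes red_ws: "red ws" and ws_max: "v \<in> lists {1..n} \<Longrightarrow> ll v \<le> ll ws"
begin

lemma ws_I: "ws \<in> lists I"
  using red_ws by (rule red_lists)

lemma ws_neg: "i \<in> I \<Longrightarrow> neg ws i"
  using pos_or_neg_snoc[OF ws_I, of i] ws_max[of "ws @ [i]"] ws_I by auto

lemma ws_antitone:
  assumes "\<And>k. k \<notin> I \<Longrightarrow> x k = 0" "\<And>k. 0 \<le> x k"
  shows "wp ws x k \<le> 0"
proof -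
  have "wp ws x k = (\<Sum>i\<in>I. x i * wp ws (al i) k)"
    using wp_decompose[OF ws_I, of x k] assms(1) by simp
  also have "\<dots> \<le> 0"
    using ws_neg assms(2) by (intro sum_nonpos mult_nonneg_nonpos) (auto simp: neg_def)
  finally show ?thesis .
qed

lemma ws_ws: "wp ws (wp ws x) = x"
proof -
  have "wp (ws @ ws) = id"
  proof (rule all_pos_imp_id)
    fix i assume i: "i \<in> I"
    have out: "wp ws (al i) k = 0" if "k \<notin> I" for k
      using wp_outside[OF ws_I that] that i by (auto simp: simple_root_def)
    have "wp ws (\<lambda>k. - wp ws (al i) k) k \<le> 0" for k
      by (rule ws_antitone) (use out ws_neg[OF i] in \<open>auto simp: neg_def\<close>)
    thus "pos (ws @ ws) i" by (simp add: pos_def wp_append wp_uminus[OF ws_I])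
  qed (use ws_I in auto)
  thus ?thesis by (simp add: wp_append fun_eq_iff)
qed

lemma all_neg_imp_ws:
  assumes v: "v \<in> lists I" and neg: "\<And>i. i \<in> I \<Longrightarrow> neg v i"
  shows "wp v = wp ws"
proof -
  have "wp (ws @ v) = id"
  proof (rule all_pos_imp_id)
    fix i assume i: "i \<in> I"
    have "wp ws (\<lambda>k. - wp v (al i) k) k \<le> 0" for k
      by (rule ws_antitone)
         (use wp_outside[OF v] i neg[OF i] in \<open>auto simp: neg_def simple_root_def\<close>)
    thus "pos (ws @ v) i" by (simp add: pos_def wp_append wp_uminus[OF ws_I])
  qed (use ws_I v in auto)
  hence "wp ws (wp v x) = x" for x by (simp add: wp_append fun_eq_iff)
  thus ?thesis using ws_ws by (metis ext)
qed

text \<open>The matrix \<open>c\<close> of -w_0 on the simple roots has nonnegative integer entries,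
  no zero row, and square 1. All its row sums are at least 1; comparing the row sums of the square
  with those of the identity shows that every row sum is 1, so every row is a unit vector.\<close>

lemma ws_simple:
  assumes i: "i \<in> I"
  shows "\<exists>j\<in>I. wp ws (al i) = (\<lambda>k. - al j k)"
proof -
  define c where "c l k = - wp ws (al l) k" for l k
  have c0: "0 \<le> c l k" if "l \<in> I" for l k using ws_neg[OF that] by (simp add: c_def neg_def)
  have cI: "c l k \<in> \<int>" for l k unfolding c_def by (intro Ints_minus wp_Ints[OF ws_I] al_Ints)
  have cout: "c l k = 0" if "l \<in> I" "k \<notin> I" for l k
    using wp_outside[OF ws_I that(2)] that by (auto simp: c_def simple_root_def)
  have ex: "\<exists>k\<in>I. 1 \<le> c l k" if l: "l \<in> I" for l
  proof (rule ccontr)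
    assume *: "\<not> ?thesis"
    have "c l k = 0" for k
    proof (cases "k \<in> I")
      case True
      obtain z where z: "c l k = of_int z" using cI[of l k] by (auto elim: Ints_cases)
      thus ?thesis using * True c0[OF l, of k] by force
    qed (use cout l in auto)
    hence "pos ws l" by (simp add: pos_def c_def)
    thus False using not_pos_neg[OF ws_I] ws_neg[OF l] by blast
  qed
  have "al i k = (\<Sum>l\<in>I. c i l * c l k)" for k
  proof -
    have "al i k = - wp ws (c i) k" using ws_ws[of "al i"]
      by (simp add: c_def[abs_def] wp_uminus[OF ws_I])
    also have "\<dots> = (\<Sum>l\<in>I. c i l * c l k)"
      using wp_decompose[OF ws_I, of "c i" k] cout[OF i] by (simp add: c_def sum_negf[symmetric])
    finally show ?thesis .
  qed
  hence "(\<Sum>k\<in>I. al i k) = (\<Sum>k\<in>I. \<Sum>l\<in>I. c i l * c l k)" by simp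
  also have "\<dots> = (\<Sum>l\<in>I. c i l * (\<Sum>k\<in>I. c l k))"
    by (subst sum.swap) (simp add: sum_distrib_left)
  finally have sum1: "(\<Sum>l\<in>I. c i l * (\<Sum>k\<in>I. c l k)) = 1"
    using i by (simp add: simple_root_def)
  have ge1: "1 \<le> (\<Sum>k\<in>I. c l k)" if l: "l \<in> I" for l
  proof -
    obtain k where "k \<in> I" "1 \<le> c l k" using ex[OF l] by blast
    moreover have "c l k \<le> (\<Sum>k\<in>I. c l k)"
      using \<open>k \<in> I\<close> c0[OF l] by (intro member_le_sum) auto
    ultimately show ?thesis by simp
  qed
  have "(\<Sum>l\<in>I. c i l * 1) \<le> (\<Sum>l\<in>I. c i l * (\<Sum>k\<in>I. c l k))"
    using ge1 c0[OF i] by (intro sum_mono mult_left_mono) auto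
  hence le1: "(\<Sum>l\<in>I. c i l) \<le> 1" using sum1 by simp
  obtain j where j: "j \<in> I" "1 \<le> c i j" using ex[OF i] by blast
  have rest: "(\<Sum>l\<in>I. c i l) = c i j + (\<Sum>l\<in>I - {j}. c i l)"
    using j(1) by (simp add: sum.remove)
  have "0 \<le> (\<Sum>l\<in>I - {j}. c i l)" using c0[OF i] by (intro sum_nonneg) auto
  hence cj: "c i j = 1" and "(\<Sum>l\<in>I - {j}. c i l) = 0" using rest le1 j(2) by auto
  hence "c i l = 0" if "l \<in> I" "l \<noteq> j" for l
    using sum_nonneg_eq_0_iff[of "I - {j}" "c i"] c0[OF i] that by auto
  hence "c i k = al j k" for k
    using cj cout[OF i, of k] by (cases "k \<in> I") (auto simp: simple_root_def)
  hence "wp ws (al i) = (\<lambda>k. - al j k)" by (auto simp: c_def fun_eq_iff) (metis minus_minus)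
  thus ?thesis using j(1) by blast
qed

text \<open>Positive simple roots are appended as long as there are any; the maximal length bounds
  the process, and an element making all simple roots negative is w_0.\<close>

lemma extend_to_ws:
  assumes "red v"
  shows "\<exists>y. red (v @ y) \<and> wp (v @ y) = wp ws"
  using assms
proof (induction "ll ws - length v" arbitrary: v rule: less_induct)
  case less
  have v: "v \<in> lists I" using less.prems by (rule red_lists)
  show ?case
  proof (cases "\<forall>i\<in>I. neg v i")
    case True
    thus ?thesis using all_neg_imp_ws[OF v] less.prems by (intro exI[of _ "[]"]) auto
  next
    case False
    then obtain i where i: "i \<in> I" "pos v i" using pos_or_neg_snoc[OF v] by blast
    hence r: "red (v @ [i])" using red_snoc_pos less.prems by blast
    hence "length (v @ [i]) \<le> ll ws" using ws_max[of "v @ [i]"] v i by (simp add: red_def)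
    hence "ll ws - length (v @ [i]) < ll ws - length v" by simp
    from less.hyps[OF this r] obtain y where "red ((v @ [i]) @ y)" "wp ((v @ [i]) @ y) = wp ws" by blast
    thus ?thesis by (intro exI[of _ "i # y"]) simp
  qed
qed

text \<open>The vector e = -w_0 th is dominant, because -w_0 permutes the simple roots, and it lies
  in the orbit of th, because the word \<open>js\<close> maps th to -th. An orbit contains only one
  dominant vector: \<open>dominant_ge\<close> gives both inequalities.\<close>

lemma ws_dominant:
  assumes th: "\<And>i. i \<in> I \<Longrightarrow> 0 \<le> F th (al i)" and js: "js \<in> lists I"
    and neg: "wp js th = (\<lambda>k. - th k)"
  shows "wp ws th = (\<lambda>k. - th k)"
proof
  fix k
  define e where "e = wp (ws @ js) th"
  have e: "e = (\<lambda>k. - wp ws th k)" by (simp add: e_def wp_append neg wp_uminus[OF ws_I])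
  have wj: "ws @ js \<in> lists I" using ws_I js by simp
  have "0 \<le> F e (al i)" if i: "i \<in> I" for i
  proof -
    obtain j where j: "j \<in> I" "wp ws (al i) = (\<lambda>k. - al j k)" using ws_simple[OF i] by blast
    have "F e (al i) = - F (wp ws th) (al i)" unfolding e using form_scale_left[of "- 1"] by simp
    also have "F (wp ws th) (al i) = F (wp ws th) (wp ws (wp ws (al i)))" by (simp add: ws_ws)
    also have "\<dots> = F th (\<lambda>k. - al j k)" by (simp only: form_wp[OF ws_I] j(2))
    also have "\<dots> = - F th (al j)" using form_scale_right[of th "- 1"] by simp
    finally show ?thesis using th[OF j(1)] by simp
  qed
  hence "wp (rev (ws @ js)) e k \<le> e k"
    by (rule dominant_ge) (use wj in \<open>auto simp: in_lists_conv_set\<close>)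
  hence "th k \<le> e k" unfolding e_def using wp_rev[OF wj] by simp
  moreover have "e k \<le> th k" unfolding e_def by (rule dominant_ge[OF th wj])
  ultimately show "wp ws th k = - th k" by (simp add: e)
qed

text \<open>Both \<open>js\<close> and w_0 map th to -th, so the complement of \<open>js\<close> in
  w_0 fixes th, and \<open>stabilizer_word\<close> describes its letters.\<close>

lemma ws_factor:
  assumes th: "\<And>i. i \<in> I \<Longrightarrow> 0 \<le> F th (al i)" and js: "red js" and neg: "wp js th = (\<lambda>k. - th k)"
  obtains y where "red (js @ y)" "wp (js @ y) = wp ws" "\<And>i. i \<in> set y \<Longrightarrow> F th (al i) = 0"
proof -
  obtain y where y: "red (js @ y)" "wp (js @ y) = wp ws" using extend_to_ws[OF js] by blast
  have jI: "js \<in> lists I" using js by (rule red_lists)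
  have "wp js (wp y th) = wp ws th" by (simp add: y(2)[symmetric] wp_append)
  also have "\<dots> = wp js th" using ws_dominant[OF th jI neg] neg by simp
  finally have "wp y th = th" by (rule wp_inj[OF jI])
  thus ?thesis using that y stabilizer_word[OF th red_suffix[OF y(1)]] by blast
qed

end

locale braided_longest = braided + longest
begin

text \<open>Since w_0 s_i = s_j w_0, the element left after removing i from the right end of w_0 is
  also what is left after removing j from the left end. Matsumoto's theorem gives two expressions
  for the lift of w_0 with this common factor.\<close>

lemma tw_ws_T:
  assumes i: "i \<in> I" and j: "j \<in> I" and eq: "wp ws (al i) = (\<lambda>k. - al j k)"
  shows "tw ws \<otimes> T i = T j \<otimes> tw ws"
proof -
  have wi: "ws @ [i] \<in> lists I" using ws_I i by simp
  obtain us where us: "red us" "wp us = wp (ws @ [i])" "length us = ll (ws @ [i])" using ex_red[OF wi] .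
  have uI: "us \<in> lists I" using us(1) by (rule red_lists)
  have len: "Suc (length us) = length ws"
    using ws_neg[OF i] neg_iff[OF ws_I i] red_ws us(3) by (simp add: red_def)
  have "wp (us @ [i]) = wp ((ws @ [i]) @ [i])"
    unfolding wp_append[of us] wp_append[of "ws @ [i]"] us(2) ..
  hence w1: "wp (us @ [i]) = wp ws" using wp_double[OF i, of ws "[]"] by simp
  have c: "wp ws (sr i x) = sr j (wp ws x)" for x
    by (rule wp_conj[OF ws_I i j, of "- 1"]) (use eq in auto)
  have w2: "wp (j # us) = wp ws"
    using i j by (auto simp: wp_Cons us(2) wp_append wp_single c fun_eq_iff sr_sr)
  have r: "red (us @ [i])" "red (j # us)"
    using redI[OF red_ws] w1 w2 len uI i j by auto
  have 1: "tw ws = tw us \<otimes> T i"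
    using matsumoto[OF red_ws r(1)] w1 uI i by (simp add: tw_append tw_single T_closed)
  have 2: "tw ws = T j \<otimes> tw us"
    using matsumoto[OF red_ws r(2)] w2 by (simp add: tw_Cons)
  have "tw ws \<otimes> T i = T j \<otimes> tw us \<otimes> T i" by (simp only: 2)
  also have "\<dots> = T j \<otimes> tw ws"
    using tw_closed[OF uI] T_closed_I[OF i] T_closed_I[OF j] by (simp add: G.m_assoc 1)
  finally show ?thesis .
qed

lemma tw_ws_sq_T:
  assumes i: "i \<in> I"
  shows "(tw ws \<otimes> tw ws) \<otimes> T i = T i \<otimes> (tw ws \<otimes> tw ws)"
proof -
  obtain j where j: "j \<in> I" "wp ws (al i) = (\<lambda>k. - al j k)" using ws_simple[OF i] by blast
  have "wp ws (\<lambda>k. - al j k) = al i" using ws_ws[of "al i"] by (simp add: j(2))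
  hence "wp ws (al j) = (\<lambda>k. - al i k)" by (auto simp: wp_uminus[OF ws_I] fun_eq_iff) (metis minus_minus)
  hence 2: "tw ws \<otimes> T j = T i \<otimes> tw ws" using tw_ws_T i j by blast
  have c: "tw ws \<in> carrier G" "T i \<in> carrier G" "T j \<in> carrier G"
    using tw_closed[OF ws_I] T_closed_I i j by auto
  have "(tw ws \<otimes> tw ws) \<otimes> T i = tw ws \<otimes> (T j \<otimes> tw ws)"
    using c tw_ws_T[OF i j] by (simp add: G.m_assoc)
  also have "\<dots> = (T i \<otimes> tw ws) \<otimes> tw ws"
    using c by (simp add: G.m_assoc[symmetric] 2)
  finally show ?thesis using c by (simp add: G.m_assoc)
qed

text \<open>Fixing alpha_i makes w commute with s_i and makes appending i lengthen w, so w s_i and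
  s_i w are two reduced words for one element.\<close>

lemma tw_commute:
  assumes js: "red js" and i: "i \<in> I" and eq: "wp js (al i) = al i"
  shows "tw js \<otimes> T i = T i \<otimes> tw js"
proof -
  have jI: "js \<in> lists I" using js by (rule red_lists)
  have "pos js i" unfolding pos_def eq by (simp add: simple_root_def)
  hence r: "red (js @ [i])" by (rule red_snoc_pos[OF js i])
  have "wp js (sr i x) = sr i (wp js x)" for x
    by (rule wp_conj[OF jI i i, of 1]) (use eq in auto)
  hence w: "wp (js @ [i]) = wp (i # js)" by (auto simp: wp_append wp_single wp_Cons)
  hence "red (i # js)" using redI[OF r] jI i by simp
  from matsumoto[OF r this w] show ?thesis
    using jI i by (simp add: tw_append tw_single tw_Cons T_closed)
qed

end

section \<open>Numerical labels\<close>

definition edge_sum :: "(nat \<times> nat \<times> int \<times> int) list \<Rightarrow> nat \<Rightarrow> nat \<Rightarrow> int" where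
  "edge_sum E i j = (\<Sum>(k, l, p, q)\<leftarrow>E. if (k, l) = (i, j) then p else if (k, l) = (j, i) then q else 0)"

text \<open>A row of the adjacency part of the Cartan matrix applied to \<open>v\<close>, summed
  over edges instead of columns. For the infinite families only the few edges at node
  \<open>i\<close> contribute.\<close>

definition neighbour_sum :: "(nat \<times> nat \<times> int \<times> int) list \<Rightarrow> (nat \<Rightarrow> int) \<Rightarrow> nat \<Rightarrow> int" where
  "neighbour_sum E v i =
     (\<Sum>(k, l, p, q)\<leftarrow>E. (if k = i then p * v l else 0) + (if l = i then q * v k else 0))"

lemma neighbour_sum_simps [simp]:
  "neighbour_sum [] v i = 0"
  "neighbour_sum ((k, l, p, q) # E) v i =
     (if k = i then p * v l else 0) + (if l = i then q * v k else 0) + neighbour_sum E v i"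
  "neighbour_sum (E @ E') v i = neighbour_sum E v i + neighbour_sum E' v i"
  by (simp_all add: neighbour_sum_def)

lemma neighbour_sum_chain:
  "neighbour_sum (chain a b) v i =
     (if a \<le> i \<and> i < b then v (Suc i) else 0) + (if a < i \<and> i \<le> b then v (i - 1) else 0)"
proof (cases "a \<le> b")
  case True
  thus ?thesis
  proof (induction b rule: dec_induct)
    case base
    show ?case by (simp add: chain_def)
  next
    case (step b)
    have "chain a (Suc b) = chain a b @ [(b, Suc b, 1, 1)]" using step(1) by (simp add: chain_def)
    thus ?case using step by auto
  qed
qed (simp add: chain_def)

lemma set_chain: "set (chain a b) = (\<lambda>k. (k, Suc k, 1, 1)) ` {a..<b}"
  by (simp add: chain_def)

lemma edge_sum_row:
  assumes "\<forall>(k, l, p, q)\<in>set E. k \<noteq> l \<and> k \<le> n \<and> l \<le> n"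
  shows "(\<Sum>j\<le>n. edge_sum E i j * v j) = neighbour_sum E v i"
  using assms
proof (induction E)
  case (Cons e E)
  obtain k l p q where e: "e = (k, l, p, q)" by (cases e)
  have kl: "k \<noteq> l" "k \<le> n" "l \<le> n" using Cons.prems e by auto
  have "(\<Sum>j\<le>n. edge_sum (e # E) i j * v j) =
      (\<Sum>j\<le>n. (if j = l then if k = i then p * v j else 0 else 0)
        + (if j = k then if l = i then q * v j else 0 else 0) + edge_sum E i j * v j)"
    using kl by (intro sum.cong HOL.refl) (auto simp: edge_sum_def e algebra_simps)
  also have "\<dots> = (if k = i then p * v l else 0) + (if l = i then q * v k else 0)
      + (\<Sum>j\<le>n. edge_sum E i j * v j)"
    using kl by (simp add: sum.distrib)
  finally show ?case using Cons e by simp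
qed (simp add: edge_sum_def)

lemma edge_sum_diag:
  assumes "\<forall>(k, l, p, q)\<in>set E. k \<noteq> l"
  shows "edge_sum E i i = 0"
  using assms by (induction E) (auto simp: edge_sum_def)

lemma edge_sum_sym:
  assumes "\<forall>(k, l, p, q)\<in>set E. p * c k * a l = q * c l * a k" "i \<noteq> j"
  shows "edge_sum E i j * c i * a j = edge_sum E j i * c j * (a i :: int)"
  using assms(1)
proof (induction E)
  case (Cons e E)
  obtain k l p q where e: "e = (k, l, p, q)" by (cases e)
  have "(if (k, l) = (i, j) then p else if (k, l) = (j, i) then q else 0) * c i * a j =
      (if (k, l) = (j, i) then p else if (k, l) = (i, j) then q else 0) * c j * a i"
    using Cons.prems assms(2) e by auto
  thus ?case using Cons by (simp add: edge_sum_def e distrib_right)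
qed (simp add: edge_sum_def)

lemma edge_sum_eq_0: "\<forall>(k, l, p, q)\<in>set E. k \<noteq> j \<and> l \<noteq> j \<Longrightarrow> edge_sum E i j = 0"
  by (induction E) (auto simp: edge_sum_def)

lemma kac_cartan_edge_sum: "i \<noteq> j \<Longrightarrow> kac_cartan t i j = - edge_sum (dynkin_edges t) i j"
  by (simp add: kac_cartan_def edge_sum_def)

lemma kac_cartan_row:
  assumes E: "\<forall>(k, l, p, q)\<in>set (dynkin_edges t). k \<noteq> l \<and> k \<le> n \<and> l \<le> n" and i: "i \<le> n"
  shows "(\<Sum>j\<le>n. kac_cartan t i j * v j) = 2 * v i - neighbour_sum (dynkin_edges t) v i"
proof -
  have d: "edge_sum (dynkin_edges t) i i = 0" using E by (intro edge_sum_diag) auto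
  have "(\<Sum>j\<le>n. kac_cartan t i j * v j) =
      (\<Sum>j\<le>n. (if j = i then 2 * v j else 0) - edge_sum (dynkin_edges t) i j * v j)"
    using d by (intro sum.cong HOL.refl) (auto simp: kac_cartan_edge_sum kac_cartan_def[of t i i])
  thus ?thesis using i by (simp add: sum_subtractf edge_sum_row[OF E])
qed

text \<open>The final equation gives the true labels of A_n^(1) and D_{n+1}^(2). For the excluded
  types it is a mere placeholder, which is why the kernel equation is stated under
  \<open>\<not> excluded_type t\<close>.\<close>

fun kac_label :: "affine_type \<Rightarrow> nat \<Rightarrow> nat" where
  "kac_label (Aff_D n) j = (if j \<le> 1 \<or> n - 1 \<le> j then 1 else 2)"
| "kac_label Aff_E6 j = [1, 1, 2, 3, 2, 1, 2] ! j"
| "kac_label Aff_E7 j = [1, 2, 3, 4, 3, 2, 1, 2] ! j"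
| "kac_label Aff_E8 j = [1, 2, 3, 4, 5, 6, 4, 2, 3] ! j"
| "kac_label (Aff_A2_even n) j = (if j = n then 1 else 2)"
| "kac_label (Aff_A2_odd n) j = (if j \<le> 1 \<or> j = n then 1 else 2)"
| "kac_label Aff_E6_2 j = [1, 2, 3, 2, 1] ! j"
| "kac_label Aff_D4_3 j = [1, 2, 1] ! j"
| "kac_label _ j = 1"

fun kac_colabel :: "affine_type \<Rightarrow> nat \<Rightarrow> nat" where
  "kac_colabel (Aff_A2_even n) j = (if j = 0 then 1 else 2)"
| "kac_colabel (Aff_A2_odd n) j = (if j \<le> 1 then 1 else 2)"
| "kac_colabel (Aff_D2 n) j = (if j = 0 \<or> j = n then 1 else 2)"
| "kac_colabel Aff_E6_2 j = [1, 2, 3, 4, 2] ! j"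
| "kac_colabel Aff_D4_3 j = [1, 2, 3] ! j"
| "kac_colabel t j = kac_label t j"

lemma le_numeral_cases:
  "(j::nat) \<le> 2 \<longleftrightarrow> j = 0 \<or> j = 1 \<or> j = 2"
  "j \<le> 4 \<longleftrightarrow> j = 0 \<or> j = 1 \<or> j = 2 \<or> j = 3 \<or> j = 4"
  "j \<le> 6 \<longleftrightarrow> j = 0 \<or> j = 1 \<or> j = 2 \<or> j = 3 \<or> j = 4 \<or> j = 5 \<or> j = 6"
  "j \<le> 7 \<longleftrightarrow> j = 0 \<or> j = 1 \<or> j = 2 \<or> j = 3 \<or> j = 4 \<or> j = 5 \<or> j = 6 \<or> j = 7"
  "j \<le> 8 \<longleftrightarrow> j = 0 \<or> j = 1 \<or> j = 2 \<or> j = 3 \<or> j = 4 \<or> j = 5 \<or> j = 6 \<or> j = 7 \<or> j = 8"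
  by linarith+

lemma kac_label_pos:
  assumes "valid_type t" "j \<le> type_rank t"
  shows "0 < kac_label t j" "0 < kac_colabel t j"
  using assms by (cases t; auto simp: le_numeral_cases)+

lemma kac_colabel_0: "valid_type t \<Longrightarrow> kac_colabel t 0 = 1"
  by (cases t) auto

lemma kac_label_eq_1: "valid_type t \<Longrightarrow> \<exists>j\<le>type_rank t. kac_label t j = 1"
  by (cases t) (auto intro!: exI[of _ 0])

text \<open>As (alpha_i, alpha_i) = 2 / d_i with d_i the quotient of label and colabel, and (theta,
  theta) = 2 in these types, the inequality says that theta is no longer than any simple root. The
  actual labels of the excluded types violate it.\<close>

lemma kac_label_le_colabel:
  assumes "valid_type t" "\<not> excluded_type t" "t \<noteq> Aff_A2_even (type_rank t)" "j \<le> type_rank t"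
  shows "kac_label t j \<le> kac_colabel t j" "kac_label t 0 = 1"
  using assms by (cases t; auto simp: le_numeral_cases)+

lemma dynkin_edges_bounds:
  "valid_type t \<Longrightarrow> \<forall>(k, l, p, q)\<in>set (dynkin_edges t). k \<noteq> l \<and> k \<le> type_rank t \<and> l \<le> type_rank t"
  by (cases t) (auto simp: set_chain)

lemma kac_label_edges:
  assumes "valid_type t" "\<not> excluded_type t"
  shows "\<forall>(k, l, p, q)\<in>set (dynkin_edges t).
    p * int (kac_colabel t k) * int (kac_label t l) = q * int (kac_colabel t l) * int (kac_label t k)"
proof (cases t)
  case Aff_E6_2
  show ?thesis unfolding Aff_E6_2 by (auto simp: set_chain atLeastLessThan_iff less_Suc_eq numeral_eq_Suc)
next
  case (Aff_A n)
  show ?thesis unfolding Aff_A by (auto simp: set_chain)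
qed (use assms in \<open>auto simp: set_chain\<close>)

lemma kac_label_kernel:
  assumes t: "valid_type t" "\<not> excluded_type t" and i: "i \<le> type_rank t"
  shows "(\<Sum>j\<le>type_rank t. kac_cartan t i j * int (kac_label t j)) = 0"
proof -
  have "2 * int (kac_label t i) = neighbour_sum (dynkin_edges t) (\<lambda>j. int (kac_label t j)) i"
  proof (cases t)
    case (Aff_A n)
    have "n = 1 \<or> (\<exists>k. n = k + 2)" using t Aff_A by simp presburger
    thus ?thesis using i unfolding Aff_A by (elim disjE exE; simp add: neighbour_sum_chain)
  next
    case (Aff_D n)
    have "4 \<le> n" "i \<le> n" using t i Aff_D by auto
    \<comment> \<open>Nodes near the two ends of the diagram are separated from interior ones, and n
      is written as an offset, so that all comparisons of indices are decided by simplification. The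
      other families below are treated likewise.\<close>
    hence "(\<exists>k. n = k + 4 \<and> (i = 0 \<or> i = 1 \<or> i = k + 3 \<or> i = k + 4)) \<or> i = 2 \<and> n = 4 \<or>
      (\<exists>k. n = k + 5 \<and> (i = 2 \<or> i = k + 3)) \<or> (\<exists>k r. i = k + 3 \<and> n = k + r + 6)"
      by presburger
    thus ?thesis unfolding Aff_D
      by (elim disjE exE conjE; simp add: neighbour_sum_chain)
  next
    case (Aff_A2_even n)
    have "1 \<le> n" "i \<le> n" using t i Aff_A2_even by auto
    hence "n = 1 \<and> (i = 0 \<or> i = 1) \<or> (\<exists>k. n = k + 2 \<and> (i = 0 \<or> i = k + 2)) \<or> i = 1 \<and> n = 2 \<or>
      (\<exists>k. n = k + 3 \<and> (i = 1 \<or> i = k + 2)) \<or> (\<exists>k r. i = k + 2 \<and> n = k + r + 4)"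
      by presburger
    thus ?thesis unfolding Aff_A2_even
      by (elim disjE exE conjE; simp add: neighbour_sum_chain)
  next
    case (Aff_A2_odd n)
    have "3 \<le> n" "i \<le> n" using t i Aff_A2_odd by auto
    hence "(\<exists>k. n = k + 3 \<and> (i = 0 \<or> i = 1 \<or> i = k + 3)) \<or> i = 2 \<and> n = 3 \<or>
      (\<exists>k. n = k + 4 \<and> (i = 2 \<or> i = k + 3)) \<or> (\<exists>k r. i = k + 3 \<and> n = k + r + 5)"
      by presburger
    thus ?thesis unfolding Aff_A2_odd
      by (elim disjE exE conjE; simp add: neighbour_sum_chain)
  next
    case (Aff_D2 n)
    have "2 \<le> n" "i \<le> n" using t i Aff_D2 by auto
    hence "(\<exists>k. n = k + 2 \<and> (i = 0 \<or> i = k + 2)) \<or> i = 1 \<and> n = 2 \<or>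
      (\<exists>k. n = k + 3 \<and> (i = 1 \<or> i = k + 2)) \<or> (\<exists>k r. i = k + 2 \<and> n = k + r + 4)"
      by presburger
    thus ?thesis unfolding Aff_D2
      by (elim disjE exE conjE; simp add: neighbour_sum_chain)
  qed (use t i in \<open>simp_all add: le_numeral_cases, (elim disjE; simp add: neighbour_sum_chain)+\<close>)
  thus ?thesis by (simp add: kac_cartan_row[OF dynkin_edges_bounds[OF t(1)] i])
qed

lemma kac_label_sym:
  assumes t: "valid_type t" "\<not> excluded_type t"
  shows "kac_cartan t i j * int (kac_colabel t i) * int (kac_label t j) =
    kac_cartan t j i * int (kac_colabel t j) * int (kac_label t i)"
proof (cases "i = j")
  case False
  thus ?thesis
    using edge_sum_sym[OF kac_label_edges[OF t], of i j] by (simp add: kac_cartan_edge_sum)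
qed simp

text \<open>Since the kernel is a line, any other solution is proportional to \<open>a\<close>. The
  entry 1 at \<open>j0\<close> makes the factor a natural number dividing all entries, and the gcd
  condition forces it to be 1.\<close>

lemma labels_eqI:
  fixes u :: "nat \<Rightarrow> real"
  assumes pos: "\<And>j. j \<le> n \<Longrightarrow> 0 < a j" and zero: "\<And>j. j > n \<Longrightarrow> a j = 0"
    and ker: "\<And>i. i \<le> n \<Longrightarrow> (\<Sum>j\<le>n. A i j * int (a j)) = 0"
    and one: "j0 \<le> n" "a j0 = 1"
    and line: "\<And>v :: nat \<Rightarrow> real. (\<And>i. i \<le> n \<Longrightarrow> (\<Sum>j\<le>n. real_of_int (A i j) * v j) = 0) \<Longrightarrow>
      \<exists>c. \<forall>j\<le>n. v j = c * u j"
  shows "labels n A = a"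
  unfolding labels_def
proof (rule the_equality, intro conjI allI impI)
  have "Gcd (a ` {..n}) dvd a j0" using one(1) by (intro Gcd_dvd) auto
  thus "Gcd (a ` {..n}) = 1" using one(2) by simp
next
  fix b assume b: "(\<forall>j\<le>n. 0 < b j) \<and> (\<forall>j>n. b j = 0) \<and> (\<forall>i\<le>n. (\<Sum>j\<le>n. A i j * int (b j)) = 0) \<and>
    Gcd (b ` {..n}) = 1"
  have l: "\<exists>c. \<forall>j\<le>n. real (x j) = c * u j" if x: "\<And>i. i \<le> n \<Longrightarrow> (\<Sum>j\<le>n. A i j * int (x j)) = 0" for x
  proof (rule line)
    fix i assume "i \<le> n"
    have "(\<Sum>j\<le>n. real_of_int (A i j) * real (x j)) = real_of_int (\<Sum>j\<le>n. A i j * int (x j))" by simp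
    thus "(\<Sum>j\<le>n. real_of_int (A i j) * real (x j)) = 0" using x[OF \<open>i \<le> n\<close>] by simp
  qed
  obtain c1 where c1: "\<forall>j\<le>n. real (a j) = c1 * u j" using l[of a] ker by blast
  obtain c2 where c2: "\<forall>j\<le>n. real (b j) = c2 * u j" using l[of b] b by blast
  have 1: "c1 * u j0 = 1" using c1 one by auto
  have "b j = b j0 * a j" if "j \<le> n" for j
  proof -
    have "real (b j) = (c1 * u j0) * (c2 * u j)" using 1 c2 that by simp
    also have "\<dots> = real (b j0) * real (a j)" using c1 c2 that one(1) by simp
    finally show ?thesis by (metis of_nat_eq_iff of_nat_mult)
  qed
  note bj = this
  hence "b j0 dvd Gcd (b ` {..n})" by (intro Gcd_greatest) auto
  hence "b j0 = 1" using b by simp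
  thus "b = a" using bj zero b by (auto simp: fun_eq_iff) (metis le_eq_less_or_eq linorder_not_le mult_1)
qed (use pos zero ker in auto)

lemma labels_of_type:
  assumes A: "irreducible_affine_cartan n A" and t: "of_type t n A" "\<not> excluded_type t"
  shows "affine_root_data n A" "j \<le> n \<Longrightarrow> labels n A j = kac_label t j"
    "j \<le> n \<Longrightarrow> colabels n A j = kac_colabel t j"
proof -
  have v: "valid_type t" and n: "n = type_rank t" and Ak: "\<And>i j. i \<le> n \<Longrightarrow> j \<le> n \<Longrightarrow> A i j = kac_cartan t i j"
    using t by (auto simp: of_type_def)
  obtain u :: "nat \<Rightarrow> real" where line: "\<And>v. \<forall>i\<le>n. (\<Sum>j\<le>n. real_of_int (A i j) * v j) = 0 \<Longrightarrow>
      \<exists>c. \<forall>j\<le>n. v j = c * u j"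
    using A unfolding irreducible_affine_cartan_def by metis
  define a where "a j = (if j \<le> n then kac_label t j else 0)" for j
  define c where "c j = (if j \<le> n then kac_colabel t j else 0)" for j
  have pos: "0 < a j" "0 < c j" if "j \<le> n" for j
    using kac_label_pos[OF v] that n by (auto simp: a_def c_def)
  have ker: "(\<Sum>j\<le>n. A i j * int (a j)) = 0" if "i \<le> n" for i
    using kac_label_kernel[OF v t(2), of i] that by (simp add: n[symmetric] Ak a_def)
  have sym: "A i j * int (c i) * int (a j) = A j i * int (c j) * int (a i)" if "i \<le> n" "j \<le> n" for i j
    using kac_label_sym[OF v t(2), of i j] that by (simp add: Ak a_def c_def)
  obtain j0 where j0: "j0 \<le> n" "a j0 = 1" using kac_label_eq_1[OF v] n by (auto simp: a_def)
  have la: "labels n A = a"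
    by (rule labels_eqI[OF pos(1) _ ker j0 line]) (auto simp: a_def)
  have lc: "colabels n A = c"
    unfolding colabels_def
  \<comment> \<open>By the symmetry relation, rescaling coordinates by a_j / c_j carries the kernel
    of the transpose into the kernel of A, so the rescaled \<open>u\<close> spans the line. Colabel
    0 is the entry equal to 1.\<close>
  proof (rule labels_eqI[OF pos(2), where u = "\<lambda>j. u j * c j / a j" and ?j0.0 = 0])
    fix i assume i: "i \<le> n"
    have "(\<Sum>j\<le>n. A j i * int (c j)) * int (a i) = (\<Sum>j\<le>n. A i j * int (c i) * int (a j))"
      unfolding sum_distrib_right by (intro sum.cong HOL.refl) (use sym i in auto)
    also have "\<dots> = int (c i) * (\<Sum>j\<le>n. A i j * int (a j))"
      by (simp add: sum_distrib_left algebra_simps)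
    finally show "(\<Sum>j\<le>n. A j i * int (c j)) = 0" using ker[OF i] pos(1)[OF i] by simp
  next
    fix v :: "nat \<Rightarrow> real"
    assume v: "\<And>i. i \<le> n \<Longrightarrow> (\<Sum>j\<le>n. real_of_int (A j i) * v j) = 0"
    have "\<exists>k. \<forall>j\<le>n. v j * a j / c j = k * u j"
    proof (rule line, intro allI impI)
      fix i assume i: "i \<le> n"
      have "(\<Sum>j\<le>n. real_of_int (A i j) * (v j * a j / c j)) =
          (\<Sum>j\<le>n. real_of_int (A j i) * v j * (a i / c i))"
      proof (intro sum.cong HOL.refl)
        fix j assume "j \<in> {..n}"
        hence j: "j \<le> n" by simp
        have "real_of_int (A i j * int (c i) * int (a j)) = real_of_int (A j i * int (c j) * int (a i))"
          using sym[OF i j] by simp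
        hence "real_of_int (A i j) * (a j / c j) = real_of_int (A j i) * (a i / c i)"
          using pos(2)[OF i] pos(2)[OF j] by (simp add: field_simps)
        hence "v j * (real_of_int (A i j) * (a j / c j)) = v j * (real_of_int (A j i) * (a i / c i))"
          by simp
        thus "real_of_int (A i j) * (v j * a j / c j) = real_of_int (A j i) * v j * (a i / c i)"
          by (simp add: algebra_simps)
      qed
      also have "\<dots> = 0" 
        using v[OF i] sum_distrib_right[of "\<lambda>j. real_of_int (A j i) * v j" "{..n}" "a i / c i"] by simp
      finally show "(\<Sum>j\<le>n. real_of_int (A i j) * (v j * a j / c j)) = 0" .
    qed
    then obtain k where k: "\<forall>j\<le>n. v j * a j / c j = k * u j" by blast
    have "v j = k * (u j * c j / a j)" if "j \<le> n" for j
      using k[rule_format, OF that] pos[OF that] by (simp add: field_simps)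
    thus "\<exists>k. \<forall>j\<le>n. v j = k * (u j * c j / a j)" by blast
  qed (auto simp: c_def kac_colabel_0[OF \<open>valid_type t\<close>])
  show "affine_root_data n A"
    by standard (use A pos ker sym in \<open>auto simp: la lc irreducible_affine_cartan_def a_def\<close>)
  show "j \<le> n \<Longrightarrow> labels n A j = kac_label t j" "j \<le> n \<Longrightarrow> colabels n A j = kac_colabel t j"
    by (simp_all add: la lc a_def c_def)
qed

text \<open>Evenness is what makes the coroots of the other finite nodes integral on half of the
  last simple root.\<close>

lemma A2_even_last_column:
  assumes "of_type (Aff_A2_even n) n A" "1 \<le> i" "i < n"
  shows "even (A i n)"
proof -
  have "A i n = kac_cartan (Aff_A2_even n) i n" using assms by (simp add: of_type_def)
  also have "\<dots> = - edge_sum (dynkin_edges (Aff_A2_even n)) i n"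
    using assms by (intro kac_cartan_edge_sum) simp
  also have "dynkin_edges (Aff_A2_even n) = [(0, 1, 2, 1), (n - 1, n, 2, 1)] @ chain 1 (n - 1)"
    using assms by simp
  also have "edge_sum \<dots> i n = edge_sum [(0, 1, 2, 1), (n - 1, n, 2, 1)] i n + edge_sum (chain 1 (n - 1)) i n"
    by (simp add: edge_sum_def)
  also have "edge_sum (chain 1 (n - 1)) i n = 0"
    by (rule edge_sum_eq_0) (auto simp: set_chain)
  finally show ?thesis using assms by (auto simp: edge_sum_def)
qed

section \<open>The braid action on a triple of generators, and its full twist\<close>

section \<open>The braid action and its central elements\<close>

context group
begin

lemma commute_mult:
  assumes "x \<in> carrier G" "y \<in> carrier G" "z \<in> carrier G" "x \<otimes> y = y \<otimes> x" "x \<otimes> z = z \<otimes> x"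
  shows "x \<otimes> (y \<otimes> z) = (y \<otimes> z) \<otimes> x"
proof -
  have "x \<otimes> (y \<otimes> z) = (y \<otimes> x) \<otimes> z" using assms(1-3) by (simp add: m_assoc[symmetric] assms(4))
  also have "\<dots> = (y \<otimes> z) \<otimes> x" using assms(1-3) by (simp add: m_assoc assms(5))
  finally show ?thesis .
qed

lemma commute_inv:
  assumes "x \<in> carrier G" "y \<in> carrier G" "x \<otimes> y = y \<otimes> x"
  shows "x \<otimes> inv y = inv y \<otimes> x"
proof -
  have "inv y \<otimes> (y \<otimes> x) \<otimes> inv y = inv y \<otimes> (x \<otimes> y) \<otimes> inv y" using assms(3) by simp
  thus ?thesis using assms(1,2) by (simp add: m_assoc)
qed

lemma conj_eq_iff_commute:
  "x \<in> carrier G \<Longrightarrow> y \<in> carrier G \<Longrightarrow> x \<otimes> y \<otimes> inv x = y \<longleftrightarrow> x \<otimes> y = y \<otimes> x"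
  using inv_solve_right'[of y "x \<otimes> y" x] by auto

lemma subgroup_equalizer:
  assumes "f \<in> auto G" "g \<in> auto G"
  shows "subgroup {x \<in> carrier G. f x = g x} G"
proof (rule subgroupI)
  show "{x \<in> carrier G. f x = g x} \<noteq> {}"
    using auto_mult[OF assms(1), of \<one> \<one>] auto_mult[OF assms(2), of \<one> \<one>]
      auto_closed[OF assms(1), of \<one>] auto_closed[OF assms(2), of \<one>]
    by (auto intro!: exI[of _ \<one>] dest!: r_cancel_one'[THEN iffD1, rotated 2])
qed (use assms in \<open>auto simp: auto_mult auto_inv\<close>)

text \<open>Members of \<open>auto\<close> are extensional, so agreement on the carrier already
  gives equality of functions; the equalizer is a subgroup, so agreement spreads from
  generators.\<close>

lemma auto_eqI:
  assumes "f \<in> auto G" "g \<in> auto G" and gen: "carrier G \<subseteq> generate G X"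
    and X: "X \<subseteq> carrier G" and eq: "\<And>x. x \<in> X \<Longrightarrow> f x = g x"
  shows "f = g"
proof (rule extensionalityI)
  show "f \<in> extensional (carrier G)" "g \<in> extensional (carrier G)"
    using assms(1,2) by (simp_all add: auto_extensional)
  fix x assume "x \<in> carrier G"
  hence "x \<in> generate G X" using gen by blast
  also have "\<dots> \<subseteq> {x \<in> carrier G. f x = g x}"
    by (rule generate_subgroup_incl) (use X eq subgroup_equalizer assms in auto)
  finally show "f x = g x" by simp
qed

end

text \<open>The Hurwitz action of the braid group on a triple, extended by a set \<open>X\<close> of
  fixed elements. Both moves preserve x1 x2 x3.\<close>

locale triple_braid = group +
  fixes fa fb X x1 x2 x3
  assumes fa: "fa \<in> auto G" and fb: "fb \<in> auto G"
    and X: "X \<subseteq> carrier G" and x [simp]: "x1 \<in> carrier G" "x2 \<in> carrier G" "x3 \<in> carrier G"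
    and gen: "carrier G \<subseteq> generate G (insert x1 (insert x2 (insert x3 X)))"
    and fa_X: "t \<in> X \<Longrightarrow> fa t = t" and fb_X: "t \<in> X \<Longrightarrow> fb t = t"
    and fa_x: "fa x3 = x3" "fa x1 = x2" "fa x2 = inv x2 \<otimes> x1 \<otimes> x2"
    and fb_x: "fb x1 = x1" "fb x2 = x3" "fb x3 = inv x3 \<otimes> x2 \<otimes> x3"
begin

lemma eq_on_gens:
  assumes "f \<in> auto G" "g \<in> auto G" "\<And>t. t \<in> X \<Longrightarrow> f t = g t" "f x1 = g x1" "f x2 = g x2" "f x3 = g x3"
  shows "f = g"
  by (rule auto_eqI[OF assms(1,2) gen]) (use X assms in auto)

lemma AutoGroup_mult_closed: "f \<in> auto G \<Longrightarrow> g \<in> auto G \<Longrightarrow> f \<otimes>\<^bsub>AutoGroup G\<^esub> g \<in> auto G"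
  using monoid.m_closed[OF group.is_monoid[OF AutoGroup], of f g] by simp

lemma AutoGroup_apply:
  "f \<in> auto G \<Longrightarrow> g \<in> auto G \<Longrightarrow> y \<in> carrier G \<Longrightarrow> (f \<otimes>\<^bsub>AutoGroup G\<^esub> g) y = f (g y)"
  by (simp add: mult_AutoGroup compose_def)

lemmas aut_simps = fa fb AutoGroup_mult_closed AutoGroup_apply auto_closed fa_X fb_X fa_x fb_x
  auto_mult auto_inv

definition c where "c = fa \<otimes>\<^bsub>AutoGroup G\<^esub> fb \<otimes>\<^bsub>AutoGroup G\<^esub> fa"

lemma X_closed: "t \<in> X \<Longrightarrow> t \<in> carrier G" using X by blast

lemma braid_relation: "c = fb \<otimes>\<^bsub>AutoGroup G\<^esub> fa \<otimes>\<^bsub>AutoGroup G\<^esub> fb"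
  unfolding c_def
  by (rule eq_on_gens) (simp_all add: aut_simps X_closed m_assoc inv_mult_group)

lemma c_auto: "c \<in> auto G"
  by (simp add: c_def aut_simps)

lemma c_simps:
  "t \<in> X \<Longrightarrow> c t = t" "c x1 = x3" "c x2 = inv x3 \<otimes> x2 \<otimes> x3"
  "c x3 = inv x3 \<otimes> inv x2 \<otimes> x1 \<otimes> x2 \<otimes> x3"
  by (simp_all add: c_def aut_simps X_closed m_assoc inv_mult_group)

definition P where "P = x1 \<otimes> x2 \<otimes> x3"

abbreviation "z \<equiv> c \<otimes>\<^bsub>AutoGroup G\<^esub> c"

lemma z_auto: "z \<in> auto G"
  by (simp add: AutoGroup_mult_closed c_auto)

lemma z_X: "t \<in> X \<Longrightarrow> z t = t"
  by (simp add: AutoGroup_apply c_auto c_simps X_closed)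

lemma z_x: "y \<in> {x1, x2, x3} \<Longrightarrow> z y = inv P \<otimes> y \<otimes> P"
  by (auto simp: AutoGroup_apply c_auto c_simps auto_mult auto_inv P_def m_assoc inv_mult_group)

lemma z_eq_conj:
  assumes w: "w \<in> carrier G" and wX: "\<And>t. t \<in> X \<Longrightarrow> w \<otimes> t = t \<otimes> w"
    and wx: "\<And>y. y \<in> {x1, x2, x3} \<Longrightarrow> w \<otimes> y \<otimes> inv w = inv P \<otimes> y \<otimes> P"
  shows "z = conj_aut w"
proof (rule eq_on_gens)
  fix t assume t: "t \<in> X"
  hence "w \<otimes> t \<otimes> inv w = t" using conj_eq_iff_commute[OF w X_closed] wX by blast
  thus "z t = conj_aut w t" using t by (simp add: z_X X_closed)
qed (use w wx in \<open>simp_all add: z_auto conj_aut_in_auto z_x\<close>)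

end

section \<open>Elements and relations of the double affine Artin group\<close>

section \<open>The double affine Artin group\<close>

locale daa = affine_root_data +
  fixes js
  assumes js: "reduced_decomposition n A js (theta_refl n A)"
    and n_pos: "1 \<le> n"
begin

text \<open>Treats A_{2n}^(2) along with the other types: the lattice has basis alpha_i / h_i, and
  the hat coroots are h_i times the simple coroots.\<close>

definition h :: "nat \<Rightarrow> nat" where
  "h i = (if of_type (Aff_A2_even n) n A \<and> i = n then 2 else 1)"

abbreviation "\<G> \<equiv> daa_group n A"
abbreviation "cl \<equiv> daa_class n A"
abbreviation "L \<equiv> finite_lattice n A"
abbreviation "Te \<equiv> T_elt n A"

definition Xe :: "rvec \<Rightarrow> daa_gen word set" where "Xe \<beta> = cl [Pos (GX \<beta>)]"
definition De :: "daa_gen word set" where "De = cl [Pos GD]"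

sublocale G: group "daa_group n A"
  unfolding daa_group_def by (rule group_presented_group)

lemma gens [simp]: "GT i \<in> daa_gens n A \<longleftrightarrow> i \<le> n" "GX \<beta> \<in> daa_gens n A \<longleftrightarrow> \<beta> \<in> L" "GD \<in> daa_gens n A"
  by (auto simp: daa_gens_def)

lemma cl_closed: "w \<in> words (daa_gens n A) \<Longrightarrow> cl w \<in> carrier \<G>"
  unfolding daa_class_def daa_group_def by simp

lemma cl_mult: "u \<in> words (daa_gens n A) \<Longrightarrow> v \<in> words (daa_gens n A) \<Longrightarrow> cl u \<otimes>\<^bsub>\<G>\<^esub> cl v = cl (u @ v)"
  unfolding daa_class_def daa_group_def by (rule presented_group_mult)

lemma cl_Nil: "cl [] = \<one>\<^bsub>\<G>\<^esub>"
  unfolding daa_class_def daa_group_def by (simp add: presented_group_one)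

lemma cl_rel: "(u, v) \<in> daa_rels n A \<Longrightarrow> u \<in> words (daa_gens n A) \<Longrightarrow> v \<in> words (daa_gens n A) \<Longrightarrow> cl u = cl v"
  unfolding daa_class_def by (rule word_class_rel)

lemma Te_closed: "i \<le> n \<Longrightarrow> Te i \<in> carrier \<G>"
  and Xe_closed: "\<beta> \<in> L \<Longrightarrow> Xe \<beta> \<in> carrier \<G>"
  and De_closed: "De \<in> carrier \<G>"
  by (simp_all add: T_elt_def Xe_def De_def cl_closed)

lemma L_iff: "\<beta> \<in> L \<longleftrightarrow> \<beta> 0 = 0 \<and> (\<forall>j>n. \<beta> j = 0) \<and> (\<forall>j\<in>I. real (h j) * \<beta> j \<in> \<int>)"
  by (auto simp: finite_lattice_def h_def)

lemma L_outside: "\<beta> \<in> L \<Longrightarrow> k \<notin> I \<Longrightarrow> \<beta> k = 0"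
  by (cases "k = 0") (auto simp: L_iff)

lemma h_pos: "0 < h i" by (simp add: h_def)

lemma h_neq_0 [simp]: "h i \<noteq> 0"
  using h_pos[of i] by simp

lemma L_add: "\<beta> \<in> L \<Longrightarrow> \<gamma> \<in> L \<Longrightarrow> (\<lambda>j. \<beta> j + \<gamma> j) \<in> L"
  by (auto simp: L_iff distrib_left)

lemma L_uminus: "\<beta> \<in> L \<Longrightarrow> (\<lambda>j. - \<beta> j) \<in> L"
  by (auto simp: L_iff)

lemma L_zero: "(\<lambda>j. 0) \<in> L"
  by (auto simp: L_iff)

lemma Xe_add: "\<beta> \<in> L \<Longrightarrow> \<gamma> \<in> L \<Longrightarrow> Xe \<beta> \<otimes>\<^bsub>\<G>\<^esub> Xe \<gamma> = Xe (\<lambda>j. \<beta> j + \<gamma> j)"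
  unfolding Xe_def by (simp add: cl_mult) (rule cl_rel, auto simp: daa_rels_def L_add)

lemma Xe_zero: "Xe (\<lambda>j. 0) = \<one>\<^bsub>\<G>\<^esub>"
  using Xe_add[OF L_zero L_zero] Xe_closed[OF L_zero] by (simp add: G.r_cancel_one')

lemma Xe_uminus: "\<beta> \<in> L \<Longrightarrow> Xe (\<lambda>j. - \<beta> j) = inv\<^bsub>\<G>\<^esub> Xe \<beta>"
  by (rule G.inv_equality[symmetric])
     (use Xe_add[OF L_uminus, of \<beta> \<beta>] in \<open>simp_all add: Xe_zero Xe_closed L_uminus\<close>)

lemma De_Te: "i \<le> n \<Longrightarrow> De \<otimes>\<^bsub>\<G>\<^esub> Te i = Te i \<otimes>\<^bsub>\<G>\<^esub> De"
  unfolding De_def T_elt_def by (simp add: cl_mult) (rule cl_rel, auto simp: daa_rels_def)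

lemma De_Xe: "\<beta> \<in> L \<Longrightarrow> De \<otimes>\<^bsub>\<G>\<^esub> Xe \<beta> = Xe \<beta> \<otimes>\<^bsub>\<G>\<^esub> De"
  unfolding De_def Xe_def by (simp add: cl_mult) (rule cl_rel, auto simp: daa_rels_def)

lemma form_hat: "i \<le> n \<Longrightarrow> F \<beta> (hat_coroot n A i) = h i * cp i \<beta>"
  by (simp add: hat_coroot_def h_def form_coroot form_scale_right)

lemma Te_Xe: "i \<le> n \<Longrightarrow> \<beta> \<in> L \<Longrightarrow> cp i \<beta> = 0 \<Longrightarrow> Te i \<otimes>\<^bsub>\<G>\<^esub> Xe \<beta> = Xe \<beta> \<otimes>\<^bsub>\<G>\<^esub> Te i"
  unfolding T_elt_def Xe_def
  by (simp add: cl_mult) (rule cl_rel, auto simp: daa_rels_def form_hat)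

lemma Te_Xe_Te:
  assumes i: "i \<in> I" and b: "\<beta> \<in> L" "sr i \<beta> \<in> L" and eq: "h i * cp i \<beta> = - 1"
  shows "Te i \<otimes>\<^bsub>\<G>\<^esub> Xe \<beta> \<otimes>\<^bsub>\<G>\<^esub> Te i = Xe (sr i \<beta>)"
proof -
  have "sr i \<beta> 0 = 0" using b(2) by (simp add: L_iff)
  \<comment> \<open>A finite reflection creates no alpha_0 coordinate, so the central generator
    occurs with exponent 0.\<close>
  hence X: "X_word n A (sr i \<beta>) = [Pos (GX (sr i \<beta>))]" by (simp add: X_word_def int_power_word_def)
  have "([Pos (GT i), Pos (GX \<beta>), Pos (GT i)], X_word n A (sr i \<beta>)) \<in> daa_rels n A"
    using i b eq by (auto simp: daa_rels_def form_hat)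
  hence "cl [Pos (GT i), Pos (GX \<beta>), Pos (GT i)] = cl [Pos (GX (sr i \<beta>))]"
    unfolding X by (rule cl_rel) (use i b in auto)
  thus ?thesis using i b unfolding T_elt_def Xe_def by (simp add: cl_mult)
qed

lemma words_T: "us \<in> lists {..n} \<Longrightarrow> map (\<lambda>j. Pos (GT j)) us \<in> words (daa_gens n A)"
  by (induction us) auto

lemma cl_T_word: "us \<in> lists {..n} \<Longrightarrow>
    cl (map (\<lambda>j. Pos (GT j)) us) = foldr (\<lambda>i g. Te i \<otimes>\<^bsub>\<G>\<^esub> g) us \<one>\<^bsub>\<G>\<^esub>"
proof (induction us)
  case (Cons i us)
  hence us: "i \<le> n" "us \<in> lists {..n}" by auto
  hence "cl (Pos (GT i) # map (\<lambda>j. Pos (GT j)) us) = Te i \<otimes>\<^bsub>\<G>\<^esub> cl (map (\<lambda>j. Pos (GT j)) us)"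
    by (simp add: T_elt_def cl_mult words_T)
  thus ?case using Cons.IH[OF us(2)] by simp
qed (simp add: cl_Nil)

lemma map_alternating: "map f (alternating k x y) = alternating k (f x) (f y)"
  by (induction k arbitrary: x y) auto

lemma Te_braid:
  assumes "i \<le> n" "j \<le> n" "i \<noteq> j" "laces A i j \<in> {0, 1, 2, 3}"
  shows "foldr (\<lambda>i g. Te i \<otimes>\<^bsub>\<G>\<^esub> g) (alternating (m i j) i j) \<one>\<^bsub>\<G>\<^esub> =
    foldr (\<lambda>i g. Te i \<otimes>\<^bsub>\<G>\<^esub> g) (alternating (m i j) j i) \<one>\<^bsub>\<G>\<^esub>"
proof -
  have l: "alternating (m i j) i j \<in> lists {..n}" "alternating (m i j) j i \<in> lists {..n}"
    using set_alternating[of "m i j" i j] set_alternating[of "m i j" j i] assms by auto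
  have "cl (map (\<lambda>j. Pos (GT j)) (alternating (m i j) i j)) = cl (map (\<lambda>j. Pos (GT j)) (alternating (m i j) j i))"
    by (rule cl_rel[OF _ words_T[OF l(1)] words_T[OF l(2)]])
       (use assms in \<open>unfold map_alternating daa_rels_def braid_rels_def, blast\<close>)
  thus ?thesis using l by (simp add: cl_T_word)
qed

sublocale braided n A "daa_group n A" Te
proof unfold_locales
  show "foldr (\<lambda>i g. Te i \<otimes>\<^bsub>\<G>\<^esub> g) (alternating (m i j) i j) \<one>\<^bsub>\<G>\<^esub> =
    foldr (\<lambda>i g. Te i \<otimes>\<^bsub>\<G>\<^esub> g) (alternating (m i j) j i) \<one>\<^bsub>\<G>\<^esub>"
    if "i \<in> I" "j \<in> I" "i \<noteq> j" for i j
    by (rule Te_braid[OF _ _ that(3) laces_bound[OF that]]) (use that in auto)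
qed (rule Te_closed)

lemma red_js: "red js" and wp_js: "wp js = theta_refl n A"
  using js by (auto simp: reduced_decomposition_def red_def)

lemma js_I: "js \<in> lists I"
  using red_js by (rule red_lists)

lemma T_word_elt_tw: "T_word_elt n A us = tw us" if "us \<in> lists I"
proof -
  have "us \<in> lists {..n}" using that by auto
  thus ?thesis by (simp add: T_word_elt_def tw_def cl_T_word)
qed

abbreviation "th \<equiv> theta n A"

definition theta0 :: rvec where "theta0 = (\<lambda>j. th j / real (labels n A 0))"

lemma a0: "0 < labels n A 0" by (simp add: label_pos)

lemma cp_th: "i \<le> n \<Longrightarrow> cp i th = - real (labels n A 0) * A i 0"
  by (simp add: theta_def cp_diff cp_delta cp_al)

lemma cp_theta0: "i \<le> n \<Longrightarrow> cp i theta0 = - A i 0"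
  using cp_scale[of i "1 / real (labels n A 0)" th] a0 by (simp add: theta0_def cp_th)

lemma th_0: "th 0 = 0"
  by (simp add: theta_def delta_def simple_root_def)

text \<open>Write theta = delta - a_0 alpha_0 and use that delta lies in the radical of the
  form.\<close>

lemma form_th: "F th th = real (labels n A 0) ^ 2 * (2 / d 0)"
proof -
  have "F th th = F (\<lambda>k. 1 * delta n A k + (- real (labels n A 0)) * al 0 k) th"
    by (simp add: theta_def)
  also have "\<dots> = F (delta n A) th - real (labels n A 0) * F (al 0) th"
    unfolding form_linear_left by simp
  also have "F (delta n A) th = 0"
    unfolding form_sym[of _ th] by (simp add: form_cp cp_delta)
  finally show ?thesis using A_diag[of 0] by (simp add: form_al cp_th power2_eq_square)
qed

lemma form_th_pos: "0 < F th th"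
  using a0 d_pos[of 0] by (simp add: form_th)

lemma th_dominant: "i \<in> I \<Longrightarrow> 0 \<le> F th (al i)"
  using A_off[of i 0] d_pos[of i]
  by (simp add: form_al' cp_th divide_nonpos_pos mult_nonneg_nonpos)

lemma theta_refl_th: "theta_refl n A th = (\<lambda>k. - th k)"
  using form_th_pos by (simp add: theta_refl_def)

lemma theta_refl_orth: "F x th = 0 \<Longrightarrow> theta_refl n A x = x"
  by (simp add: theta_refl_def)

end

text \<open>In order: theta / a_0 lies in the lattice, the hat coroots are integral on the lattice,
  and theta / a_0 is no longer than any basis vector alpha_i / h_i.\<close>

locale daa_hat = daa +
  assumes h_label: "i \<in> {1..n} \<Longrightarrow> labels n A 0 dvd labels n A i * h i"
    and h_cartan: "i \<in> {1..n} \<Longrightarrow> j \<in> {1..n} \<Longrightarrow> int (h j) dvd A i j * int (h i)"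
    and h_norm: "i \<in> {1..n} \<Longrightarrow> labels n A i * h i ^ 2 * colabels n A 0 \<le> colabels n A i * labels n A 0"
begin

lemma theta0_pos: "i \<in> I \<Longrightarrow> 0 < theta0 i"
  using a0 label_pos[of i] by (simp add: theta0_def theta_def delta_def simple_root_def)

lemma theta0_L: "theta0 \<in> L"
proof -
  have "real (h j) * theta0 j \<in> \<int>" if j: "j \<in> I" for j
  proof -
    obtain k where "labels n A j * h j = labels n A 0 * k" using h_label[OF j] by (rule dvdE)
    hence "real (h j) * real (labels n A j) = real (labels n A 0) * real k"
      by (metis mult.commute of_nat_mult)
    hence "real (h j) * theta0 j = real k"
      using a0 j by (simp add: theta0_def theta_def delta_def simple_root_def field_simps)
    thus ?thesis by simp
  qed
  moreover have "0 < n" using n_pos by simp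
  ultimately show ?thesis
    using th_0 by (auto simp: L_iff theta0_def theta_def delta_def simple_root_def label_outside)
qed

section \<open>Generation of the group by descent in the lattice\<close>

definition hat_root :: "nat \<Rightarrow> rvec" where "hat_root i = (\<lambda>k. al i k / h i)"

lemma hat_root_L: "i \<in> I \<Longrightarrow> hat_root i \<in> L"
  using h_pos[of i] by (auto simp: L_iff hat_root_def simple_root_def)

lemma cp_hat_root: "i \<in> I \<Longrightarrow> cp j (hat_root i) = A j i / h i"
  using cp_scale[of j "1 / h i" "al i"] by (simp add: hat_root_def cp_al)

lemma form_hat_root: "i \<in> I \<Longrightarrow> F x (hat_root i) = cp i x / (d i * h i)"
  using form_scale_right[of x "1 / h i" "al i"] by (simp add: hat_root_def form_al' mult.commute)

lemma form_theta0: "F theta0 theta0 = 2 / d 0"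
  using form_scale_left[of "1 / real (labels n A 0)" th] form_scale_right[of _ "1 / real (labels n A 0)" th] a0
  by (simp add: theta0_def form_th power2_eq_square)

lemma form_theta0_le:
  assumes i: "i \<in> I"
  shows "F theta0 theta0 \<le> F (hat_root i) (hat_root i)"
proof -
  have n: "i \<le> n" using i by simp
  have pos: "0 < real (labels n A i)" "0 < real (colabels n A i)" "0 < real (h i)"
    "0 < real (labels n A 0)" "0 < real (colabels n A 0)"
    using label_pos[OF n] colabel_pos[OF n] h_pos label_pos[of 0] colabel_pos[of 0] by simp_all
  have "real (labels n A i * h i ^ 2 * colabels n A 0) \<le> real (colabels n A i * labels n A 0)"
    using h_norm[OF i] by (simp only: of_nat_le_iff)
  hence "colabels n A 0 / labels n A 0 \<le> colabels n A i / (labels n A i * (h i)\<^sup>2)"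
    using pos by (simp add: divide_simps mult_ac)
  moreover have "F (hat_root i) (hat_root i) = 2 * (colabels n A i / (labels n A i * (h i)\<^sup>2))"
    using i pos by (simp add: form_hat_root cp_hat_root dd_def power2_eq_square)
  moreover have "F theta0 theta0 = 2 * (colabels n A 0 / labels n A 0)"
    by (simp add: form_theta0 dd_def)
  ultimately show ?thesis by linarith
qed

lemma hat_pairing_Ints:
  assumes i: "i \<in> I" and b: "\<beta> \<in> L"
  shows "h i * cp i \<beta> \<in> \<int>"
proof -
  have "h i * cp i \<beta> = (\<Sum>j\<le>n. real (h i) * (A i j * \<beta> j))"
    by (simp add: pairing_def sum_distrib_left)
  also have "\<dots> \<in> \<int>"
  proof (rule Ints_sum)
    fix j assume "j \<in> {..n}"
    show "real (h i) * (A i j * \<beta> j) \<in> \<int>"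
    proof (cases "j = 0")
      case False
      hence j: "j \<in> I" using \<open>j \<in> {..n}\<close> by auto
      obtain k where "A i j * int (h i) = int (h j) * k" using h_cartan[OF i j] by (rule dvdE)
      hence "real_of_int (A i j) * real (h i) = real (h j) * real_of_int k"
        by (metis of_int_mult of_int_of_nat_eq)
      hence "real (h i) * (A i j * \<beta> j) = real_of_int k * (real (h j) * \<beta> j)"
        using mult.assoc[of "real_of_int (A i j)" "real (h i)" "\<beta> j"] by (simp add: mult_ac)
      moreover have "real (h j) * \<beta> j \<in> \<int>" using b j by (simp add: L_iff)
      ultimately show ?thesis by (simp only: Ints_mult Ints_of_int)
    qed (use b in \<open>simp add: L_iff\<close>)
  qed
  finally show ?thesis .
qed

lemma sr_hat: "i \<in> I \<Longrightarrow> sr i \<beta> = (\<lambda>k. \<beta> k - (h i * cp i \<beta>) * hat_root i k)"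
  using h_pos[of i] by (simp add: sr_eq hat_root_def)

lemma Ints_ge_1: "(x::real) \<in> \<int> \<Longrightarrow> 0 < x \<Longrightarrow> 1 \<le> x"
  by (auto elim: Ints_cases)

text \<open>Descent from a vector \<open>\<beta>\<close> of minimal length: if \<open>\<beta>\<close> pairs positively with \<open>\<alpha>\<^sub>i\<close>, then either the
  hat coroot takes the value 1 and \<open>s\<^sub>i \<beta>\<close> is smaller, or minimality forces \<open>\<beta>\<close> to be the simple root.\<close>

lemma descent:
  assumes K: "subgroup K \<G>" and T: "\<And>i. i \<in> I \<Longrightarrow> Te i \<in> K"
    and b: "\<beta> \<in> L" "Xe \<beta> \<in> K" "\<And>k. 0 \<le> \<beta> k" "F \<beta> \<beta> = F theta0 theta0"
    and i: "i \<in> I" "\<beta> i \<noteq> 0"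
  shows "Xe (hat_root i) \<in> K"
  using b i
proof (induction "nat \<lfloor>\<Sum>j\<in>I. h j * \<beta> j\<rfloor>" arbitrary: \<beta> i rule: less_induct)
  case less
  note b = less.prems(1-4)
  interpret K: subgroup K \<G> by (fact K)
  have pos: "0 < F \<beta> \<beta>" using b(4) d_pos[of 0] by (simp add: form_theta0)
  note out = L_outside[OF b(1)]
  \<comment> \<open>The positive number (beta, beta) is the sum of these terms, so one of them is
    positive.\<close>
  have "\<exists>j\<in>I. 0 < \<beta> j * (cp j \<beta> / d j)"
  proof (rule ccontr)
    assume *: "\<not> ?thesis"
    have "F \<beta> \<beta> \<le> 0" unfolding form_cp
    proof (rule sum_nonpos)
      show "\<beta> j * (cp j \<beta> / d j) \<le> 0" for j
        using * out[of j] by (cases "j \<in> I") (auto simp: not_less)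
    qed
    thus False using pos by simp
  qed
  then obtain j where j: "j \<in> I" "0 < \<beta> j * (cp j \<beta> / d j)" by blast
  have jn: "j \<le> n" using j by simp
  have bj: "0 < \<beta> j" "0 < cp j \<beta>"
    using j(2) b(3)[of j] d_pos[OF jn] by (auto simp: zero_less_mult_iff zero_less_divide_iff)
  define k where "k = h j * cp j \<beta>"
  have k: "k \<in> \<int>" "1 \<le> k"
    using hat_pairing_Ints[OF j(1) b(1)] Ints_ge_1 bj(2) h_pos[of j] by (simp_all add: k_def)
  have hbj: "real (h j) * \<beta> j \<in> \<int>" using b(1) j(1) by (simp add: L_iff)
  have hb1: "1 \<le> real (h j) * \<beta> j" using Ints_ge_1[OF hbj] bj(1) h_pos[of j] by simp
  show ?case
  proof (cases "k = 1")
    case True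
    define \<gamma> where "\<gamma> = sr j \<beta>"
    have g: "\<gamma> = (\<lambda>l. \<beta> l - hat_root j l)" using j(1) True by (simp add: \<gamma>_def sr_hat k_def)
    have gL: "\<gamma> \<in> L" unfolding g using L_add[OF b(1) L_uminus[OF hat_root_L[OF j(1)]]] by simp
    have cg: "cp j \<gamma> = - cp j \<beta>" using jn by (simp add: \<gamma>_def sr_eq cp_diff cp_al)
    \<comment> \<open>The reflected vector pairs to -1 with the hat coroot, so relation (iii)
      applies to it: it puts the element of \<gamma> into \<open>K\<close>, and dividing by it
      leaves the element of the root \<open>hat_root j\<close>.\<close>
    have "Te j \<otimes>\<^bsub>\<G>\<^esub> Xe \<gamma> \<otimes>\<^bsub>\<G>\<^esub> Te j = Xe (sr j \<gamma>)"
      by (rule Te_Xe_Te[OF j(1) gL]) (use jn b(1) True in \<open>simp_all add: \<gamma>_def sr_sr cg[unfolded \<gamma>_def] k_def\<close>)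
    also have "sr j \<gamma> = \<beta>" using jn by (simp add: \<gamma>_def sr_sr)
    finally have rel: "Te j \<otimes>\<^bsub>\<G>\<^esub> Xe \<gamma> \<otimes>\<^bsub>\<G>\<^esub> Te j = Xe \<beta>" .
    hence "Xe \<gamma> = inv\<^bsub>\<G>\<^esub> Te j \<otimes>\<^bsub>\<G>\<^esub> Xe \<beta> \<otimes>\<^bsub>\<G>\<^esub> inv\<^bsub>\<G>\<^esub> Te j"
      using Te_closed[OF jn] Xe_closed[OF gL] by (simp add: G.m_assoc rel[symmetric])
    hence gK: "Xe \<gamma> \<in> K" using T[OF j(1)] b(2) by simp
    have "(\<lambda>l. \<beta> l + - \<gamma> l) = hat_root j" by (simp add: g)
    hence "Xe (hat_root j) = Xe \<beta> \<otimes>\<^bsub>\<G>\<^esub> inv\<^bsub>\<G>\<^esub> Xe \<gamma>"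
      using Xe_add[OF b(1) L_uminus[OF gL]] Xe_uminus[OF gL] by simp
    hence hK: "Xe (hat_root j) \<in> K" using gK b(2) by simp
    show ?thesis
    proof (cases "i = j")
      case False
      show ?thesis
      \<comment> \<open>Only coordinate j has changed, so i stays in the support, while the sum of
        the lattice coordinates drops by exactly 1.\<close>
      proof (rule less.hyps[OF _ gL gK _ _ less.prems(5)])
        show "\<gamma> i \<noteq> 0" using False less.prems(6) by (simp add: g hat_root_def simple_root_def)
        show "F \<gamma> \<gamma> = F theta0 theta0" unfolding \<gamma>_def using jn b(4) by (simp add: form_sr)
        show "0 \<le> \<gamma> l" for l
          using b(3)[of l] hb1 h_pos[of j] by (auto simp: g hat_root_def simple_root_def divide_simps mult.commute)
        have "(\<Sum>l\<in>I. h l * \<gamma> l) = (\<Sum>l\<in>I. h l * \<beta> l - al j l)"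
          using h_pos[of j] by (intro sum.cong HOL.refl) (simp add: g hat_root_def simple_root_def right_diff_distrib)
        also have "\<dots> = (\<Sum>l\<in>I. h l * \<beta> l) - 1"
          using j(1) by (simp add: sum_subtractf simple_root_def)
        finally have eq: "(\<Sum>l\<in>I. h l * \<gamma> l) = (\<Sum>l\<in>I. h l * \<beta> l) - 1" .
        have "real (h j) * \<beta> j \<le> (\<Sum>l\<in>I. h l * \<beta> l)"
          using j(1) b(3) by (intro member_le_sum) auto
        hence "1 \<le> (\<Sum>l\<in>I. h l * \<beta> l)" using hb1 by simp
        thus "nat \<lfloor>\<Sum>l\<in>I. h l * \<gamma> l\<rfloor> < nat \<lfloor>\<Sum>l\<in>I. h l * \<beta> l\<rfloor>"
          unfolding eq by linarith
      qed
    qed (use hK in simp)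
  next
    case False
    have k2: "2 \<le> k"
      using k False Ints_ge_1[of "k - 1"] by simp
    \<comment> \<open>The squared length of this difference is (beta, beta) - (k - 1) times that of
      the hat root. For k at least 2 it is at most 0, as beta is no longer than the hat root, so
      definiteness forces beta to be the hat root itself.\<close>
    define \<gamma> where "\<gamma> = (\<lambda>l. 1 * \<beta> l + (- 1) * hat_root j l)"
    have fb: "F \<beta> (hat_root j) = k / (d j * (h j)\<^sup>2)"
      using j(1) h_pos[of j] by (simp add: form_hat_root k_def power2_eq_square)
    have fh: "F (hat_root j) (hat_root j) = 2 / (d j * (h j)\<^sup>2)"
      using j(1) by (simp add: form_hat_root cp_hat_root power2_eq_square mult_ac)
    have "F \<gamma> \<gamma> = F \<beta> \<beta> - 2 * F \<beta> (hat_root j) + F (hat_root j) (hat_root j)"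
      unfolding \<gamma>_def form_linear_left form_linear_right by (simp add: form_sym[of "hat_root j" \<beta>])
    also have "\<dots> = F \<beta> \<beta> - (k - 1) * F (hat_root j) (hat_root j)"
      unfolding fb fh by (simp only: left_diff_distrib) simp
    also have "\<dots> \<le> F \<beta> \<beta> - 1 * F (hat_root j) (hat_root j)"
      using k2 fh d_pos[OF jn] by (intro diff_left_mono mult_right_mono) auto
    also have "\<dots> \<le> 0" using form_theta0_le[OF j(1)] b(4) by simp
    finally have "F \<gamma> \<gamma> \<le> 0" .
    hence "\<gamma> l = 0" for l
      by (rule form_definite[rotated 2]) (use out j(1) in \<open>auto simp: \<gamma>_def hat_root_def simple_root_def\<close>)
    hence eq: "\<beta> = hat_root j" by (auto simp: \<gamma>_def fun_eq_iff)
    hence "i = j" using less.prems(6) by (auto simp: hat_root_def simple_root_def split: if_splits)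
    thus ?thesis using b(2) eq by simp
  qed
qed

lemma Xe_lattice_in_subgroup:
  assumes K: "subgroup K \<G>" and hK: "\<And>i. i \<in> I \<Longrightarrow> Xe (hat_root i) \<in> K" and b: "\<beta> \<in> L"
  shows "Xe \<beta> \<in> K"
proof -
  interpret K: subgroup K \<G> by (fact K)
  define M where "M = {\<gamma> \<in> L. Xe \<gamma> \<in> K}"
  have add: "(\<lambda>k. \<gamma> k + \<gamma>' k) \<in> M" if "\<gamma> \<in> M" "\<gamma>' \<in> M" for \<gamma> \<gamma>'
    using that by (auto simp: M_def L_add Xe_add[symmetric])
  have neg: "(\<lambda>k. - \<gamma> k) \<in> M" if "\<gamma> \<in> M" for \<gamma>
    using that by (auto simp: M_def L_uminus Xe_uminus)
  have zero: "(\<lambda>k. 0) \<in> M" by (simp add: M_def L_zero Xe_zero)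
  have nat: "(\<lambda>k. real l * \<gamma> k) \<in> M" if "\<gamma> \<in> M" for \<gamma> and l :: nat
  proof (induction l)
    case (Suc l)
    thus ?case using add[OF that Suc] by (simp add: distrib_right)
  qed (simp add: zero)
  have int: "(\<lambda>k. z * \<gamma> k) \<in> M" if \<gamma>: "\<gamma> \<in> M" and z: "z \<in> \<int>" for \<gamma> and z :: real
  proof -
    obtain w where w: "z = of_int w" using z by (auto elim: Ints_cases)
    show ?thesis using nat[OF \<gamma>, of "nat w"] neg[OF nat[OF \<gamma>, of "nat (- w)"]]
      by (cases "0 \<le> w") (simp_all add: w)
  qed
  have sum: "(\<lambda>k. \<Sum>i\<in>J. (h i * \<beta> i) * hat_root i k) \<in> M" if "finite J" "J \<subseteq> I" for J
    using that
  proof (induction J)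
    case (insert i J)
    have "hat_root i \<in> M" using insert.prems hK hat_root_L by (simp add: M_def)
    moreover have "real (h i) * \<beta> i \<in> \<int>" using b insert.prems by (simp add: L_iff)
    ultimately show ?case using add[OF int insert.IH] insert by simp
  qed (simp add: zero)
  have "\<beta> = (\<lambda>k. \<Sum>i\<in>I. \<beta> i * al i k)"
    by (rule decompose) (rule L_outside[OF b])
  also have "\<dots> = (\<lambda>k. \<Sum>i\<in>I. (h i * \<beta> i) * hat_root i k)"
    by (simp add: hat_root_def)
  finally show ?thesis using sum[of I] by (simp add: M_def)
qed

abbreviation "x1 \<equiv> T01 n A"
abbreviation "x2 \<equiv> T02 n A"
abbreviation "x3 \<equiv> T03 n A js"

lemma X_elt_theta0: "X_elt n A theta0 = Xe theta0"
  using theta0_L by (simp add: X_elt_def Xe_def X_word_def int_power_word_def L_iff)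

text \<open>Use alpha_0 = delta / a_0 - theta / a_0.\<close>

lemma X_elt_al0: "X_elt n A (al 0) = Xe (\<lambda>j. - theta0 j) \<otimes>\<^bsub>\<G>\<^esub> De"
proof -
  have "(\<lambda>j. al 0 j - al 0 0 * (delta n A j / real (labels n A 0))) = (\<lambda>j. - theta0 j)"
    using a0 by (auto simp: theta0_def theta_def simple_root_def field_simps)
  hence "X_word n A (al 0) = [Pos (GX (\<lambda>j. - theta0 j))] @ [Pos GD]"
    by (simp add: X_word_def int_power_word_def simple_root_def)
  thus ?thesis using L_uminus[OF theta0_L] by (simp add: X_elt_def Xe_def De_def cl_mult)
qed

lemma x1_eq: "x1 = Te 0"
  and x2_eq: "x2 = inv\<^bsub>\<G>\<^esub> Te 0 \<otimes>\<^bsub>\<G>\<^esub> (inv\<^bsub>\<G>\<^esub> Xe theta0 \<otimes>\<^bsub>\<G>\<^esub> De)"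
  and x3_eq: "x3 = Xe theta0 \<otimes>\<^bsub>\<G>\<^esub> inv\<^bsub>\<G>\<^esub> tw js"
  unfolding T01_def T02_def T03_def theta0_def[symmetric] X_elt_theta0
  by (simp_all add: X_elt_al0 Xe_uminus theta0_L T_word_elt_tw js_I)

lemma closed [simp]: "Te 0 \<in> carrier \<G>" "Xe theta0 \<in> carrier \<G>" "De \<in> carrier \<G>" "tw js \<in> carrier \<G>"
  by (simp_all add: Te_closed Xe_closed theta0_L De_closed tw_closed js_I)

lemma x_closed: "x1 \<in> carrier \<G>" "x2 \<in> carrier \<G>" "x3 \<in> carrier \<G>"
  by (simp_all add: x1_eq x2_eq x3_eq)

lemma x_product: "x1 \<otimes>\<^bsub>\<G>\<^esub> x2 \<otimes>\<^bsub>\<G>\<^esub> x3 = De \<otimes>\<^bsub>\<G>\<^esub> inv\<^bsub>\<G>\<^esub> tw js"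
proof -
  have "x1 \<otimes>\<^bsub>\<G>\<^esub> x2 \<otimes>\<^bsub>\<G>\<^esub> x3 =
      inv\<^bsub>\<G>\<^esub> Xe theta0 \<otimes>\<^bsub>\<G>\<^esub> (De \<otimes>\<^bsub>\<G>\<^esub> Xe theta0) \<otimes>\<^bsub>\<G>\<^esub> inv\<^bsub>\<G>\<^esub> tw js"
    by (simp add: x1_eq x2_eq x3_eq G.m_assoc)
  thus ?thesis by (simp only: De_Xe[OF theta0_L]) (simp add: G.m_assoc)
qed

text \<open>The three elements and the finite T_i give the lattice element of theta / a_0 and then
  the central generator. As theta has full support, the descent reaches the hat root of every finite
  node, and these span the lattice.\<close>

lemma generation: "carrier \<G> \<subseteq> generate \<G> (insert x1 (insert x2 (insert x3 (Te ` I))))"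
proof -
  define K where "K = generate \<G> (insert x1 (insert x2 (insert x3 (Te ` I))))"
  have K: "subgroup K \<G>"
    unfolding K_def by (rule G.generate_is_subgroup) (use x_closed Te_closed in auto)
  interpret K: subgroup K \<G> by (fact K)
  have x: "x1 \<in> K" "x2 \<in> K" "x3 \<in> K" and T: "\<And>i. i \<in> I \<Longrightarrow> Te i \<in> K"
    unfolding K_def by (auto intro: generate.incl)
  have tw: "tw us \<in> K" if "us \<in> lists I" for us
    using that by (induction us) (auto simp: tw_Cons T)
  have "Xe theta0 = x3 \<otimes>\<^bsub>\<G>\<^esub> tw js" by (simp add: x3_eq G.m_assoc)
  hence theta0: "Xe theta0 \<in> K" using x tw js_I by simp
  have "x1 \<otimes>\<^bsub>\<G>\<^esub> x2 = inv\<^bsub>\<G>\<^esub> Xe theta0 \<otimes>\<^bsub>\<G>\<^esub> De" by (simp add: x1_eq x2_eq)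
  hence "De = Xe theta0 \<otimes>\<^bsub>\<G>\<^esub> (x1 \<otimes>\<^bsub>\<G>\<^esub> x2)" by simp
  hence D: "De \<in> K" using theta0 x by simp
  have "Xe (hat_root i) \<in> K" if i: "i \<in> I" for i
  proof (rule descent[OF K T theta0_L theta0 _ HOL.refl i])
    show "0 \<le> theta0 k" for k
      using a0 by (simp add: theta0_def theta_def delta_def simple_root_def)
    show "theta0 i \<noteq> 0" using theta0_pos[OF i] by simp
  qed
  hence X: "Xe \<beta> \<in> K" if "\<beta> \<in> L" for \<beta> using Xe_lattice_in_subgroup[OF K _ that] by blast
  have T0: "Te i \<in> K" if "i \<le> n" for i
    using that T[of i] x(1) by (cases "i = 0") (auto simp: x1_eq)
  show ?thesis
    unfolding K_def[symmetric] unfolding daa_group_def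
  proof (rule presented_group_subgroup_eq)
    show "subgroup K (presented_group (daa_gens n A) (daa_rels n A))" using K by (simp add: daa_group_def)
    fix g assume "g \<in> daa_gens n A"
    thus "word_class (daa_gens n A) (daa_rels n A) [Pos g] \<in> K"
      using T0 X D unfolding T_elt_def Xe_def De_def daa_class_def by (cases g) auto
  qed
qed

end

section \<open>The full twist compared with conjugation by the lift of the longest element\<close>

locale daa_longest = daa_hat + longest
begin

sublocale braided_longest n A "daa_group n A" Te ws ..

text \<open>A finite node is orthogonal to theta exactly when it is not joined to node 0, since
  (theta, alpha_i) = -a_0 A i 0 / d_i. So for the letters of the complement T_i commutes with T_0 by
  a braid relation of length 2, with the element of theta / a_0 by relation (ii), and with T_s by
  \<open>tw_commute\<close>.\<close>

lemma ws_split: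
  obtains u where "u \<in> carrier \<G>" "tw ws = tw js \<otimes>\<^bsub>\<G>\<^esub> u" "u \<otimes>\<^bsub>\<G>\<^esub> tw js = tw js \<otimes>\<^bsub>\<G>\<^esub> u"
    "\<And>y. y \<in> {x1, x2, x3} \<Longrightarrow> u \<otimes>\<^bsub>\<G>\<^esub> y = y \<otimes>\<^bsub>\<G>\<^esub> u"
proof -
  have "wp js th = (\<lambda>k. - th k)" by (simp add: wp_js theta_refl_th)
  then obtain y where y: "red (js @ y)" "wp (js @ y) = wp ws" "\<And>i. i \<in> set y \<Longrightarrow> F th (al i) = 0"
    using ws_factor[OF th_dominant red_js] by blast
  have yI: "y \<in> lists I" using red_lists[OF y(1)] by simp
  have eq: "tw ws = tw js \<otimes>\<^bsub>\<G>\<^esub> tw y"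
    using matsumoto[OF red_ws y(1)] y(2) js_I yI by (simp add: tw_append)
  have comm: "g \<otimes>\<^bsub>\<G>\<^esub> tw us = tw us \<otimes>\<^bsub>\<G>\<^esub> g"
    if g: "g \<in> carrier \<G>" and c: "\<And>i. i \<in> I \<Longrightarrow> F th (al i) = 0 \<Longrightarrow> g \<otimes>\<^bsub>\<G>\<^esub> Te i = Te i \<otimes>\<^bsub>\<G>\<^esub> g"
      and us: "set us \<subseteq> set y" for g us
    using us
  proof (induction us)
    case (Cons i us)
    have i: "i \<in> I" "F th (al i) = 0" and uI: "us \<in> lists I" using Cons.prems yI y(3) by auto
    show ?case unfolding tw_Cons
      using g i(1) uI Cons c[OF i] by (intro G.commute_mult) (auto simp: T_closed_I tw_closed)
  qed (use g in simp)
  have orth: "A i 0 = 0" "A 0 i = 0" "i \<le> n" if "i \<in> I" "F th (al i) = 0" for i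
  proof -
    show n: "i \<le> n" using that by simp
    show "A i 0 = 0" using that a0 d_pos[OF n] n by (simp add: form_al' cp_th)
    thus "A 0 i = 0" using A_zero[of i 0] n by simp
  qed
  have cT0: "Te 0 \<otimes>\<^bsub>\<G>\<^esub> Te i = Te i \<otimes>\<^bsub>\<G>\<^esub> Te 0" if i: "i \<in> I" "F th (al i) = 0" for i
  proof -
    have l: "laces A i 0 = 0" and m2: "m i 0 = 2" using orth[OF i] by (simp_all add: laces_def braid_length_def)
    have "i \<noteq> 0" using i by auto
    from Te_braid[OF orth(3)[OF i] _ this] l show ?thesis
      using Te_closed[OF orth(3)[OF i]] by (simp add: m2 alternating_numeral)
  qed
  have cXe: "Xe theta0 \<otimes>\<^bsub>\<G>\<^esub> Te i = Te i \<otimes>\<^bsub>\<G>\<^esub> Xe theta0" if i: "i \<in> I" "F th (al i) = 0" for i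
    using Te_Xe[OF orth(3)[OF i] theta0_L] orth[OF i] by (simp add: cp_theta0)
  have cjs: "tw js \<otimes>\<^bsub>\<G>\<^esub> Te i = Te i \<otimes>\<^bsub>\<G>\<^esub> tw js" if i: "i \<in> I" "F th (al i) = 0" for i
    using tw_commute[OF red_js i(1)] theta_refl_orth[of "al i"] i(2) by (simp add: wp_js form_sym)
  have uc: "tw y \<in> carrier \<G>" using yI by (rule tw_closed)
  have T: "tw y \<otimes>\<^bsub>\<G>\<^esub> Te 0 = Te 0 \<otimes>\<^bsub>\<G>\<^esub> tw y" using comm[of "Te 0" y] cT0 by simp
  have X: "tw y \<otimes>\<^bsub>\<G>\<^esub> Xe theta0 = Xe theta0 \<otimes>\<^bsub>\<G>\<^esub> tw y" using comm[of "Xe theta0" y] cXe by simp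
  have D: "tw y \<otimes>\<^bsub>\<G>\<^esub> De = De \<otimes>\<^bsub>\<G>\<^esub> tw y" using comm[of De y] De_Te by simp
  have J: "tw y \<otimes>\<^bsub>\<G>\<^esub> tw js = tw js \<otimes>\<^bsub>\<G>\<^esub> tw y" using comm[of "tw js" y] cjs by simp
  have "tw y \<otimes>\<^bsub>\<G>\<^esub> x1 = x1 \<otimes>\<^bsub>\<G>\<^esub> tw y" by (simp add: x1_eq T)
  moreover have "tw y \<otimes>\<^bsub>\<G>\<^esub> x2 = x2 \<otimes>\<^bsub>\<G>\<^esub> tw y" unfolding x2_eq
    by (intro G.commute_mult G.commute_inv) (use uc T X D in simp_all)
  moreover have "tw y \<otimes>\<^bsub>\<G>\<^esub> x3 = x3 \<otimes>\<^bsub>\<G>\<^esub> tw y" unfolding x3_eq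
    by (intro G.commute_mult G.commute_inv) (use uc X J in simp_all)
  ultimately show ?thesis using that[OF uc eq J] by blast
qed

context
  fixes fa fb
  assumes a: "is_aut_a n A js fa" and b: "is_aut_b n A js fb"
begin

interpretation tb: triple_braid "daa_group n A" fa fb "Te ` I" x1 x2 x3
  using a b x_closed generation Te_closed
  by unfold_locales (auto simp: is_aut_a_def is_aut_b_def)

lemmas braid_relation = tb.braid_relation[unfolded tb.c_def]

lemma P_conj:
  assumes y: "y \<in> {x1, x2, x3}"
  shows "inv\<^bsub>\<G>\<^esub> tb.P \<otimes>\<^bsub>\<G>\<^esub> y \<otimes>\<^bsub>\<G>\<^esub> tb.P = tw js \<otimes>\<^bsub>\<G>\<^esub> y \<otimes>\<^bsub>\<G>\<^esub> inv\<^bsub>\<G>\<^esub> tw js"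
proof -
  have P: "tb.P = De \<otimes>\<^bsub>\<G>\<^esub> inv\<^bsub>\<G>\<^esub> tw js" unfolding tb.P_def by (rule x_product)
  have yc: "y \<in> carrier \<G>" using y x_closed by auto
  have dtw: "De \<otimes>\<^bsub>\<G>\<^esub> tw js = tw js \<otimes>\<^bsub>\<G>\<^esub> De"
  proof -
    have "us \<in> lists I \<Longrightarrow> De \<otimes>\<^bsub>\<G>\<^esub> tw us = tw us \<otimes>\<^bsub>\<G>\<^esub> De" for us
    proof (induction us)
      case (Cons i us)
      thus ?case unfolding tw_Cons
        by (intro G.commute_mult) (auto simp: T_closed_I tw_closed De_Te)
    qed simp
    thus ?thesis using js_I .
  qed
  have "De \<otimes>\<^bsub>\<G>\<^esub> x1 = x1 \<otimes>\<^bsub>\<G>\<^esub> De" by (simp add: x1_eq De_Te)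
  moreover have "De \<otimes>\<^bsub>\<G>\<^esub> x2 = x2 \<otimes>\<^bsub>\<G>\<^esub> De" unfolding x2_eq
    by (intro G.commute_mult G.commute_inv) (simp_all add: De_Te De_Xe theta0_L)
  moreover have "De \<otimes>\<^bsub>\<G>\<^esub> x3 = x3 \<otimes>\<^bsub>\<G>\<^esub> De" unfolding x3_eq
    by (intro G.commute_mult G.commute_inv) (simp_all add: De_Xe theta0_L dtw)
  ultimately have "De \<otimes>\<^bsub>\<G>\<^esub> y = y \<otimes>\<^bsub>\<G>\<^esub> De" using y by auto
  hence "inv\<^bsub>\<G>\<^esub> De \<otimes>\<^bsub>\<G>\<^esub> (y \<otimes>\<^bsub>\<G>\<^esub> De) = y" using yc by (metis G.inv_cancel_left(1) closed(3))
  thus ?thesis using yc by (simp add: P G.inv_mult_group G.m_assoc) (simp add: G.m_assoc[symmetric])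
qed

lemma z_x: "y \<in> {x1, x2, x3} \<Longrightarrow> tb.z y = tw js \<otimes>\<^bsub>\<G>\<^esub> y \<otimes>\<^bsub>\<G>\<^esub> inv\<^bsub>\<G>\<^esub> tw js"
  using tb.z_x P_conj by simp

lemma z_tw: "us \<in> lists I \<Longrightarrow> tb.z (tw us) = tw us"
proof (induction us)
  case Nil
  have "tb.z \<one>\<^bsub>\<G>\<^esub> \<otimes>\<^bsub>\<G>\<^esub> tb.z \<one>\<^bsub>\<G>\<^esub> = tb.z \<one>\<^bsub>\<G>\<^esub>"
    by (simp add: auto_mult[OF tb.z_auto, symmetric])
  thus ?case using auto_closed[OF tb.z_auto G.one_closed] by (simp add: G.r_cancel_one')
next
  case (Cons i us)
  thus ?case
    using auto_mult[OF tb.z_auto T_closed_I[of i] tw_closed[of us]] tb.z_X[of "Te i"] by (simp add: tw_Cons)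
qed

lemma conj_tw_ws:
  assumes u: "u \<in> carrier \<G>" "tw ws = tw js \<otimes>\<^bsub>\<G>\<^esub> u" and g: "g \<in> carrier \<G>" "u \<otimes>\<^bsub>\<G>\<^esub> g = g \<otimes>\<^bsub>\<G>\<^esub> u"
  shows "tw ws \<otimes>\<^bsub>\<G>\<^esub> g \<otimes>\<^bsub>\<G>\<^esub> inv\<^bsub>\<G>\<^esub> tw ws = tw js \<otimes>\<^bsub>\<G>\<^esub> g \<otimes>\<^bsub>\<G>\<^esub> inv\<^bsub>\<G>\<^esub> tw js"
proof -
  have "tw ws \<otimes>\<^bsub>\<G>\<^esub> g \<otimes>\<^bsub>\<G>\<^esub> inv\<^bsub>\<G>\<^esub> tw ws =
      tw js \<otimes>\<^bsub>\<G>\<^esub> (u \<otimes>\<^bsub>\<G>\<^esub> g \<otimes>\<^bsub>\<G>\<^esub> inv\<^bsub>\<G>\<^esub> u) \<otimes>\<^bsub>\<G>\<^esub> inv\<^bsub>\<G>\<^esub> tw js"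
    using u(1) g(1) by (simp add: u(2) G.inv_mult_group G.m_assoc)
  also have "u \<otimes>\<^bsub>\<G>\<^esub> g \<otimes>\<^bsub>\<G>\<^esub> inv\<^bsub>\<G>\<^esub> u = g"
    using g(2) G.conj_eq_iff_commute[OF u(1) g(1)] by simp
  finally show ?thesis .
qed

text \<open>The twist fixes each T_i, while conjugation by the lift of w_0 maps T_i to T_j with
  alpha_j = -w_0 alpha_i; if w_0 = -1 then j = i.\<close>

lemma z_eq_conj_if_minus_one:
  assumes "acts_as_minus_one n (wp ws)"
  shows "tb.z = G.conj_aut (tw ws)"
proof -
  obtain u where u: "u \<in> carrier \<G>" "tw ws = tw js \<otimes>\<^bsub>\<G>\<^esub> u"
    "\<And>y. y \<in> {x1, x2, x3} \<Longrightarrow> u \<otimes>\<^bsub>\<G>\<^esub> y = y \<otimes>\<^bsub>\<G>\<^esub> u" using ws_split by metis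
  show ?thesis
  proof (rule tb.z_eq_conj)
    show "tw ws \<in> carrier \<G>" by (rule tw_closed[OF ws_I])
    fix t assume "t \<in> Te ` I"
    then obtain i where i: "i \<in> I" "t = Te i" by blast
    have "wp ws (al i) = (\<lambda>k. - al i k)"
      using assms i(1) by (auto simp: acts_as_minus_one_def simple_root_def)
    thus "tw ws \<otimes>\<^bsub>\<G>\<^esub> t = t \<otimes>\<^bsub>\<G>\<^esub> tw ws" using tw_ws_T[OF i(1) i(1)] i(2) by simp
  next
    fix y assume y: "y \<in> {x1, x2, x3}"
    hence "y \<in> carrier \<G>" using x_closed by auto
    thus "tw ws \<otimes>\<^bsub>\<G>\<^esub> y \<otimes>\<^bsub>\<G>\<^esub> inv\<^bsub>\<G>\<^esub> tw ws = inv\<^bsub>\<G>\<^esub> tb.P \<otimes>\<^bsub>\<G>\<^esub> y \<otimes>\<^bsub>\<G>\<^esub> tb.P"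
      using P_conj[OF y] conj_tw_ws[OF u(1,2) _ u(3)[OF y]] by simp
  qed
qed

text \<open>The square of the lift of w_0 commutes with all T_i because the diagram symmetry -w_0 is
  an involution.\<close>

lemma z_sq_eq_conj: "tb.z \<otimes>\<^bsub>AutoGroup \<G>\<^esub> tb.z = G.conj_aut (tw ws \<otimes>\<^bsub>\<G>\<^esub> tw ws)"
proof -
  obtain u where u: "u \<in> carrier \<G>" "tw ws = tw js \<otimes>\<^bsub>\<G>\<^esub> u" "u \<otimes>\<^bsub>\<G>\<^esub> tw js = tw js \<otimes>\<^bsub>\<G>\<^esub> u"
    "\<And>y. y \<in> {x1, x2, x3} \<Longrightarrow> u \<otimes>\<^bsub>\<G>\<^esub> y = y \<otimes>\<^bsub>\<G>\<^esub> u" using ws_split by metis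
  let ?w = "tw ws"
  have wc: "?w \<in> carrier \<G>" by (rule tw_closed[OF ws_I])
  have ww: "?w \<otimes>\<^bsub>\<G>\<^esub> ?w \<in> carrier \<G>" using wc by simp
  have zz: "tb.z \<otimes>\<^bsub>AutoGroup \<G>\<^esub> tb.z \<in> auto \<G>" by (intro tb.AutoGroup_mult_closed tb.z_auto)
  have X: "(tb.z \<otimes>\<^bsub>AutoGroup \<G>\<^esub> tb.z) t = G.conj_aut (?w \<otimes>\<^bsub>\<G>\<^esub> ?w) t" if t: "t \<in> Te ` I" for t
  proof -
    obtain i where i: "i \<in> I" "t = Te i" using t by blast
    have tc: "t \<in> carrier \<G>" using i T_closed_I by simp
    have "(?w \<otimes>\<^bsub>\<G>\<^esub> ?w) \<otimes>\<^bsub>\<G>\<^esub> t \<otimes>\<^bsub>\<G>\<^esub> inv\<^bsub>\<G>\<^esub> (?w \<otimes>\<^bsub>\<G>\<^esub> ?w) = t"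
      using tw_ws_sq_T[OF i(1)] G.conj_eq_iff_commute[OF ww tc] i(2) by simp
    thus ?thesis using tc t by (simp add: tb.AutoGroup_apply tb.z_auto tb.z_X)
  qed
  have x: "(tb.z \<otimes>\<^bsub>AutoGroup \<G>\<^esub> tb.z) y = G.conj_aut (?w \<otimes>\<^bsub>\<G>\<^esub> ?w) y" if y: "y \<in> {x1, x2, x3}" for y
  proof -
    have yc: "y \<in> carrier \<G>" using y x_closed by auto
    define g where "g = tw js \<otimes>\<^bsub>\<G>\<^esub> y \<otimes>\<^bsub>\<G>\<^esub> inv\<^bsub>\<G>\<^esub> tw js"
    have gc: "g \<in> carrier \<G>" using yc by (simp add: g_def)
    \<comment> \<open>The complement commutes with T_s too, hence with the conjugate of
      \<open>y\<close>; so T_s can be replaced by the lift of w_0 in the second conjugation as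
      well.\<close>
    have ug: "u \<otimes>\<^bsub>\<G>\<^esub> g = g \<otimes>\<^bsub>\<G>\<^esub> u" unfolding g_def
      by (intro G.commute_mult G.commute_inv) (use u(1,3) u(4)[OF y] yc in simp_all)
    have "(tb.z \<otimes>\<^bsub>AutoGroup \<G>\<^esub> tb.z) y = tb.z g"
      using yc z_x[OF y] by (simp add: tb.AutoGroup_apply tb.z_auto g_def)
    also have "\<dots> = tw js \<otimes>\<^bsub>\<G>\<^esub> g \<otimes>\<^bsub>\<G>\<^esub> inv\<^bsub>\<G>\<^esub> tw js"
      using yc z_x[OF y] z_tw[OF js_I]
      by (simp add: g_def auto_mult[OF tb.z_auto] G.auto_inv[OF tb.z_auto])
    also have "\<dots> = ?w \<otimes>\<^bsub>\<G>\<^esub> g \<otimes>\<^bsub>\<G>\<^esub> inv\<^bsub>\<G>\<^esub> ?w"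
      by (rule conj_tw_ws[OF u(1,2) gc ug, symmetric])
    also have "g = ?w \<otimes>\<^bsub>\<G>\<^esub> y \<otimes>\<^bsub>\<G>\<^esub> inv\<^bsub>\<G>\<^esub> ?w"
      unfolding g_def by (rule conj_tw_ws[OF u(1,2) yc u(4)[OF y], symmetric])
    finally show ?thesis using yc wc by (simp add: G.inv_mult_group G.m_assoc)
  qed
  show ?thesis
    by (rule tb.eq_on_gens[OF zz G.conj_aut_in_auto[OF ww] X x x x]) auto
qed

lemmas z_conj = z_eq_conj_if_minus_one[unfolded tb.c_def] z_sq_eq_conj[unfolded tb.c_def]

end

end

section \<open>The morphism to the outer automorphism group\<close>

lemma daa_hat_of_type:
  assumes A: "irreducible_affine_cartan n A" and t: "of_type t n A" "\<not> excluded_type t"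
    and js: "reduced_decomposition n A js (theta_refl n A)"
  shows "daa_hat n A js"
proof -
  have n: "1 \<le> n" using t by (cases t) (auto simp: of_type_def)
  interpret affine_root_data n A by (rule labels_of_type(1)[OF A t])
  interpret daa n A js by unfold_locales (use js n in auto)
  show ?thesis
  proof (cases "of_type (Aff_A2_even n) n A")
    case True
    \<comment> \<open>Here a_0 = 2; halving the last simple root puts theta / 2 into the lattice and
      gives the new basis vector squared length 1, the same as that of theta / 2.\<close>
    have lab: "labels n A i = (if i = n then 1 else 2)" "colabels n A i = (if i = 0 then 1 else 2)" if "i \<le> n" for i
      using labels_of_type(2,3)[OF A True _ that] by simp_all
    have h: "h i = (if i = n then 2 else 1)" for i using True by (simp add: h_def)
    show ?thesis
    proof
      show "labels n A 0 dvd labels n A i * h i" if "i \<in> I" for i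
        using that n by (simp add: lab h)
      show "int (h j) dvd A i j * int (h i)" if "i \<in> I" "j \<in> I" for i j
        using that A2_even_last_column[OF True, of i] by (auto simp: h)
      show "labels n A i * h i ^ 2 * colabels n A 0 \<le> colabels n A i * labels n A 0" if "i \<in> I" for i
        using that n by (simp add: lab h)
    qed
  next
    case False
    have v: "valid_type t" and r: "n = type_rank t" using t by (auto simp: of_type_def)
    have ne: "t \<noteq> Aff_A2_even (type_rank t)" using t(1) False r by metis
    have lab: "labels n A i \<le> colabels n A i" if "i \<le> n" for i
      using labels_of_type(2,3)[OF A t] kac_label_le_colabel(1)[OF v t(2) ne, of i] that r by simp
    have lab0: "labels n A 0 = 1" "colabels n A 0 = 1"
      using labels_of_type(2,3)[OF A t] kac_label_le_colabel(2)[OF v t(2) ne, of 0] kac_colabel_0[OF v] by simp_all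
    have h: "h i = 1" for i using False by (simp add: h_def)
    show ?thesis by unfold_locales (simp_all add: lab lab0 h)
  qed
qed

theorem corollary4p8:
  fixes n :: nat and A :: "nat \<Rightarrow> nat \<Rightarrow> int" and t :: affine_type
    and w\<^sub>0 :: "rvec \<Rightarrow> rvec" and js :: "nat list"
    and fa fb :: "daa_gen word set \<Rightarrow> daa_gen word set"
  assumes "irreducible_affine_cartan n A"
    and "of_type t n A" and "\<not> excluded_type t"
    and "longest_element n A w\<^sub>0"
    and "reduced_decomposition n A js (theta_refl n A)"
    and "is_aut_a n A js fa" and "is_aut_b n A js fb"
  shows "b3_action (daa_group n A) fa fb \<in> hom B3 (AutoGroup (daa_group n A)) \<and>
    b3_action (daa_group n A) fa fb (b3 BA) = fa \<and>
    b3_action (daa_group n A) fa fb (b3 BB) = fb \<and>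
    (acts_as_minus_one n w\<^sub>0 \<longrightarrow>
       (\<exists>\<phi>\<in>hom PSL2Z (OutGroup (daa_group n A)). \<forall>x\<in>carrier B3.
          \<phi> (psl_class (b3_to_SL2Z x)) =
          out_class (daa_group n A) (b3_action (daa_group n A) fa fb x))) \<and>
    (\<not> acts_as_minus_one n w\<^sub>0 \<longrightarrow>
       (\<exists>\<phi>\<in>hom SL2Z (OutGroup (daa_group n A)). \<forall>x\<in>carrier B3.
          \<phi> (b3_to_SL2Z x) =
          out_class (daa_group n A) (b3_action (daa_group n A) fa fb x)))"
proof -
  interpret daa_hat n A js by (rule daa_hat_of_type[OF assms(1-3,5)])
  obtain vs where vs: "vs \<in> lists I" "w\<^sub>0 = wp vs"
    and max: "\<And>v. v \<in> lists I \<Longrightarrow> ll v \<le> ll vs"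
    using assms(4) by (auto simp: longest_element_def finite_weyl_def)
  \<comment> \<open>The longest element is given as a map; its lift needs a reduced word, and
    maximality of length passes to that word because length depends on the map only.\<close>
  obtain ws where ws: "red ws" "wp ws = w\<^sub>0" using ex_red[OF vs(1)] vs(2) by metis
  interpret daa_longest n A js ws
    by unfold_locales (use ws vs max in auto)
  let ?Aut = "AutoGroup \<G>" and ?f = "b3_action \<G> fa fb"
  interpret Aut: group ?Aut by (rule G.AutoGroup)
  have fab: "fa \<in> auto \<G>" "fb \<in> auto \<G>" using assms(6,7) by (simp_all add: is_aut_a_def is_aut_b_def)
  have gen: "case_b3_gen fa fb g \<in> carrier ?Aut" for g
    using fab by (cases g rule: b3_gen.exhaust) simp_all
  have rel: "word_eval ?Aut (case_b3_gen fa fb) u = word_eval ?Aut (case_b3_gen fa fb) v"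
    if "(u, v) \<in> b3_rels" for u v
  proof -
    have "fa \<otimes>\<^bsub>?Aut\<^esub> (fb \<otimes>\<^bsub>?Aut\<^esub> fa) = fb \<otimes>\<^bsub>?Aut\<^esub> (fa \<otimes>\<^bsub>?Aut\<^esub> fb)"
      using braid_relation[OF assms(6,7)] Aut.m_assoc fab by simp
    thus ?thesis using that fab Aut.r_one[of fa] Aut.r_one[of fb] by (simp add: b3_rels_def)
  qed
  have hom: "?f \<in> hom B3 ?Aut"
    unfolding b3_action_def B3_def by (rule Aut.pres_lift_hom) (use gen rel in auto)
  have val: "?f (b3 g) = case_b3_gen fa fb g" for g
    unfolding b3_action_def b3_def
    by (subst Aut.pres_lift_class) (use gen[of g] gen rel Aut.r_one[of "case_b3_gen fa fb g"] in auto)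
  interpret f: group_hom B3 ?Aut ?f
    by (simp add: group_hom_def group_hom_axioms_def B3.is_group Aut.is_group hom)
  define F where "F = out_class \<G> \<circ> ?f"
  have F: "F \<in> hom B3 (OutGroup \<G>)"
    unfolding F_def by (rule hom_compose[OF hom G.out_class_hom])
  let ?c = "fa \<otimes>\<^bsub>?Aut\<^esub> fb \<otimes>\<^bsub>?Aut\<^esub> fa"
  have Z: "?f B3.Z = ?c \<otimes>\<^bsub>?Aut\<^esub> ?c"
    unfolding B3.Z_def B3.S_def by (simp add: val)
  note z = z_conj[OF assms(6,7)]
  have tc: "tw ws \<in> carrier \<G>" by (rule tw_closed[OF ws_I])
  have "\<exists>\<phi>\<in>hom PSL2Z (OutGroup \<G>). \<forall>x\<in>carrier B3. \<phi> (psl_class (b3_to_SL2Z x)) = F x"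
    if "acts_as_minus_one n w\<^sub>0"
  proof (rule factor_through_PSL2Z[OF G.group_OutGroup F])
    show "F B3.Z = \<one>\<^bsub>OutGroup \<G>\<^esub>"
      using z(1) that ws(2) G.out_class_conj_aut[OF tc] by (simp add: F_def Z)
  qed
  moreover have "\<exists>\<phi>\<in>hom SL2Z (OutGroup \<G>). \<forall>x\<in>carrier B3. \<phi> (b3_to_SL2Z x) = F x"
  proof (rule factor_through_SL2Z[OF G.group_OutGroup F])
    have "?f (B3.Z \<otimes>\<^bsub>B3\<^esub> B3.Z) = G.conj_aut (tw ws \<otimes>\<^bsub>\<G>\<^esub> tw ws)"
      using z(2) by (simp only: f.hom_mult B3.SUZ_closed Z)
    thus "F (B3.Z \<otimes>\<^bsub>B3\<^esub> B3.Z) = \<one>\<^bsub>OutGroup \<G>\<^esub>"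
      using G.out_class_conj_aut[OF G.m_closed[OF tc tc]] by (simp add: F_def)
  qed
  ultimately show ?thesis using hom val[of BA] val[of BB] by (simp add: F_def)
qed

end
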